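(* Let $d\ge1$, $0<\beta\le1$, and let $H=-\Delta+|x|^2$ on $\mathbb{R}^d$. For every fixed $T>0$ and every $t\in[0,T]$, the operator $K_\beta(t)=e^{-tH^\beta}$ is a pseudodifferential operator with Weyl symbol $b(t,\cdot)$ in the Shubin class $\Gamma^0_1(\mathbb{R}^{2d})$, with semi-norms uniformly bounded with respect to $t\in[0,T]$: for every $k\in\mathbb{N}$, $$\sup_{t\in[0,T]}|b(t,\cdot)|_k<\infty .$$
   Context: Notation: $\langle z\rangle=(1+|z|^2)^{1/2}$. Shubin class: $\Gamma_1^0(\mathbb{R}^{2d})$ consists of all $a\in C^\infty(\mathbb{R}^{2d})$ such that for every $\alpha\in\mathbb{N}^{2d}$ there is $C_\alpha\ge0$ with $|\partial^\alpha_z a(z)|\le C_\alpha\langle z\rangle^{-|\alpha|}$ for all $z\in\mathbb{R}^{2d}$. Its semi-norms are, for $k\in\mathbb{N}$, $$|a|_k=\sup_{|\alpha|+|\gamma|\le k}\ \sup_{(x,\xi)\in\mathbb{R}^{2d}}|\partial^\alpha_\xi\partial^\gamma_x a(x,\xi)|\,\langle(x,\xi)\rangle^{|\alpha|+|\gamma|}.$$ Hermite semigroup: $H=\sum_{k\ge0}(2k+d)P_k$, where $P_k$ is the orthogonal projection of $L^2(\mathbb{R}^d)$ onto the span of the Hermite functions $\Phi_\alpha$, $\alpha\in\mathbb{N}^d$, $|\alpha|=k$; $H^\beta=\sum_{k\ge0}(2k+d)^\beta P_k$ and $e^{-tH^\beta}=\sum_{k\ge0}e^{-t(2k+d)^\beta}P_k$.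 Weyl quantization: the Weyl operator with symbol $\sigma\in\mathcal{S}'(\mathbb{R}^{2d})$ is defined by $\langle \mathrm{Op}_{1/2}(\sigma)f,g\rangle=\langle\sigma,W_{1/2}(g,f)\rangle$ for $f,g\in\mathcal{S}(\mathbb{R}^d)$, where $W_{1/2}(f,g)(x,\omega)=\int_{\mathbb{R}^d}e^{-2\pi iy\omega}f(x+\tfrac y2)\overline{g(x-\tfrac y2)}\,dy$ and brackets are linear in the first and conjugate-linear in the second argument. (With this normalization $H$ has Weyl symbol $|x|^2+4\pi^2|\xi|^2$.) *)

theory Defs
  imports "HOL-Analysis.Analysis"
begin

section \<open>Smooth functions and multi-index derivatives\<close>

definition japanese :: "'a::real_normed_vector \<Rightarrow> real" where
  "japanese z = sqrt (1 + (norm z)\<^sup>2)"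

definition partial_deriv ::
  "'a::euclidean_space \<Rightarrow> ('a \<Rightarrow> complex) \<Rightarrow> 'a \<Rightarrow> complex" where
  "partial_deriv b f = (\<lambda>x. frechet_derivative f (at x) b)"

definition iter_partial ::
  "'a::euclidean_space list \<Rightarrow> ('a \<Rightarrow> complex) \<Rightarrow> 'a \<Rightarrow> complex" where
  "iter_partial bs f = foldr partial_deriv bs f"

text \<open>
  The class of smooth functions: every iterated partial derivative, in every order of
  differentiation, exists and is differentiable (hence continuous) on the whole space.
\<close>

definition smooth_fun :: "('a::euclidean_space \<Rightarrow> complex) \<Rightarrow> bool" where
  "smooth_fun f \<longleftrightarrow>
     (\<forall>bs. set bs \<subseteq> Basis \<longrightarrow> iter_partial bs f differentiable_on UNIV)"

text \<open>
  A multi-index on a Euclidean space is a function \<open>\<alpha>\<close> of which only the values on \<open>Basis\<close>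
  matter. As \<open>Basis\<close> is not ordered, a fixed enumeration of it fixes the order of the
  differentiations; for smooth functions the order is immaterial.
\<close>

definition basis_list :: "'a::euclidean_space list" where
  "basis_list = (SOME bs. distinct bs \<and> set bs = Basis)"

definition mi_order :: "('a::euclidean_space \<Rightarrow> nat) \<Rightarrow> nat" where
  "mi_order \<alpha> = (\<Sum>b\<in>Basis. \<alpha> b)"

definition mi_deriv ::
  "('a::euclidean_space \<Rightarrow> nat) \<Rightarrow> ('a \<Rightarrow> complex) \<Rightarrow> 'a \<Rightarrow> complex" where
  "mi_deriv \<alpha> f = iter_partial (concat (map (\<lambda>b. replicate (\<alpha> b) b) basis_list)) f"

section \<open>The Shubin class\<close>

text \<open>
  Phase space is \<open>(real^'n) \<times> (real^'n)\<close> with points \<open>(x, \<xi>)\<close>; its norm is the Euclidean norm,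
  and a multi-index on it is the pair of a multi-index in \<open>x\<close> and one in \<open>\<xi>\<close>.
\<close>

definition shubin_class :: "((real^'n) \<times> (real^'n) \<Rightarrow> complex) set" where
  "shubin_class = {a. smooth_fun a \<and>
     (\<forall>\<alpha>. \<exists>C\<ge>0. \<forall>z. norm (mi_deriv \<alpha> a z) \<le> C * japanese z powr (- real (mi_order \<alpha>)))}"

definition shubin_seminorm :: "nat \<Rightarrow> ((real^'n) \<times> (real^'n) \<Rightarrow> complex) \<Rightarrow> ennreal" where
  "shubin_seminorm k a =
     (SUP \<alpha>\<in>{\<alpha>. mi_order \<alpha> \<le> k}. SUP z.
        ennreal (norm (mi_deriv \<alpha> a z) * japanese z ^ mi_order \<alpha>))"

section \<open>Weyl quantization\<close>

definition schwartz :: "('a::euclidean_space \<Rightarrow> complex) set" where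
  "schwartz = {f. smooth_fun f \<and>
     (\<forall>\<alpha> N. \<exists>C. \<forall>x. japanese x ^ N * norm (mi_deriv \<alpha> f x) \<le> C)}"

definition bracket ::
  "('a::euclidean_space \<Rightarrow> complex) \<Rightarrow> ('a \<Rightarrow> complex) \<Rightarrow> complex" where
  "bracket f g = (LINT x|lborel. f x * cnj (g x))"

text \<open>
  A tempered distribution \<open>\<sigma>\<close> is represented by the conjugate-linear functional that maps
  a Schwartz function \<open>\<phi>\<close> to the bracket of \<open>\<sigma>\<close> with \<open>\<phi>\<close>. An ordinary function \<open>f\<close> acts as
  the functional \<open>bracket f\<close>.
\<close>

type_synonym 'a distr = "('a \<Rightarrow> complex) \<Rightarrow> complex"

definition wigner ::
  "(real^'n \<Rightarrow> complex) \<Rightarrow> (real^'n \<Rightarrow> complex) \<Rightarrow> (real^'n) \<times> (real^'n) \<Rightarrow> complex" where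
  "wigner f g = (\<lambda>(x, \<omega>). LINT y|lborel.
     exp (- 2 * complex_of_real pi * \<i> * complex_of_real (y \<bullet> \<omega>))
       * f (x + (1/2) *\<^sub>R y) * cnj (g (x - (1/2) *\<^sub>R y)))"

definition weyl_op ::
  "((real^'n) \<times> (real^'n)) distr \<Rightarrow> (real^'n \<Rightarrow> complex) \<Rightarrow> (real^'n) distr" where
  "weyl_op \<sigma> f = (\<lambda>g. \<sigma> (wigner g f))"

definition has_weyl_symbol ::
  "((real^'n \<Rightarrow> complex) \<Rightarrow> (real^'n \<Rightarrow> complex)) \<Rightarrow> ((real^'n) \<times> (real^'n) \<Rightarrow> complex) \<Rightarrow> bool" where
  "has_weyl_symbol K a \<longleftrightarrow>
     (\<forall>f\<in>schwartz. \<forall>g\<in>schwartz. bracket (K f) g = weyl_op (bracket a) f g)"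

section \<open>The Hermite semigroup\<close>

definition hermite_poly :: "nat \<Rightarrow> real \<Rightarrow> real" where
  "hermite_poly k x = (-1) ^ k * exp (x\<^sup>2) * (deriv ^^ k) (\<lambda>s. exp (- s\<^sup>2)) x"

definition hermite_fun1 :: "nat \<Rightarrow> real \<Rightarrow> real" where
  "hermite_fun1 k x = hermite_poly k x * exp (- x\<^sup>2 / 2) / sqrt (2 ^ k * fact k * sqrt pi)"

definition hermite_fun :: "('n::finite \<Rightarrow> nat) \<Rightarrow> real^'n \<Rightarrow> complex" where
  "hermite_fun \<alpha> x = complex_of_real (\<Prod>i\<in>UNIV. hermite_fun1 (\<alpha> i) (x $ i))"

text \<open>The complex linear span of the (finitely many) Hermite functions of degree \<open>k\<close>.\<close>

definition hermite_space :: "nat \<Rightarrow> (real^'n \<Rightarrow> complex) set" where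
  "hermite_space k =
     {(\<lambda>x. \<Sum>\<alpha> | (\<Sum>i\<in>UNIV. \<alpha> i) = k. c \<alpha> * hermite_fun \<alpha> x) | c. True}"

text \<open>
  Orthogonal projection onto \<open>hermite_space k\<close>. Elements of this space are continuous, so the
  projection is unique as a function and not only almost everywhere.
\<close>

definition hermite_proj :: "nat \<Rightarrow> (real^'n \<Rightarrow> complex) \<Rightarrow> real^'n \<Rightarrow> complex" where
  "hermite_proj k f =
     (THE p. p \<in> hermite_space k \<and> (\<forall>h\<in>hermite_space k. bracket (\<lambda>x. f x - p x) h = 0))"

definition L2 :: "('a::euclidean_space \<Rightarrow> complex) set" where
  "L2 = {f. f \<in> borel_measurable lborel \<and> integrable lborel (\<lambda>x. (norm (f x))\<^sup>2)}"

definition L2_lim :: "(nat \<Rightarrow> 'a::euclidean_space \<Rightarrow> complex) \<Rightarrow> ('a \<Rightarrow> complex) \<Rightarrow> bool" where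
  "L2_lim F g \<longleftrightarrow> g \<in> L2 \<and> (\<forall>N. F N \<in> L2) \<and>
     (\<lambda>N. LINT x|lborel. (norm (F N x - g x))\<^sup>2) \<longlonglongrightarrow> 0"

text \<open>
  The sum over \<open>k\<close> converges in \<open>L2\<close>; its value is defined up to a null set, and \<open>SOME\<close> picks
  a representative.
\<close>

definition hermite_semigroup ::
  "real \<Rightarrow> real \<Rightarrow> (real^'n \<Rightarrow> complex) \<Rightarrow> real^'n \<Rightarrow> complex" where
  "hermite_semigroup \<beta> t f = (SOME g. L2_lim
     (\<lambda>N x. \<Sum>k<N. complex_of_real (exp (- t * real (2 * k + CARD('n)) powr \<beta>))
                      * hermite_proj k f x) g)"

end

theory Submission
  imports Defs "HOL-Probability.Probability" "HOL-Real_Asymp.Real_Asymp"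
begin

text \<open>
  By Mehler's formula \<open>\<Sum>\<^sub>k r\<^sup>k P\<^sub>k\<close>, for \<open>0 \<le> r \<le> 1\<close>, has the Weyl symbol
  \<open>(2 / (1 + r))\<^sup>d exp (- c Q)\<close> with \<open>c = (1 - r) / (1 + r)\<close> and \<open>Q (x, \<xi>) = |x|\<^sup>2 + 4 \<pi>\<^sup>2 |\<xi>|\<^sup>2\<close>.
  Since \<open>\<lambda> \<mapsto> exp (- t \<lambda>\<^sup>\<beta>)\<close> is completely monotone for \<open>\<beta> \<le> 1\<close>, Hausdorff's moment theorem writes
  \<open>exp (- t (2 k + d)\<^sup>\<beta>)\<close> as \<open>exp (- t d\<^sup>\<beta>)\<close> times the \<open>k\<close>-th moment of a probability measure on
  \<open>[0, 1]\<close>. So the semigroup is an average of the operators \<open>\<Sum>\<^sub>k r\<^sup>k P\<^sub>k\<close> and its symbol is the same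
  average of their symbols. As \<open>0 \<le> c \<le> 1\<close>, the functions \<open>exp (- c Q)\<close> are bounded in the Shubin
  class uniformly in \<open>r\<close>, and an average over a probability measure keeps these bounds, whatever \<open>t\<close> is.
\<close>

section \<open>Completely monotone functions and Hausdorff moments\<close>

text \<open>What must be uniform is the decay of derivatives as c tends to 0, where exp (- c Q)
  flattens and loses its own decay. Each derivative in Q brings a factor c, and (c (1 + q))^m exp (-
  c q) stays below m! e for all c in [0, 1]. These factors supply exactly the decay of order zero,
  with constants that do not see the measure; so the measures may be found for each t separately.

  Only the values at the eigenvalues 2 k + d occur, so moments on [0, 1] take the place of a Laplace
  representation, with r standing for exp (- 2 s). Dividing by the value at k = 0 makes the mass 1,
  and the factor split off is at most 1.

  The Weyl identity is tested on Schwartz functions: both sides are shown to be sums of one and the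
  same series in the numbers <P_k f, g>.\<close>

primrec completely_monotone_upto :: "nat \<Rightarrow> (real \<Rightarrow> real) \<Rightarrow> bool" where
  "completely_monotone_upto 0 f = (\<forall>x>0. 0 \<le> f x)"
| "completely_monotone_upto (Suc n) f = ((\<forall>x>0. 0 \<le> f x) \<and>
     (\<exists>g. (\<forall>x>0. (f has_real_derivative - g x) (at x)) \<and> completely_monotone_upto n g))"

lemma cm_SucI:
  assumes "\<And>x. x > 0 \<Longrightarrow> 0 \<le> f x"
    and "\<And>x. x > 0 \<Longrightarrow> (f has_real_derivative - g x) (at x)"
    and "completely_monotone_upto n g"
  shows "completely_monotone_upto (Suc n) f"
  using assms by auto

lemma cm_nonneg: "completely_monotone_upto n f \<Longrightarrow> x > 0 \<Longrightarrow> 0 \<le> f x"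
  by (cases n) auto

lemma cm_SucD: "completely_monotone_upto (Suc n) f \<Longrightarrow> completely_monotone_upto n f"
  by (induction n arbitrary: f) auto

lemma cm_add:
  "completely_monotone_upto n f \<Longrightarrow> completely_monotone_upto n g \<Longrightarrow>
     completely_monotone_upto n (\<lambda>x. f x + g x)"
proof (induction n arbitrary: f g)
  case (Suc n)
  from Suc.prems obtain f' g' where d: "\<forall>x>0. (f has_real_derivative - f' x) (at x)"
      "\<forall>x>0. (g has_real_derivative - g' x) (at x)"
    and cm: "completely_monotone_upto n f'" "completely_monotone_upto n g'" by auto
  show ?case
    by (rule cm_SucI[OF _ _ Suc.IH[OF cm]])
       (use Suc.prems d in \<open>auto intro!: derivative_eq_intros\<close>)
qed auto

text \<open>Since the witnesses are minus the derivatives, the Leibniz rule has only plus signs. The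
  undifferentiated factors are brought down to the same order by \<open>cm_SucD\<close>.\<close>

lemma cm_mult:
  "completely_monotone_upto n f \<Longrightarrow> completely_monotone_upto n g \<Longrightarrow>
     completely_monotone_upto n (\<lambda>x. f x * g x)"
proof (induction n arbitrary: f g)
  case (Suc n)
  from Suc.prems obtain f' g' where d: "\<forall>x>0. (f has_real_derivative - f' x) (at x)"
      "\<forall>x>0. (g has_real_derivative - g' x) (at x)"
    and cm: "completely_monotone_upto n f'" "completely_monotone_upto n g'" by auto
  have "completely_monotone_upto n (\<lambda>x. f' x * g x + f x * g' x)"
    using cm_SucD[OF Suc.prems(1)] cm_SucD[OF Suc.prems(2)] cm by (intro cm_add Suc.IH)
  then show ?case
    by (rule cm_SucI[rotated 2])
       (use Suc.prems d in \<open>auto intro!: derivative_eq_intros simp: algebra_simps\<close>)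
qed auto

lemma cm_const: "0 \<le> c \<Longrightarrow> completely_monotone_upto n (\<lambda>_. c)"
proof (induction n arbitrary: c)
  case (Suc n)
  show ?case
    by (rule cm_SucI[OF _ _ Suc.IH[of 0]]) (use Suc.prems in auto)
qed auto

text \<open>The family x^(-a), a \<ge> 0, is closed under minus the derivative up to the constant a,
  so the induction runs over all a at once.\<close>

lemma cm_powr: "0 \<le> a \<Longrightarrow> completely_monotone_upto n (\<lambda>x. x powr (- a))"
proof (induction n arbitrary: a)
  case (Suc n)
  have "completely_monotone_upto n (\<lambda>x. a * x powr (- (a + 1)))"
    using Suc.prems by (intro cm_mult cm_const Suc.IH) auto
  then show ?case
  proof (rule cm_SucI[rotated 2])
    fix x :: real assume "x > 0"
    then have "((\<lambda>x. x powr (- a)) has_real_derivative (- a) * x powr (- a - 1)) (at x)"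
      by (rule has_real_derivative_powr)
    moreover have "- a - 1 = - (a + 1)" by simp
    ultimately show "((\<lambda>x. x powr (- a)) has_real_derivative - (a * x powr (- (a + 1)))) (at x)"
      by (simp only: mult_minus_left)
  qed auto
qed auto

text \<open>Minus the derivative is t \<beta> x^(-(1 - \<beta>)) times the function itself, so the
  product rule raises the order by one. The exponent 1 - \<beta> must be nonnegative, which is where
  \<beta> \<le> 1 enters.\<close>

lemma cm_exp_powr:
  assumes "0 \<le> t" "0 \<le> \<beta>" "\<beta> \<le> 1"
  shows "completely_monotone_upto n (\<lambda>x. exp (- t * x powr \<beta>))"
proof (induction n)
  case (Suc n)
  have "completely_monotone_upto n (\<lambda>x. t * \<beta> * x powr (- (1 - \<beta>)) * exp (- t * x powr \<beta>))"
    using assms by (intro cm_mult cm_const Suc.IH cm_powr) auto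
  then show ?case
    by (rule cm_SucI[rotated 2]) (auto intro!: derivative_eq_intros simp: algebra_simps)
qed auto

lemma antimono_of_derivative:
  assumes "\<And>x. x > 0 \<Longrightarrow> (f has_real_derivative - g x) (at x)" "\<And>x. x > 0 \<Longrightarrow> 0 \<le> g x"
    and "0 < x" "0 \<le> h"
  shows "f (x + h) \<le> f (x :: real)"
proof (rule DERIV_nonpos_imp_nonincreasing[where f = f and a = x and b = "x + h"])
  fix y assume "x \<le> y"
  then show "\<exists>z. (f has_real_derivative z) (at y) \<and> z \<le> 0"
    using assms by (intro exI[of _ "- g y"]) auto
qed (use assms in auto)

text \<open>A difference commutes with the derivative, so only nonnegativity has to be seen; it
  follows from monotonicity and costs one order.\<close>

lemma cm_diff:
  assumes "0 \<le> h"
  shows "completely_monotone_upto (Suc n) f \<Longrightarrow> completely_monotone_upto n (\<lambda>x. f x - f (x + h))"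
proof (induction n arbitrary: f)
  case (0 f)
  then obtain g where d: "\<forall>x>0. (f has_real_derivative - g x) (at x)" and g: "\<forall>x>0. 0 \<le> g x"
    by auto
  have "f (x + h) \<le> f x" if "x > 0" for x
    using d g that assms by (intro antimono_of_derivative[of f g]) auto
  then show ?case by auto
next
  case (Suc n f)
  then obtain g where d: "\<forall>x>0. (f has_real_derivative - g x) (at x)"
    and g: "completely_monotone_upto (Suc n) g" by auto
  have "((\<lambda>x. f x - f (x + h)) has_real_derivative - (g x - g (x + h))) (at x)" if "x > 0" for x
  proof -
    have "(f has_real_derivative - g (x + h)) (at (x + h))"
      using d that assms by auto
    then have "((\<lambda>x. f (x + h)) has_real_derivative - g (x + h)) (at x)"
      by (simp add: DERIV_shift)
    then show ?thesis using d that by (auto intro!: derivative_eq_intros)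
  qed
  moreover have "0 \<le> f x - f (x + h)" if "x > 0" for x
  proof -
    have "f (x + h) \<le> f x"
      using d cm_nonneg[OF g] that assms by (intro antimono_of_derivative[of f g]) auto
    then show ?thesis by simp
  qed
  ultimately show ?case by (intro cm_SucI[OF _ _ Suc.IH[OF g]])
qed

section \<open>Iterated differences and the Hausdorff moment problem\<close>

primrec back_diff :: "(nat \<Rightarrow> real) \<Rightarrow> nat \<Rightarrow> nat \<Rightarrow> real" where
  "back_diff m 0 k = m k"
| "back_diff m (Suc n) k = back_diff m n k - back_diff m n (Suc k)"

text \<open>Taking the new difference on the innermost sequence instead of the outermost lets
  \<open>cm_diff\<close> act on the sampled function in \<open>back_diff_nonneg\<close>.\<close>

lemma back_diff_Suc': "back_diff m (Suc n) k = back_diff (\<lambda>k. m k - m (Suc k)) n k"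
  by (induction n arbitrary: k) auto

lemma back_diff_nonneg:
  assumes "0 < d" "completely_monotone_upto n f"
  shows "0 \<le> back_diff (\<lambda>k. f (d + 2 * real k)) n k"
  using assms(2)
proof (induction n arbitrary: f k)
  case 0
  then show ?case using \<open>0 < d\<close> by auto
next
  case (Suc n)
  from Suc.IH[OF cm_diff[of 2, OF _ Suc.prems]] show ?case
    unfolding back_diff_Suc' by (simp add: algebra_simps)
qed

text \<open>For moments m of a measure on [0, 1], \<open>back_diff m n k\<close> is the integral of
  x^k (1 - x)^n, and the identity is x^a (1 - x)^l (x + (1 - x))^N = x^a (1 - x)^l. For an arbitrary
  sequence it follows from Pascal's rule.\<close>

lemma sum_back_diff:
  "(\<Sum>i\<le>N. real (N choose i) * back_diff m (N - i + l) (a + i)) = back_diff m l a"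
proof (induction N arbitrary: l)
  case (Suc N)
  have "(\<Sum>i\<le>Suc N. real (Suc N choose i) * back_diff m (Suc N - i + l) (a + i)) =
     back_diff m (Suc N + l) a + (\<Sum>i\<le>N. real (Suc N choose Suc i) * back_diff m (N - i + l) (Suc a + i))"
    by (subst sum.atMost_Suc_shift) simp
  also have "(\<Sum>i\<le>N. real (Suc N choose Suc i) * back_diff m (N - i + l) (Suc a + i)) =
     (\<Sum>i\<le>N. real (N choose i) * back_diff m (N - i + l) (Suc a + i))
     + (\<Sum>i\<le>N. real (N choose Suc i) * back_diff m (N - i + l) (Suc a + i))"
    by (simp add: algebra_simps sum.distrib)
  also have "back_diff m (Suc N + l) a + \<dots> = 
     (\<Sum>i\<le>N. real (N choose i) * back_diff m (N - i + l) (Suc a + i)) +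
     (back_diff m (Suc N + l) a + (\<Sum>i\<le>N. real (N choose Suc i) * back_diff m (N - i + l) (Suc a + i)))"
    by simp
  also have "(back_diff m (Suc N + l) a + (\<Sum>i\<le>N. real (N choose Suc i) * back_diff m (N - i + l) (Suc a + i)))
     = (\<Sum>i\<le>Suc N. real (N choose i) * back_diff m (Suc N - i + l) (a + i))"
    by (subst sum.atMost_Suc_shift) simp
  also have "\<dots> = (\<Sum>i\<le>N. real (N choose i) * back_diff m (Suc N - i + l) (a + i))"
    by simp
  also have "(\<Sum>i\<le>N. real (N choose i) * back_diff m (N - i + l) (Suc a + i)) + \<dots> =
     (\<Sum>i\<le>N. real (N choose i) * back_diff m (N - i + l) (a + i))"
    by (subst sum.distrib[symmetric], rule sum.cong) (auto simp: Suc_diff_le algebra_simps)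
  finally show ?case using Suc.IH by simp
qed simp


text \<open>The ratio is a product of factors (k - i) / (n - i), each close to k / n; exchanging
  them one at a time is stable because all factors have modulus at most 1. The bound is uniform in k
  and vanishes as n grows, so binomial moments and power moments have the same limit.\<close>

lemma binomial_ratio_bound:
  assumes "k \<le> n" "2 * j \<le> n" "0 < n"
  shows "\<bar>(real k / real n) ^ j - real (k choose j) / real (n choose j)\<bar> \<le> real j * real j / (real n - real j)"
proof -
  have A: "real (k choose j) / real (n choose j) = (\<Prod>i<j. (real k - real i) / (real n - real i))"
    by (simp add: binomial_gbinomial gbinomial_prod_rev prod_dividef atLeast0LessThan)
  have "\<bar>(real k / real n) ^ j - real (k choose j) / real (n choose j)\<bar> 
    = norm ((\<Prod>i<j. real k / real n) - (\<Prod>i<j. (real k - real i) / (real n - real i)))"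
    unfolding A by simp
  also have "\<dots> \<le> (\<Sum>i<j. norm (real k / real n - (real k - real i) / (real n - real i)))"
  proof (rule norm_prod_diff)
    \<comment> \<open>For i > k the numerator k - i is negative; its modulus stays below n - i
      because \<open>2 * j \<le> n\<close>.\<close>
    fix i assume "i \<in> {..<j}"
    then show "norm (real k / real n) \<le> 1" "norm ((real k - real i) / (real n - real i)) \<le> 1"
      using assms by (auto simp: divide_le_eq abs_le_iff)
  qed
  also have "\<dots> \<le> (\<Sum>i<j. real j / (real n - real j))"
  proof (rule sum_mono)
    fix i assume i: "i \<in> {..<j}"
    have "real k / real n - (real k - real i) / (real n - real i) = 
        real i * ((real n - real k) / real n) / (real n - real i)"
      using i assms by (simp add: field_simps)
    then have "norm (real k / real n - (real k - real i) / (real n - real i)) =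
        real i * ((real n - real k) / real n) / (real n - real i)"
      using i assms by simp
    also have "\<dots> \<le> real j / (real n - real j)"
    proof (rule frac_le)
      have "real i * ((real n - real k) / real n) \<le> real i * 1"
        using assms by (intro mult_left_mono) auto
      then show "real i * ((real n - real k) / real n) \<le> real j" using i by simp
    qed (use i assms in auto)
    finally show "norm (real k / real n - (real k - real i) / (real n - real i)) \<le> real j / (real n - real j)" .
  qed
  finally show ?thesis by simp
qed

text \<open>The approximating measures put the mass of the \<open>k\<close>-th Bernstein coefficient at \<open>k / n\<close>.\<close>

theorem hausdorff_moment:
  assumes nonneg: "\<And>n k. 0 \<le> back_diff m n k" and m0: "m 0 = 1"
  shows "\<exists>M. real_distribution M \<and> (AE x in M. 0 \<le> x \<and> x \<le> 1) \<and> (\<forall>j. (LINT x|M. x ^ j) = m j)"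
proof -
  define w where "w n k = real (n choose k) * back_diff m (n - k) k" for n k
  \<comment> \<open>The index is shifted to \<open>Suc n\<close> so that the denominator is never
    zero.\<close>
  define X where "X n k = real k / real (Suc n)" for n k :: nat
  define P where "P n = point_measure {..Suc n} (\<lambda>k. ennreal (w (Suc n) k))" for n
  have w_nonneg: "0 \<le> w n k" for n k
    using nonneg by (simp add: w_def)
  have w_sum: "(\<Sum>k\<le>n. w n k) = 1" for n
    using sum_back_diff[of n m 0 0] by (simp add: w_def m0)
  have prob: "prob_space (P n)" for n
    using w_sum[of "Suc n"] w_nonneg
    by (intro prob_spaceI)
       (simp add: P_def space_point_measure emeasure_point_measure_finite sum_ennreal del: sum.atMost_Suc)
  define \<mu> where "\<mu> n = distr (P n) borel (X n)" for n
  have X_meas: "X n \<in> borel_measurable (P n)" for n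
    by (simp add: P_def)
  have real_\<mu>: "real_distribution (\<mu> n)" for n
    unfolding \<mu>_def using prob_space.real_distribution_distr[OF prob X_meas] .
  have int_\<mu>: "(LINT x|\<mu> n. f x) = (\<Sum>k\<le>Suc n. w (Suc n) k * f (X n k))"
    if "f \<in> borel_measurable borel" for f :: "real \<Rightarrow> real" and n
    unfolding \<mu>_def P_def using that w_nonneg
    by (subst integral_distr) (auto simp: lebesgue_integral_point_measure_finite)
  have X01: "0 \<le> X n k \<and> X n k \<le> 1" if "k \<le> Suc n" for n k
    using that by (simp add: X_def divide_le_eq)
  have \<mu>01: "AE x in \<mu> n. 0 \<le> x \<and> x \<le> 1" for n
  proof -
    have "AE k in P n. 0 \<le> X n k \<and> X n k \<le> 1"
      unfolding P_def AE_point_measure using X01 by blast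
    then show ?thesis
      unfolding \<mu>_def by (subst AE_distr_iff[OF X_meas]) auto
  qed
  have tight: "tight \<mu>"
    unfolding tight_def
  proof (intro conjI allI impI real_\<mu>)
    fix e :: real assume "e > 0"
    \<comment> \<open>The left end is -1 because \<open>tight\<close> uses intervals open on the
      left and there may be mass at 0.\<close>
    have "measure (\<mu> n) {-1<..1} = 1" for n
    proof -
      interpret real_distribution "\<mu> n" by (rule real_\<mu>)
      show ?thesis using \<mu>01[of n] by (intro prob_eq_1[THEN iffD2]) auto
    qed
    with \<open>e > 0\<close> show "\<exists>a b. a < b \<and> (\<forall>n. measure (\<mu> n) {a<..b} > 1 - e)"
      by (intro exI[of _ "-1"] exI[of _ 1]) auto
  qed
  from tight_imp_convergent_subsubsequence[OF tight strict_mono_id]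
  obtain r M where r: "strict_mono r" and M: "real_distribution M" and conv: "weak_conv_m (\<mu> \<circ> r) M"
    by auto
  interpret M: real_distribution M by (rule M)
  have lim: "(\<lambda>n. LINT x|\<mu> (r n). f x) \<longlonglongrightarrow> (LINT x|M. f x)"
    if "continuous_on UNIV f" "\<And>x. norm (f x) \<le> B" for f :: "real \<Rightarrow> real" and B
    using weak_conv_imp_integral_bdd_continuous_conv[of "\<mu> \<circ> r" M f B] real_\<mu> M conv that
    by (auto simp: continuous_on_eq_continuous_at)
  \<comment> \<open>Weak convergence tests only bounded continuous functions, and x^j is unbounded
    on the line; the clamp \<open>c\<close> replaces x by its nearest point in [0, 1].
    \<open>D\<close> below, bounded, continuous and zero exactly on [0, 1], carries the support over
    to the limit.\<close>
  define c where "c x = max 0 (min 1 x)" for x :: real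
  have c_cont: "continuous_on UNIV c" unfolding c_def by (intro continuous_intros)
  have c01: "0 \<le> c x" "c x \<le> 1" for x by (auto simp: c_def)
  define D where "D x = min 1 \<bar>x - c x\<bar>" for x
  have D_cont: "continuous_on UNIV D" unfolding D_def by (intro continuous_intros c_cont)
  have [measurable]: "c \<in> borel_measurable borel" "D \<in> borel_measurable borel"
    using c_cont D_cont by (auto intro: borel_measurable_continuous_onI)
  have D_bd: "norm (D x) \<le> 1" for x by (auto simp: D_def)
  have "(LINT x|\<mu> n. D x) = 0" for n
  proof -
    have "(LINT x|\<mu> n. D x) = (LINT x|\<mu> n. 0)"
      by (rule integral_cong_AE) (use \<mu>01[of n] in \<open>auto simp: \<mu>_def D_def c_def elim!: AE_mp\<close>)
    then show ?thesis by simp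
  qed
  with lim[OF D_cont D_bd] have "(LINT x|M. D x) = 0"
    by (simp add: LIMSEQ_const_iff)
  moreover have "integrable M D"
    by (rule M.integrable_const_bound[of _ 1]) (use D_bd in auto)
  ultimately have "AE x in M. D x = 0"
    by (subst (asm) integral_nonneg_eq_0_iff_AE) (auto simp: D_def)
  then have M01: "AE x in M. 0 \<le> x \<and> x \<le> 1"
    by (rule AE_mp) (auto simp: D_def c_def split: if_splits)
  have "(LINT x|M. x ^ j) = m j" for j
  proof -
    have "(\<lambda>n. LINT x|\<mu> (r n). c x ^ j) \<longlonglongrightarrow> (LINT x|M. c x ^ j)"
      by (rule lim[of _ 1]) (use c01 in \<open>auto intro!: continuous_intros c_cont simp: power_le_one\<close>)
    moreover have "(LINT x|M. c x ^ j) = (LINT x|M. x ^ j)"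
      by (rule integral_cong_AE) (use M01 in \<open>auto simp: c_def elim!: AE_mp\<close>)
    moreover have "(\<lambda>n. LINT x|\<mu> n. c x ^ j) \<longlonglongrightarrow> m j"
    proof (rule LIM_zero_cancel, rule Lim_null_comparison)
      show "(\<lambda>n. real j * real j / (real (Suc n) - real j)) \<longlonglongrightarrow> 0" by real_asymp
      show "\<forall>\<^sub>F n in sequentially. norm ((LINT x|\<mu> n. c x ^ j) - m j)
              \<le> real j * real j / (real (Suc n) - real j)"
        using eventually_ge_at_top[of "2 * j"]
      proof eventually_elim
        case (elim n)
        define N where "N = Suc n"
        have N: "2 * j \<le> N" "0 < N" using elim by (auto simp: N_def)
        have "(LINT x|\<mu> n. c x ^ j) = (\<Sum>k\<le>N. w N k * (real k / real N) ^ j)"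
        proof (subst int_\<mu>)
          show "(\<Sum>k\<le>Suc n. w (Suc n) k * c (X n k) ^ j) = (\<Sum>k\<le>N. w N k * (real k / real N) ^ j)"
            unfolding N_def[symmetric]
          proof (rule sum.cong)
            fix k assume "k \<in> {..N}"
            then have "c (X n k) = X n k" using X01[of k n] by (auto simp: c_def N_def)
            then show "w N k * c (X n k) ^ j = w N k * (real k / real N) ^ j"
              by (simp add: X_def N_def)
          qed simp
        qed simp
        \<comment> \<open>The moment is an exact average of binomial ratios:
          \<open>sum_back_diff\<close> expands x^j (x + (1 - x))^(N - j), and
          \<open>choose_mult\<close> turns the coefficients into the weights
          \<open>w N k\<close>.\<close>
        moreover have "m j = (\<Sum>k\<le>N. w N k * (real (k choose j) / real (N choose j)))"
        proof -
          have "m j = (\<Sum>i\<le>N - j. real (N - j choose i) * back_diff m (N - j - i + 0) (j + i))"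
            unfolding sum_back_diff by simp
          also have "\<dots> = (\<Sum>k=j..N. real (N - j choose (k - j)) * back_diff m (N - k) k)"
            using N by (intro sum.reindex_bij_witness[of _ "\<lambda>k. k - j" "\<lambda>i. j + i"]) auto
          also have "\<dots> = (\<Sum>k=j..N. w N k * (real (k choose j) / real (N choose j)))"
          proof (rule sum.cong)
            fix k assume k: "k \<in> {j..N}"
            then have "real (N choose k) * real (k choose j) = real (N choose j) * real (N - j choose (k - j))"
              using choose_mult[of j k N] by (simp flip: of_nat_mult)
            then show "real (N - j choose (k - j)) * back_diff m (N - k) k
                = w N k * (real (k choose j) / real (N choose j))"
              using N by (simp add: w_def field_simps)
          qed simp
          also have "\<dots> = (\<Sum>k\<le>N. w N k * (real (k choose j) / real (N choose j)))"
            by (rule sum.mono_neutral_left) auto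
          finally show ?thesis .
        qed
        ultimately have "norm ((LINT x|\<mu> n. c x ^ j) - m j)
          = \<bar>\<Sum>k\<le>N. w N k * ((real k / real N) ^ j - real (k choose j) / real (N choose j))\<bar>"
          by (simp add: sum_subtractf right_diff_distrib)
        also have "\<dots> \<le> (\<Sum>k\<le>N. \<bar>w N k * ((real k / real N) ^ j - real (k choose j) / real (N choose j))\<bar>)"
          by (rule sum_abs)
        also have "\<dots> \<le> (\<Sum>k\<le>N. w N k * (real j * real j / (real N - real j)))"
          unfolding abs_mult abs_of_nonneg[OF w_nonneg]
          by (intro sum_mono mult_left_mono w_nonneg binomial_ratio_bound N) auto
        also have "\<dots> = real j * real j / (real N - real j)"
          unfolding sum_distrib_right[symmetric] w_sum by simp
        finally show ?case by (simp add: N_def)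
      qed
    qed
    ultimately show ?thesis
      using LIMSEQ_subseq_LIMSEQ[OF _ r, of "\<lambda>n. LINT x|\<mu> n. c x ^ j" "m j"] LIMSEQ_unique
      by (fastforce simp: o_def)
  qed
  with M M01 show ?thesis by blast
qed

text \<open>Sampling starts at d > 0 because complete monotonicity is stated on x > 0 only; for 0 <
  \<beta> < 1 the derivative of x^\<beta> blows up at 0.\<close>

lemma subordination_moments:
  assumes "0 \<le> t" "0 \<le> \<beta>" "\<beta> \<le> 1" "0 < d"
  shows "\<exists>M. real_distribution M \<and> (AE x in M. 0 \<le> x \<and> x \<le> 1) \<and>
    (\<forall>k. exp (- t * real (2 * k + d) powr \<beta>) = exp (- t * real d powr \<beta>) * (LINT x|M. x ^ k))"
proof -
  define c where "c = exp (- t * real d powr \<beta>)"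
  define f where "f x = inverse c * exp (- t * x powr \<beta>)" for x
  have c: "c > 0" by (simp add: c_def)
  have cm: "completely_monotone_upto n f" for n
    unfolding f_def using assms c by (intro cm_mult cm_const cm_exp_powr) auto
  have "0 \<le> back_diff (\<lambda>k. f (real d + 2 * real k)) n k" for n k
    using assms cm by (intro back_diff_nonneg) auto
  moreover have "f (real d + 2 * real 0) = 1"
    using c by (simp add: f_def c_def)
  ultimately obtain M where M: "real_distribution M" "AE x in M. 0 \<le> x \<and> x \<le> 1"
    and mom: "\<And>j. (LINT x|M. x ^ j) = f (real d + 2 * real j)"
    using hausdorff_moment[of "\<lambda>k. f (real d + 2 * real k)"] by auto
  have "exp (- t * real (2 * k + d) powr \<beta>) = c * (LINT x|M. x ^ k)" for k
    using c unfolding mom f_def by (simp add: add.commute)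
  with M show ?thesis unfolding c_def by blast
qed

section \<open>Integration over Euclidean spaces\<close>

lemma lborel_prod_Basis:
  fixes f :: "'a::euclidean_space \<Rightarrow> real \<Rightarrow> 'c::{real_normed_field,banach,second_countable_topology}"
  assumes "\<And>b. b \<in> Basis \<Longrightarrow> integrable lborel (f b)"
  shows "integrable lborel (\<lambda>x. \<Prod>b\<in>Basis. f b (x \<bullet> b))" (is ?A)
    and "(LINT x|lborel. (\<Prod>b\<in>Basis. f b (x \<bullet> b))) = (\<Prod>b\<in>Basis. LINT x|lborel. f b x)" (is ?B)
proof -
  interpret product_sigma_finite "\<lambda>_::'a. lborel :: real measure" ..
  let ?S = "\<lambda>f :: 'a \<Rightarrow> real. \<Sum>b\<in>Basis. f b *\<^sub>R b"
  have [measurable]: "f b \<in> borel_measurable borel" if "b \<in> Basis" for b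
    using borel_measurable_integrable[OF assms[OF that]] by simp
  have S: "?S \<in> measurable (\<Pi>\<^sub>M b\<in>Basis. lborel) borel" by measurable
  have F: "(\<lambda>x. \<Prod>b\<in>Basis. f b (x \<bullet> b)) \<in> borel_measurable borel" by measurable
  have eq: "(\<Prod>b\<in>Basis. f b (?S g \<bullet> b)) = (\<Prod>b\<in>Basis. f b (g b))" for g
    by (intro prod.cong) auto
  show ?A
    by (subst lborel_eq, subst integrable_distr_eq[OF S F])
       (simp only: eq, intro product_integrable_prod finite_Basis assms)
  show ?B
    by (subst lborel_eq, subst integral_distr[OF S F])
       (simp only: eq, intro product_integral_prod finite_Basis assms)
qed

lemma lborel_prod_vec:
  fixes f :: "'n::finite \<Rightarrow> real \<Rightarrow> 'c::{real_normed_field,banach,second_countable_topology}"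
  assumes "\<And>i. integrable lborel (f i)"
  shows "integrable lborel (\<lambda>x::real^'n. \<Prod>i\<in>UNIV. f i (x $ i))" (is ?A)
    and "(LINT x|lborel. (\<Prod>i\<in>UNIV. f i ((x::real^'n) $ i))) = (\<Prod>i\<in>UNIV. LINT x|lborel. f i x)" (is ?B)
proof -
  \<comment> \<open>The version for \<open>Basis\<close> is indexed by vectors; \<open>g\<close>
    recovers the coordinate i from \<open>axis i 1\<close>.\<close>
  define g where "g b = f (THE i. b = axis i 1)" for b :: "real^'n"
  have g: "g (axis i 1) = f i" for i
    unfolding g_def by (rule arg_cong[of _ _ f]) (auto simp: axis_eq_axis)
  have B: "Basis = (\<lambda>i::'n. axis i (1::real)) ` UNIV" by (auto simp: Basis_vec_def)
  have inj: "inj (\<lambda>i::'n. axis i (1::real))" by (auto simp: inj_on_def axis_eq_axis)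
  have re: "(\<Prod>b\<in>Basis. h b) = (\<Prod>i\<in>UNIV. h (axis i 1))" for h :: "real^'n \<Rightarrow> 'c"
    unfolding B by (subst prod.reindex[OF inj]) simp
  have int: "integrable lborel (g b)" if "b \<in> Basis" for b
    using that assms unfolding B by (auto simp: g)
  note L = lborel_prod_Basis[of g, OF int]
  show ?A using L(1) by (simp add: re g cart_eq_inner_axis)
  show ?B using L(2) by (simp add: re g cart_eq_inner_axis)
qed

lemma integrable_prod_vec_inverse_square:
  "integrable lborel (\<lambda>x::real^'n. \<Prod>i\<in>UNIV. inverse (1 + (x $ i)\<^sup>2))"
  using integrable_inverse_1_plus_square
  by (intro lborel_prod_vec) (simp add: set_integrable_def einterval_def)

lemma lborel_affine_integrable:
  fixes f :: "'a::euclidean_space \<Rightarrow> 'b::{banach, second_countable_topology}"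
  assumes "c \<noteq> 0" "integrable lborel f"
  shows "integrable lborel (\<lambda>x. f (t + c *\<^sub>R x))"
proof -
  have m: "f \<in> borel_measurable borel" using borel_measurable_integrable[OF assms(2)] by simp
  have "integrable (density (distr lborel borel (\<lambda>x. t + c *\<^sub>R x)) (\<lambda>_. \<bar>c\<bar>^DIM('a))) f"
    using lborel_affine[OF assms(1), of t] assms(2) by simp
  then have "integrable lborel (\<lambda>x. \<bar>c\<bar>^DIM('a) *\<^sub>R f (t + c *\<^sub>R x))" using m
    by (subst (asm) integrable_density) (auto simp: integrable_distr_eq)
  from integrable_scaleR_right[OF this, of "inverse (\<bar>c\<bar>^DIM('a))"] show ?thesis
    using assms(1) by simp
qed

lemma lborel_affine_integral:
  fixes f :: "'a::euclidean_space \<Rightarrow> 'b::{banach, second_countable_topology}"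
  assumes "c \<noteq> 0" and m: "f \<in> borel_measurable borel"
  shows "(LINT x|lborel. f (t + c *\<^sub>R x)) = (LINT x|lborel. f x) /\<^sub>R \<bar>c\<bar> ^ DIM('a)"
proof -
  have "(LINT x|lborel. f x) = (LINT x|density (distr lborel borel (\<lambda>x. t + c *\<^sub>R x)) (\<lambda>_. \<bar>c\<bar>^DIM('a)). f x)"
    using lborel_affine[OF assms(1), of t] by simp
  also have "\<dots> = \<bar>c\<bar>^DIM('a) *\<^sub>R (LINT x|lborel. f (t + c *\<^sub>R x))"
    using assms(1) m by (subst integral_density) (auto simp: integral_distr)
  finally show ?thesis using assms(1) by simp
qed

text \<open>
  Integrating the fundamental theorem of calculus along \<open>b\<close> over the whole space leaves only
  translation invariance of the Lebesgue measure, so \<open>G\<close> need not decay pointwise.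
\<close>

lemma integral_directional_derivative_zero:
  fixes G G' :: "'a::euclidean_space \<Rightarrow> 'b::euclidean_space"
  assumes der: "\<And>y. ((\<lambda>s. G (y + s *\<^sub>R b)) has_vector_derivative G' y) (at 0)"
    and cont: "continuous_on UNIV G'"
    and int: "integrable lborel G" "integrable lborel G'"
  shows "(LINT y|lborel. G' y) = 0"
proof -
  have [measurable]: "G \<in> borel_measurable borel" "G' \<in> borel_measurable borel"
    using int[THEN borel_measurable_integrable] by auto
  have int': "integrable lborel (\<lambda>y. G' (y + s *\<^sub>R b))" for s
    using lborel_affine_integrable[OF _ int(2), of 1 "s *\<^sub>R b"] by (simp add: add.commute)
  have eq': "(LINT y|lborel. H (y + s *\<^sub>R b)) = (LINT y|lborel. H y)"
    if [measurable]: "H \<in> borel_measurable borel" for s and H :: "'a \<Rightarrow> 'c::euclidean_space"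
    using lborel_affine_integral[of 1 H "s *\<^sub>R b"] by (simp add: add.commute)
  have der': "((\<lambda>s. G (y + s *\<^sub>R b)) has_vector_derivative G' (y + s *\<^sub>R b)) (at s within S)" for y s S
  proof -
    have "((\<lambda>h. G ((y + s *\<^sub>R b) + (h - s) *\<^sub>R b)) has_vector_derivative 1 *\<^sub>R G' (y + s *\<^sub>R b)) (at s)"
      by (rule vector_diff_chain_at[of "\<lambda>h. h - s" 1 s "\<lambda>h. G ((y + s *\<^sub>R b) + h *\<^sub>R b)", unfolded o_def])
         (use der[of "y + s *\<^sub>R b"] in \<open>auto intro!: derivative_eq_intros\<close>)
    then show ?thesis by (simp add: algebra_simps has_vector_derivative_at_within)
  qed
  have ftc: "(LINT s|lborel. indicator {0..1} s *\<^sub>R G' (y + s *\<^sub>R b)) = G (y + 1 *\<^sub>R b) - G (y + 0 *\<^sub>R b)" for y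
  proof (rule integral_FTC_Icc)
    show "continuous_on {0..1} (\<lambda>s. G' (y + s *\<^sub>R b))"
      by (rule continuous_on_compose2[OF cont]) (auto intro!: continuous_intros)
  qed (use der' in auto)
  \<comment> \<open>Joint integrability for Fubini: by translation invariance the inner integral of
    the norm does not depend on s, and s is confined to [0, 1].\<close>
  have P: "integrable (lborel \<Otimes>\<^sub>M lborel) (\<lambda>(s, y). indicator {0..1::real} s *\<^sub>R G' (y + s *\<^sub>R b))"
  proof (rule lborel_pair.Fubini_integrable)
    have "(\<lambda>s. LINT y|lborel. norm (case (s, y) of (s, y) \<Rightarrow> indicator {0..1} s *\<^sub>R G' (y + s *\<^sub>R b)))
       = (\<lambda>s. indicator {0..1} s *\<^sub>R (LINT y|lborel. norm (G' y)))"
      by (auto simp: fun_eq_iff eq'[of "\<lambda>y. norm (G' y)"] split: split_indicator)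
    then show "integrable lborel (\<lambda>s. LINT y|lborel. norm (case (s, y) of (s, y) \<Rightarrow> indicator {0..1} s *\<^sub>R G' (y + s *\<^sub>R b)))"
      by (auto intro!: integrable_real_mult_indicator)
  qed (use int' in auto)
  have "0 = (LINT y|lborel. G (y + 1 *\<^sub>R b)) - (LINT y|lborel. G (y + 0 *\<^sub>R b))"
    by (subst (1 2) eq') auto
  also have "\<dots> = (LINT y|lborel. G (y + 1 *\<^sub>R b) - G (y + 0 *\<^sub>R b))"
    using int(1) lborel_affine_integrable[OF _ int(1), of 1 b]
    by (subst Bochner_Integration.integral_diff) (auto simp: add.commute)
  also have "\<dots> = (LINT y|lborel. LINT s|lborel. indicator {0..1} s *\<^sub>R G' (y + s *\<^sub>R b))"
    by (simp only: ftc)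
  also have "\<dots> = (LINT s|lborel. LINT y|lborel. indicator {0..1} s *\<^sub>R G' (y + s *\<^sub>R b))"
    using lborel_pair.Fubini_integral[OF P] by simp
  also have "\<dots> = (LINT s|lborel. indicator {0..1::real} s *\<^sub>R (LINT y|lborel. G' y))"
    by (simp add: eq')
  also have "\<dots> = (LINT y|lborel. G' y)"
    by simp
  finally show ?thesis by simp
qed

text \<open>Up to the scaling x = c u with c^2 = 2 a this is the characteristic function of the
  standard normal distribution at b / c.\<close>

lemma gaussian_fourier:
  fixes a b :: real
  assumes "0 < a"
  shows "integrable lborel (\<lambda>u. exp (complex_of_real (- a * u\<^sup>2) + \<i> * complex_of_real (b * u)))" (is ?A)
    and "(LINT u|lborel. exp (complex_of_real (- a * u\<^sup>2) + \<i> * complex_of_real (b * u)))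
       = complex_of_real (sqrt (pi / a) * exp (- b\<^sup>2 / (4 * a)))" (is ?B)
proof -
  define c where "c = sqrt (2 * a)"
  have c: "c > 0" "c\<^sup>2 = 2 * a" using assms by (auto simp: c_def)
  define F where "F x = std_normal_density x *\<^sub>R iexp ((b / c) * x)" for x
  have Fm: "F \<in> borel_measurable borel" unfolding F_def by measurable
  have Fi: "integrable lborel F"
    unfolding F_def
    by (rule Bochner_Integration.integrable_bound[OF integrable_std_normal_moment[of 0]]) auto
  have E: "F (0 + c *\<^sub>R u) = complex_of_real (1 / sqrt (2 * pi)) * exp (complex_of_real (- a * u\<^sup>2) + \<i> * complex_of_real (b * u))" for u
  proof -
    have "(c * u)\<^sup>2 / 2 = a * u\<^sup>2" "b / c * (c * u) = b * u"
      using c by (auto simp: power_mult_distrib)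
    then show ?thesis
      unfolding F_def std_normal_density_def exp_add scaleR_conv_of_real by (simp flip: exp_of_real)
  qed
  have "(LINT x|lborel. F x) = char std_normal_distribution (b / c)"
    unfolding char_def F_def by (subst integral_density) auto
  also have "\<dots> = complex_of_real (exp (- b\<^sup>2 / (4 * a)))"
    unfolding char_std_normal_distribution using c by (simp add: power_divide)
  finally have I: "(LINT x|lborel. F x) = complex_of_real (exp (- b\<^sup>2 / (4 * a)))" .
  have "integrable lborel (\<lambda>u. F (0 + c *\<^sub>R u))"
    by (rule lborel_affine_integrable[OF _ Fi]) (use c in auto)
  from integrable_mult_right[OF this[unfolded E], of "complex_of_real (sqrt (2 * pi))"] show ?A
    by simp
  have "(LINT u|lborel. F (0 + c *\<^sub>R u)) = complex_of_real (exp (- b\<^sup>2 / (4 * a))) /\<^sub>R c"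
    using lborel_affine_integral[OF _ Fm, of c 0] c I by simp
  then show ?B unfolding E using c assms
    by (simp add: scaleR_conv_of_real real_sqrt_mult real_sqrt_divide c_def field_simps)
qed

lemma lborel_pair_mult:
  fixes f :: "'a::euclidean_space \<Rightarrow> 'c::{real_normed_field,banach,second_countable_topology}"
    and g :: "'b::euclidean_space \<Rightarrow> 'c"
  assumes "integrable lborel f" "integrable lborel g"
  shows "integrable (lborel \<Otimes>\<^sub>M lborel) (\<lambda>(x, y). f x * g y)" (is ?A)
    and "(LINT p|(lborel \<Otimes>\<^sub>M lborel). (case p of (x, y) \<Rightarrow> f x * g y)) = (LINT x|lborel. f x) * (LINT y|lborel. g y)" (is ?B)
proof -
  have [measurable]: "f \<in> borel_measurable borel" "g \<in> borel_measurable borel"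
    using assms[THEN borel_measurable_integrable] by auto
  show A: ?A
    by (rule lborel_pair.Fubini_integrable) (use assms in \<open>auto simp: norm_mult\<close>)
  show ?B using lborel_pair.integral_fst'[OF A] by simp
qed

section \<open>Hermite functions of one variable and the Mehler formula\<close>

text \<open>The physicists' Hermite polynomials, generated by the rule for differentiating H_k exp
  (- s^2). As formal polynomials they are open to \<open>pderiv\<close>.\<close>

primrec herm :: "nat \<Rightarrow> real poly" where
  "herm 0 = 1"
| "herm (Suc k) = [:0, 2:] * herm k - pderiv (herm k)"

lemma deriv_gaussian: "(deriv ^^ k) (\<lambda>s::real. exp (- s\<^sup>2)) = (\<lambda>s. (-1) ^ k * poly (herm k) s * exp (- s\<^sup>2))"
proof (induction k)
  case (Suc k)
  have "((\<lambda>s. (-1) ^ k * poly (herm k) s * exp (- s\<^sup>2)) has_real_derivative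
      (-1) ^ Suc k * poly (herm (Suc k)) s * exp (- s\<^sup>2)) (at s)" for s
    by (auto intro!: derivative_eq_intros poly_DERIV simp: algebra_simps power2_eq_square)
  then show ?case by (simp only: funpow.simps o_apply Suc.IH) (auto intro!: DERIV_imp_deriv)
qed simp

lemma hermite_poly_eq: "hermite_poly k x = poly (herm k) x"
proof -
  have "(-1 :: real) ^ k * (-1) ^ k = 1" "exp (x\<^sup>2) * exp (- x\<^sup>2) = 1"
    by (simp_all flip: power_mult_distrib exp_add)
  moreover have "(-1) ^ k * exp (x\<^sup>2) * ((-1) ^ k * poly (herm k) x * exp (- x\<^sup>2))
     = ((-1) ^ k * (-1) ^ k) * (exp (x\<^sup>2) * exp (- x\<^sup>2)) * poly (herm k) x"
    by (simp only: ac_simps)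
  ultimately show ?thesis unfolding hermite_poly_def deriv_gaussian by simp
qed

text \<open>Differentiating the recursion leaves 2 H_k + 2 x H_k' - H_k''; by the induction
  hypothesis and the recursion one step lower the last two terms are 2 k H_k. At k = 0 the truncated
  index \<open>k - 1\<close> is harmless because its coefficient is 0.\<close>

lemma pderiv_herm: "pderiv (herm k) = smult (2 * real k) (herm (k - 1))"
proof (induction k)
  case (Suc k)
  have "pderiv (herm (Suc k)) = smult 2 (herm k) + ([:0, 2:] * pderiv (herm k) - pderiv (pderiv (herm k)))"
    by (simp add: pderiv_diff pderiv_mult pderiv_pCons pderiv_smult)
  also have "[:0, 2:] * pderiv (herm k) - pderiv (pderiv (herm k)) = smult (2 * real k) (herm k)"
    unfolding Suc.IH by (cases k) (simp_all add: pderiv_smult smult_diff_right)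
  finally show ?case by (simp add: smult_add_left[symmetric] algebra_simps)
qed simp

lemma herm_rec: "poly (herm (Suc k)) x = 2 * x * poly (herm k) x - 2 * real k * poly (herm (k - 1)) x"
  by (simp add: pderiv_herm)

lemma integrable_power_gaussian: "integrable lborel (\<lambda>x::real. x ^ k * exp (- x\<^sup>2))"
proof (rule Bochner_Integration.integrable_bound)
  show "integrable lborel (\<lambda>x. sqrt (2 * pi) * (std_normal_density x * \<bar>x\<bar> ^ k))"
    by (intro integrable_mult_right integrable_std_normal_moment_abs)
  show "AE x in lborel. norm (x ^ k * exp (- x\<^sup>2)) \<le> norm (sqrt (2 * pi) * (std_normal_density x * \<bar>x\<bar> ^ k))"
    unfolding mult.commute[of "x ^ k" "exp _" for x]
    by (intro AE_I2) (auto simp: std_normal_density_def abs_mult power_abs intro!: mult_right_mono)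
qed auto

lemma integrable_poly_gaussian: "integrable lborel (\<lambda>x::real. poly p x * exp (- x\<^sup>2))"
  unfolding poly_altdef sum_distrib_right mult.assoc
  by (intro Bochner_Integration.integrable_sum integrable_mult_right integrable_power_gaussian)

lemma integral_gaussian: "(LINT x|lborel. exp (- (x::real)\<^sup>2)) = sqrt pi"
proof -
  have int: "integrable lborel (\<lambda>x::real. exp (- x\<^sup>2))"
    using integrable_power_gaussian[of 0] by simp
  have "complex_of_real (LINT x|lborel. exp (- (x::real)\<^sup>2)) = (LINT x|lborel. complex_of_real (exp (- x\<^sup>2)))"
    using int by (rule integral_of_real[symmetric])
  also have "\<dots> = (LINT x|lborel. exp (complex_of_real (- 1 * x\<^sup>2) + \<i> * complex_of_real (0 * x)))"
    by (simp flip: exp_of_real)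
  also have "\<dots> = complex_of_real (sqrt pi)"
    unfolding gaussian_fourier(2)[OF zero_less_one] by simp
  finally show ?thesis by (simp only: of_real_eq_iff)
qed

text \<open>The derivative of H_j H_k exp (- x^2) is (2 j H_(j-1) H_k - H_j H_(k+1)) exp (- x^2),
  and it integrates to zero.\<close>

lemma integral_herm_Suc:
  "(LINT x|lborel. poly (herm j) x * poly (herm (Suc k)) x * exp (- x\<^sup>2)) =
     2 * real j * (LINT x|lborel. poly (herm (j - 1)) x * poly (herm k) x * exp (- x\<^sup>2))"
proof -
  let ?A = "\<lambda>x. poly (herm j) x * poly (herm (Suc k)) x * exp (- x\<^sup>2)"
  let ?B = "\<lambda>x. poly (herm (j - 1)) x * poly (herm k) x * exp (- x\<^sup>2)"
  have i: "integrable lborel ?A" "integrable lborel ?B"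
    using integrable_poly_gaussian[of "herm j * herm (Suc k)"] integrable_poly_gaussian[of "herm (j - 1) * herm k"]
    by auto
  have "(LINT x|lborel. 2 * real j * ?B x - ?A x) = 0"
  proof (rule integral_directional_derivative_zero[where b = 1])
    show "((\<lambda>s. poly (herm j * herm k) (y + s *\<^sub>R 1) * exp (- (y + s *\<^sub>R 1)\<^sup>2))
        has_vector_derivative 2 * real j * ?B y - ?A y) (at 0)" for y
      unfolding has_real_derivative_iff_has_vector_derivative[symmetric]
      by (auto intro!: derivative_eq_intros poly_DERIV DERIV_chain2[where f = "poly _"]
          simp: pderiv_herm algebra_simps power2_eq_square)
    show "integrable lborel (\<lambda>x. poly (herm j * herm k) x * exp (- x\<^sup>2))"
      by (rule integrable_poly_gaussian)
  qed (use i in \<open>auto intro!: continuous_intros\<close>)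
  then show ?thesis using i by (simp add: mult.assoc)
qed

lemma integral_herm:
  "(LINT x|lborel. poly (herm j) x * poly (herm k) x * exp (- x\<^sup>2)) = (if j = k then 2 ^ k * fact k * sqrt pi else 0)"
proof (induction k arbitrary: j)
  case 0
  show ?case
  proof (cases j)
    case 0
    then show ?thesis by (simp add: integral_gaussian)
  next
    case (Suc i)
    then show ?thesis using integral_herm_Suc[of 0 i] by (simp add: mult.commute)
  qed
next
  case (Suc k)
  then show ?case unfolding integral_herm_Suc by (cases j) auto
qed

lemma hermite_fun1_eq: "hermite_fun1 k x = poly (herm k) x * exp (- x\<^sup>2 / 2) / sqrt (2 ^ k * fact k * sqrt pi)"
  by (simp add: hermite_fun1_def hermite_poly_eq)

lemma hermite_fun1_mult:
  "hermite_fun1 j x * hermite_fun1 k x = poly (herm j) x * poly (herm k) x * exp (- x\<^sup>2) /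
     (sqrt (2 ^ j * fact j * sqrt pi) * sqrt (2 ^ k * fact k * sqrt pi))"
  by (simp add: hermite_fun1_eq flip: exp_add)

lemma hermite_fun1_orthonormal:
  shows "integrable lborel (\<lambda>x. hermite_fun1 j x * hermite_fun1 k x)" (is ?A)
    and "(LINT x|lborel. hermite_fun1 j x * hermite_fun1 k x) = (if j = k then 1 else 0)" (is ?B)
proof -
  show ?A using integrable_poly_gaussian[of "herm j * herm k"]
    by (simp add: hermite_fun1_mult)
  have "sqrt pi > 0" by simp
  then have "2 ^ k * fact k * sqrt pi > 0" by (intro mult_pos_pos) auto
  then show ?B
    by (simp add: hermite_fun1_mult integral_herm)
qed

lemma has_vector_derivative_shift_0:
  assumes "(f has_vector_derivative D) (at u)"
  shows "((\<lambda>s. f (u + s)) has_vector_derivative D) (at (0::real))"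
proof -
  have "((\<lambda>s. u + s) has_vector_derivative 1) (at 0)"
    by (auto intro!: derivative_eq_intros)
  from vector_diff_chain_at[OF this, of f D] assms show ?thesis by (simp add: o_def)
qed

section \<open>Hermite polynomials as complex Gaussian moments\<close>

definition gauss_moment :: "nat \<Rightarrow> real \<Rightarrow> complex" where
  "gauss_moment k x = (LINT u|lborel. (of_real x + \<i> * of_real u) ^ k * of_real (exp (- u\<^sup>2)))"

lemma integrable_gauss_moment:
  "integrable lborel (\<lambda>u. (of_real x + \<i> * of_real u) ^ k * complex_of_real (exp (- u\<^sup>2)))"
proof (rule Bochner_Integration.integrable_bound)
  \<comment> \<open>The polynomial is 1 + |x| + u^2, which dominates |x| + |u|.\<close>
  show "integrable lborel (\<lambda>u. poly ([:1 + \<bar>x\<bar>, 0, 1:] ^ k) u * exp (- u\<^sup>2))"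
    by (rule integrable_poly_gaussian)
  show "AE u in lborel. norm ((of_real x + \<i> * of_real u) ^ k * complex_of_real (exp (- u\<^sup>2)))
      \<le> norm (poly ([:1 + \<bar>x\<bar>, 0, 1:] ^ k) u * exp (- u\<^sup>2))"
  proof (intro AE_I2)
    fix u
    have "norm (complex_of_real x + \<i> * of_real u) \<le> \<bar>x\<bar> + \<bar>u\<bar>"
      by (rule order_trans[OF norm_triangle_ineq]) (simp add: norm_mult)
    moreover have "\<bar>u\<bar> \<le> 1 + u\<^sup>2"
      using zero_le_power2[of "\<bar>u\<bar> - 1"] by (simp add: power2_diff)
    ultimately have "norm (complex_of_real x + \<i> * of_real u) \<le> \<bar>1 + \<bar>x\<bar> + u * u\<bar>"
      by (simp add: power2_eq_square)
    then show "norm ((of_real x + \<i> * of_real u) ^ k * complex_of_real (exp (- u\<^sup>2)))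
      \<le> norm (poly ([:1 + \<bar>x\<bar>, 0, 1:] ^ k) u * exp (- u\<^sup>2))"
      by (auto simp: norm_mult norm_power poly_power power_abs algebra_simps intro!: power_mono)
  qed
qed auto

text \<open>With z = x + i u, the u-derivative of z^k exp (- u^2) is 2 i (z^(k+1) - x z^k + (k/2)
  z^(k-1)) exp (- u^2), because u = - i (z - x); its integral vanishes.\<close>

lemma gauss_moment_Suc:
  "gauss_moment (Suc k) x = of_real x * gauss_moment k x - of_nat k / 2 * gauss_moment (k - 1) x"
proof -
  let ?z = "\<lambda>u. complex_of_real x + \<i> * of_real u"
  let ?g = "\<lambda>k u. ?z u ^ k * complex_of_real (exp (- u\<^sup>2))"
  note int = integrable_gauss_moment[of x]
  have D: "(LINT u|lborel. 2 * \<i> * (?g (Suc k) u - of_real x * ?g k u + of_nat k / 2 * ?g (k - 1) u)) = 0"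
  proof (rule integral_directional_derivative_zero[where b = 1 and G = "?g k"])
    have "((\<lambda>w. (of_real x + \<i> * w) ^ k * exp (- w\<^sup>2)) has_field_derivative
       2 * \<i> * (?g (Suc k) u - of_real x * ?g k u + of_nat k / 2 * ?g (k - 1) u)) (at (complex_of_real u))" for u
      by (auto intro!: derivative_eq_intros simp: algebra_simps power2_eq_square simp flip: exp_of_real)
    from has_vector_derivative_real_field[OF this, of u UNIV for u]
    have "(?g k has_vector_derivative
       2 * \<i> * (?g (Suc k) u - of_real x * ?g k u + of_nat k / 2 * ?g (k - 1) u)) (at u)" for u
      by (simp flip: exp_of_real)
    from has_vector_derivative_shift_0[OF this]
    show "((\<lambda>s. ?g k (u + s *\<^sub>R 1)) has_vector_derivative
       2 * \<i> * (?g (Suc k) u - of_real x * ?g k u + of_nat k / 2 * ?g (k - 1) u)) (at 0)" for u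
      by simp
    show "integrable lborel (\<lambda>u. 2 * \<i> * (?g (Suc k) u - of_real x * ?g k u + of_nat k / 2 * ?g (k - 1) u))"
      by (intro integrable_mult_right Bochner_Integration.integrable_diff
          Bochner_Integration.integrable_add int)
  qed (auto intro!: continuous_intros int)
  have "(LINT u|lborel. ?g (Suc k) u - of_real x * ?g k u + of_nat k / 2 * ?g (k - 1) u) =
     gauss_moment (Suc k) x - of_real x * gauss_moment k x + of_nat k / 2 * gauss_moment (k - 1) x"
    unfolding gauss_moment_def using int[of "Suc k"] int[of k] int[of "k - 1"] by simp
  with D have "2 * \<i> * (gauss_moment (Suc k) x - of_real x * gauss_moment k x + of_nat k / 2 * gauss_moment (k - 1) x) = 0"
    by (simp only: integral_mult_right_zero)
  then have "gauss_moment (Suc k) x - of_real x * gauss_moment k x + of_nat k / 2 * gauss_moment (k - 1) x = 0"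
    unfolding mult_eq_0_iff by simp
  then show ?thesis by (simp add: algebra_simps)
qed

text \<open>Both sides obey the three-term recurrence \<open>herm_rec\<close>. On the right k
  appears only as an exponent under the integral, so generating series can be summed there.\<close>

lemma herm_eq_gauss_moment: "complex_of_real (poly (herm k) x) = 2 ^ k / of_real (sqrt pi) * gauss_moment k x"
proof (induction k rule: less_induct)
  case (less k)
  show ?case
  proof (cases k)
    case 0
    have "gauss_moment 0 x = of_real (LINT u|lborel. exp (- u\<^sup>2))"
      by (simp add: gauss_moment_def)
    then show ?thesis using 0 by (simp add: integral_gaussian)
  next
    case (Suc n)
    show ?thesis
    proof (cases n)
      case 0
      with Suc less[of 0] show ?thesis by (simp add: gauss_moment_Suc pderiv_pCons)
    next
      case (Suc m)
      have "complex_of_real (poly (herm (Suc n)) x) = 2 * of_real x * of_real (poly (herm n) x)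
              - 2 * of_nat n * of_real (poly (herm m) x)"
        unfolding herm_rec using Suc by simp
      also have "\<dots> = 2 * of_real x * (2 ^ n / of_real (sqrt pi) * gauss_moment n x)
              - 2 * of_nat n * (2 ^ m / of_real (sqrt pi) * gauss_moment m x)"
        using less[of n] less[of m] \<open>k = Suc n\<close> Suc by simp
      also have "\<dots> = 2 ^ Suc n / of_real (sqrt pi) * gauss_moment (Suc n) x"
        unfolding gauss_moment_Suc using Suc by (simp add: field_simps)
      finally show ?thesis using \<open>k = Suc n\<close> by simp
    qed
  qed
qed


text \<open>The Mehler kernel, written in x + y and x - y: at the points x + y/2 and x - y/2 of the
  Weyl correspondence these become 2 x and y, and the two variables separate.\<close>

definition mehler :: "real \<Rightarrow> real \<Rightarrow> real \<Rightarrow> real" where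
  "mehler r x y = exp (- ((1 - r) / (1 + r) * (x + y)\<^sup>2 / 4) - (1 + r) / (1 - r) * (x - y)\<^sup>2 / 4)
     / sqrt (pi * (1 - r\<^sup>2))"

lemma gaussian_integral_2d:
  fixes x y r :: real
  assumes r: "0 \<le> r" "r < 1"
  defines "E \<equiv> \<lambda>(u, v). exp (2 * of_real r * (of_real x + \<i> * of_real u) * (of_real y + \<i> * of_real v))
               * complex_of_real (exp (- u\<^sup>2) * exp (- v\<^sup>2))"
  assumes int: "integrable (lborel \<Otimes>\<^sub>M lborel) E"
  shows "(LINT p|(lborel \<Otimes>\<^sub>M lborel). E p)
     = of_real (pi / sqrt (1 - r\<^sup>2) * exp (2 * r * x * y - r\<^sup>2 * y\<^sup>2 - r\<^sup>2 * (x - r * y)\<^sup>2 / (1 - r\<^sup>2)))"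
proof -
  have r2: "0 < 1 - r\<^sup>2" using r by (simp add: power_less_one_iff abs_square_less_1)
  define F where "F w = exp (complex_of_real (- 1 * w\<^sup>2) + \<i> * complex_of_real (2 * r * y * w))" for w
  define A where "A = complex_of_real (sqrt pi * exp (2 * r * x * y - r\<^sup>2 * y\<^sup>2))"
  define C where "C v = exp (complex_of_real (2 * r * x * y + r\<^sup>2 * v\<^sup>2 - v\<^sup>2) + \<i> * complex_of_real (2 * r * (x - r * y) * v))" for v
  \<comment> \<open>Completing the square, - u^2 - 2 r u v = - (u + r v)^2 + r^2 v^2. The shift of u
    decouples the variables and leaves a Gaussian in v with coefficient 1 - r^2, positive because r
    < 1.\<close>
  have eq: "E (u, v) = C v * F (r * v + 1 *\<^sub>R u)" for u v
    unfolding E_def C_def F_def exp_of_real[symmetric] prod.case of_real_mult exp_add[symmetric]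
    by (rule arg_cong[of _ _ exp]) (simp add: algebra_simps power2_eq_square)
  have Fm: "F \<in> borel_measurable borel" unfolding F_def by measurable
  have inner: "(LINT u|lborel. E (u, v)) = C v * of_real (sqrt pi * exp (- (r\<^sup>2 * y\<^sup>2)))" for v
  proof -
    have "(LINT u|lborel. E (u, v)) = C v * (LINT u|lborel. F (r * v + 1 *\<^sub>R u))"
      unfolding eq by simp
    also have "(LINT u|lborel. F (r * v + 1 *\<^sub>R u)) = (LINT u|lborel. F u)"
      using lborel_affine_integral[OF _ Fm, of 1 "r * v"] by simp
    also have "\<dots> = of_real (sqrt pi * exp (- (r\<^sup>2 * y\<^sup>2)))"
      unfolding F_def using gaussian_fourier(2)[of 1 "2 * r * y"] by (simp add: power_mult_distrib)
    finally show ?thesis .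
  qed
  have C: "C v * of_real (sqrt pi * exp (- (r\<^sup>2 * y\<^sup>2)))
      = A * exp (complex_of_real (- (1 - r\<^sup>2) * v\<^sup>2) + \<i> * complex_of_real (2 * r * (x - r * y) * v))" for v
    unfolding A_def C_def of_real_mult exp_of_real[symmetric]
    by (simp add: mult.commute[of "exp _" "of_real (sqrt pi)"] mult.assoc flip: exp_add)
       (simp add: algebra_simps)
  have "(LINT p|(lborel \<Otimes>\<^sub>M lborel). E p) = (LINT v|lborel. LINT u|lborel. E (u, v))"
    using lborel_pair.integral_snd[of "\<lambda>u v. E (u, v)"] int by simp
  also have "\<dots> = A * (LINT v|lborel. exp (complex_of_real (- (1 - r\<^sup>2) * v\<^sup>2) + \<i> * complex_of_real (2 * r * (x - r * y) * v)))"
    unfolding inner C by simp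
  also have "\<dots> = A * of_real (sqrt (pi / (1 - r\<^sup>2)) * exp (- (2 * r * (x - r * y))\<^sup>2 / (4 * (1 - r\<^sup>2))))"
    unfolding gaussian_fourier(2)[OF r2] ..
  also have "\<dots> = of_real ((sqrt pi * sqrt pi) / sqrt (1 - r\<^sup>2) * (exp (2 * r * x * y - r\<^sup>2 * y\<^sup>2) * exp (- (2 * r * (x - r * y))\<^sup>2 / (4 * (1 - r\<^sup>2)))))"
    unfolding A_def of_real_mult[symmetric] by (rule arg_cong[of _ _ of_real]) (simp add: real_sqrt_divide)
  also have "exp (2 * r * x * y - r\<^sup>2 * y\<^sup>2) * exp (- (2 * r * (x - r * y))\<^sup>2 / (4 * (1 - r\<^sup>2)))
     = exp (2 * r * x * y - r\<^sup>2 * y\<^sup>2 - r\<^sup>2 * (x - r * y)\<^sup>2 / (1 - r\<^sup>2))"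
    unfolding exp_add[symmetric] by (simp add: power_mult_distrib del: right_diff_distrib_numeral)
  finally show ?thesis by (simp only: real_sqrt_mult_self abs_of_pos[OF pi_gt_zero])
qed

text \<open>
  With both Hermite polynomials written as Gaussian moments, the series becomes an exponential series
  under a double Gaussian integral.
\<close>

lemma mehler_herm:
  fixes x y r :: real
  assumes r: "0 \<le> r" "r < 1"
  shows "(\<lambda>k. r ^ k * poly (herm k) x * poly (herm k) y / (2 ^ k * fact k)) sums
     (exp (2 * r * x * y - r\<^sup>2 * y\<^sup>2 - r\<^sup>2 * (x - r * y)\<^sup>2 / (1 - r\<^sup>2)) / sqrt (1 - r\<^sup>2))" 
proof -
  let ?a = "\<lambda>u. complex_of_real x + \<i> * of_real u" and ?b = "\<lambda>v. complex_of_real y + \<i> * of_real v"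
  let ?g = "\<lambda>u v. complex_of_real (exp (- u\<^sup>2) * exp (- v\<^sup>2))"
  let ?M = "lborel \<Otimes>\<^sub>M lborel :: (real \<times> real) measure"
  define z where "z = (\<lambda>(u, v). 2 * of_real r * ?a u * ?b v)"
  define T where "T k = (\<lambda>(u, v). (z (u, v) ^ k /\<^sub>R fact k) * ?g u v)" for k
  \<comment> \<open>From 2 |a| |b| \<le> |a|^2 + |b|^2 the exponential series is dominated by exp (r
    (x^2 + u^2 + y^2 + v^2)); against the Gaussian weight this leaves exp (- (1 - r) u^2) and the
    same in v, integrable because r < 1.\<close>
  define D where "D = (\<lambda>(u, v). exp (r * (x\<^sup>2 + y\<^sup>2)) * (exp (- (1 - r) * u\<^sup>2) * exp (- (1 - r) * v\<^sup>2)))"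
  define E where "E = (\<lambda>(u, v). exp (2 * of_real r * ?a u * ?b v) * ?g u v)"
  have gi: "integrable lborel (\<lambda>u::real. exp (- (1 - r) * u\<^sup>2))"
    using integrable_norm[OF gaussian_fourier(1)[of "1 - r" 0]] r by simp
  have Di: "integrable ?M D"
    using integrable_mult_right[OF lborel_pair_mult(1)[OF gi gi], of "exp (r * (x\<^sup>2 + y\<^sup>2))"]
    by (simp add: D_def case_prod_unfold)
  have zD: "exp (norm (z (u, v))) * norm (?g u v) \<le> D (u, v)" for u v
  proof -
    have "norm (z (u, v)) = r * (2 * (norm (?a u) * norm (?b v)))"
      using r by (simp add: z_def norm_mult)
    also have "\<dots> \<le> r * ((norm (?a u))\<^sup>2 + (norm (?b v))\<^sup>2)"
      using r sum_squares_bound[of "norm (?a u)" "norm (?b v)"] by (intro mult_left_mono) auto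
    also have "\<dots> = r * (x\<^sup>2 + y\<^sup>2) + r * u\<^sup>2 + r * v\<^sup>2"
      by (simp add: cmod_power2 algebra_simps)
    finally have "exp (norm (z (u, v)) - u\<^sup>2 - v\<^sup>2) \<le> exp (r * (x\<^sup>2 + y\<^sup>2) - (1 - r) * u\<^sup>2 - (1 - r) * v\<^sup>2)"
      by (simp add: algebra_simps)
    moreover have "norm (?g u v) = exp (- u\<^sup>2) * exp (- v\<^sup>2)"
      by (simp only: norm_of_real) simp
    ultimately show ?thesis
      by (simp only: D_def prod.case mult_exp_exp) (simp add: algebra_simps)
  qed
  have sums: "(\<lambda>k. T k p) sums E p" for p
  proof (cases p)
    case (Pair u v)
    have "(\<lambda>k. z (u, v) ^ k /\<^sub>R fact k * ?g u v) sums (exp (z (u, v)) * ?g u v)"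
      by (intro sums_mult2 exp_converges)
    then show ?thesis by (simp only: Pair T_def E_def z_def prod.case)
  qed
  have zm: "z \<in> borel_measurable ?M" unfolding z_def by measurable
  have Tm: "T k \<in> borel_measurable ?M" for k unfolding T_def using zm by measurable
  have partial: "norm (\<Sum>k<n. T k p) \<le> D p" for n p
  proof (cases p)
    case (Pair u v)
    have "norm (\<Sum>k<n. T k p) \<le> (\<Sum>k<n. norm (z (u, v)) ^ k /\<^sub>R fact k * norm (?g u v))"
      by (rule sum_norm_le) (simp add: T_def Pair norm_mult norm_power)
    also have "\<dots> = (\<Sum>k<n. norm (z (u, v)) ^ k /\<^sub>R fact k) * norm (?g u v)"
      by (simp only: sum_distrib_right)
    also have "\<dots> \<le> exp (norm (z (u, v))) * norm (?g u v)"
      using sum_le_suminf[OF sums_summable[OF exp_converges[of "norm (z (u, v))"]], of "{..<n}"]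
      by (intro mult_right_mono) (auto simp: exp_def)
    also note zD
    finally show ?thesis by (simp add: Pair)
  qed
  have Ti: "integrable ?M (T k)" for k
  proof (rule Bochner_Integration.integrable_bound)
    show "integrable ?M (\<lambda>p. 2 * D p)" using Di by simp
    have "norm (T k p) \<le> norm (2 * D p)" for p
    proof -
      have "T k p = (\<Sum>j<Suc k. T j p) - (\<Sum>j<k. T j p)" by simp
      also have "norm \<dots> \<le> D p + D p"
        by (intro order_trans[OF norm_triangle_ineq4] add_mono partial)
      finally show ?thesis by simp
    qed
    then show "AE p in ?M. norm (T k p) \<le> norm (2 * D p)" by simp
  qed (rule Tm)
  have Em: "E \<in> borel_measurable ?M" unfolding E_def by measurable
  have ED: "norm (E p) \<le> D p" for p
    by (rule LIMSEQ_le_const2[OF tendsto_norm[OF sums[of p, unfolded sums_def]]]) (use partial in auto)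
  have Ei: "integrable ?M E"
    by (rule Bochner_Integration.integrable_bound[OF Di Em])
       (use ED order_trans[OF norm_ge_zero ED] in auto)
  have IT: "(LINT p|?M. T k p) = of_real (pi * (r ^ k * poly (herm k) x * poly (herm k) y / (2 ^ k * fact k)))" for k
  proof -
    have "(LINT p|?M. T k p) = (LINT p|?M. ((2 * of_real r) ^ k /\<^sub>R fact k) *
       (case p of (u, v) \<Rightarrow> (?a u ^ k * of_real (exp (- u\<^sup>2))) * (?b v ^ k * of_real (exp (- v\<^sup>2)))))"
      by (rule Bochner_Integration.integral_cong)
         (auto simp: T_def z_def power_mult_distrib scaleR_conv_of_real)
    also have "\<dots> = ((2 * of_real r) ^ k /\<^sub>R fact k) * (gauss_moment k x * gauss_moment k y)"
      unfolding gauss_moment_def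
      by (subst integral_mult_right_zero, subst lborel_pair_mult(2)) (auto intro: integrable_gauss_moment)
    also have "gauss_moment k x * gauss_moment k y
      = of_real (sqrt pi / 2 ^ k * poly (herm k) x) * of_real (sqrt pi / 2 ^ k * poly (herm k) y)"
      unfolding of_real_mult[of "sqrt pi / 2 ^ k"] herm_eq_gauss_moment by simp
    also have "((2 * complex_of_real r) ^ k /\<^sub>R fact k) * (of_real (sqrt pi / 2 ^ k * poly (herm k) x) * of_real (sqrt pi / 2 ^ k * poly (herm k) y))
      = of_real ((sqrt pi * sqrt pi) * (r ^ k * poly (herm k) x * poly (herm k) y / (2 ^ k * fact k)))"
    proof -
      have "complex_of_real (sqrt pi) * complex_of_real (sqrt pi) = of_real pi"
        by (simp flip: of_real_mult)
      then show ?thesis by (simp add: scaleR_conv_of_real power_mult_distrib field_simps)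
    qed
    finally show ?thesis by simp
  qed
  let ?R = "exp (2 * r * x * y - r\<^sup>2 * y\<^sup>2 - r\<^sup>2 * (x - r * y)\<^sup>2 / (1 - r\<^sup>2)) / sqrt (1 - r\<^sup>2)"
  have "(\<lambda>n. LINT p|?M. (\<Sum>k<n. T k p)) \<longlonglongrightarrow> (LINT p|?M. E p)"
    by (rule integral_dominated_convergence[where w = D])
       (use Em Tm Di partial sums in \<open>auto simp: sums_def\<close>)
  moreover have "(LINT p|?M. E p) = of_real (pi * ?R)"
    using gaussian_integral_2d[OF r Ei[unfolded E_def]] by (simp add: E_def)
  moreover have "(LINT p|?M. (\<Sum>k<n. T k p)) = (\<Sum>k<n. LINT p|?M. T k p)" for n
    by (rule Bochner_Integration.integral_sum) (rule Ti)
  ultimately have "(\<lambda>k. complex_of_real (pi * (r ^ k * poly (herm k) x * poly (herm k) y / (2 ^ k * fact k)))) sums of_real (pi * ?R)"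
    by (simp add: sums_def IT)
  then have "(\<lambda>k. pi * (r ^ k * poly (herm k) x * poly (herm k) y / (2 ^ k * fact k))) sums (pi * ?R)"
    by (simp only: sums_of_real_iff)
  from sums_mult[OF this, of "inverse pi"] show ?thesis
    by (simp add: field_simps)
qed

lemma mehler_hermite_fun1:
  assumes r: "0 \<le> r" "r < 1"
  shows "(\<lambda>k. r ^ k * (hermite_fun1 k x * hermite_fun1 k y)) sums mehler r x y"
proof -
  have r2: "0 < 1 - r\<^sup>2" "1 + r > 0" "1 - r > 0" using r by (auto simp: power_less_one_iff abs_square_less_1)
  have f: "1 - r\<^sup>2 = (1 + r) * (1 - r)" by (simp add: algebra_simps power2_eq_square)
  let ?c = "exp (- (x\<^sup>2 + y\<^sup>2) / 2) / sqrt pi"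
  have "r ^ k * (hermite_fun1 k x * hermite_fun1 k y)
      = ?c * (r ^ k * poly (herm k) x * poly (herm k) y / (2 ^ k * fact k))" for k
  proof -
    have "0 \<le> (2 ^ k * fact k * sqrt pi :: real)" by simp
    then have "sqrt (2 ^ k * fact k * sqrt pi) * sqrt (2 ^ k * fact k * sqrt pi) = 2 ^ k * fact k * sqrt pi"
      by (simp only: real_sqrt_mult_self abs_of_nonneg)
    moreover have "exp (- (x\<^sup>2 + y\<^sup>2) / 2) = exp (- x\<^sup>2 / 2) * exp (- y\<^sup>2 / 2)"
      by (simp flip: exp_add add: field_simps)
    ultimately show ?thesis by (simp add: hermite_fun1_eq field_simps)
  qed
  moreover have "?c * (exp (2 * r * x * y - r\<^sup>2 * y\<^sup>2 - r\<^sup>2 * (x - r * y)\<^sup>2 / (1 - r\<^sup>2)) / sqrt (1 - r\<^sup>2)) = mehler r x y"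
  proof -
    have "- (x\<^sup>2 + y\<^sup>2) / 2 + (2 * r * x * y - r\<^sup>2 * y\<^sup>2 - r\<^sup>2 * (x - r * y)\<^sup>2 / (1 - r\<^sup>2)) =
      - ((1 - r) / (1 + r) * (x + y)\<^sup>2 / 4) - (1 + r) / (1 - r) * (x - y)\<^sup>2 / 4" (is "?L = ?R")
    proof -
      have "?L * (4 * ((1 + r) * (1 - r))) = ?R * (4 * ((1 + r) * (1 - r)))"
      proof -
        have "?L * (4 * ((1 + r) * (1 - r))) = - 2 * (x\<^sup>2 + y\<^sup>2) * ((1 + r) * (1 - r))
          + (2 * r * x * y - r\<^sup>2 * y\<^sup>2) * (4 * ((1 + r) * (1 - r))) - 4 * (r\<^sup>2 * (x - r * y)\<^sup>2)"
          using r2 unfolding f by (simp add: field_simps)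
        also have "\<dots> = - ((1 - r)\<^sup>2 * (x + y)\<^sup>2) - (1 + r)\<^sup>2 * (x - y)\<^sup>2"
          by (simp add: algebra_simps power2_eq_square)
        also have "\<dots> = ?R * (4 * ((1 + r) * (1 - r)))"
          using r2 by (simp add: divide_simps) (simp add: algebra_simps power2_eq_square)
        finally show ?thesis .
      qed
      then show ?thesis using r2 by simp
    qed
    then show ?thesis
      unfolding mehler_def by (simp add: real_sqrt_mult flip: exp_add)
  qed
  ultimately show ?thesis
    using sums_mult[OF mehler_herm[OF r, of x y], of ?c] by simp
qed

text \<open>Off the diagonal the terms may change sign, but |a b| \<le> a^2 + b^2 reduces to the two
  diagonal series, whose terms are nonnegative and which converge by Mehler's formula.\<close>

lemma mehler_abs_summable:
  assumes r: "0 \<le> r" "r < 1"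
  shows "summable (\<lambda>k. norm (r ^ k * (hermite_fun1 k x * hermite_fun1 k y)))"
proof (rule summable_comparison_test)
  show "summable (\<lambda>k. r ^ k * (hermite_fun1 k x * hermite_fun1 k x) + r ^ k * (hermite_fun1 k y * hermite_fun1 k y))"
    by (intro summable_add sums_summable[OF mehler_hermite_fun1] r)
  have "\<bar>a * b\<bar> \<le> a * a + b * b" for a b :: real
  proof -
    have "2 * \<bar>a * b\<bar> \<le> a * a + b * b"
      using sum_squares_bound[of "\<bar>a\<bar>" "\<bar>b\<bar>"] by (simp add: abs_mult power2_eq_square mult.assoc)
    then show ?thesis using abs_ge_zero[of "a * b"] by linarith
  qed
  then show "\<exists>N. \<forall>n\<ge>N. norm (norm (r ^ n * (hermite_fun1 n x * hermite_fun1 n y)))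
      \<le> r ^ n * (hermite_fun1 n x * hermite_fun1 n x) + r ^ n * (hermite_fun1 n y * hermite_fun1 n y)"
    using r by (auto simp: abs_mult power_abs simp flip: distrib_left intro!: exI[of _ 0] mult_left_mono)
qed

section \<open>Square-integrable functions\<close>

lemma L2_measurable: "f \<in> L2 \<Longrightarrow> f \<in> borel_measurable borel"
  by (simp add: L2_def)

lemma L2_integrable: "f \<in> L2 \<Longrightarrow> integrable lborel (\<lambda>x. (norm (f x))\<^sup>2)"
  by (simp add: L2_def)

lemma borel_measurable_cnj [measurable]:
  "f \<in> borel_measurable M \<Longrightarrow> (\<lambda>x. cnj (f x)) \<in> borel_measurable M"
  by (rule borel_measurable_continuous_on[of cnj]) (auto intro!: continuous_intros)

lemma mult_le_sum_squares: "a * b \<le> a\<^sup>2 + (b::real)\<^sup>2"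
  using zero_le_power2[of a] zero_le_power2[of b] sum_squares_bound[of a b] by linarith

lemma L2_integrable_mult:
  assumes "f \<in> L2" "g \<in> L2"
  shows "integrable lborel (\<lambda>x. f x * cnj (g x))" "integrable lborel (\<lambda>x. norm (f x) * norm (g x))"
proof -
  have [measurable]: "f \<in> borel_measurable borel" "g \<in> borel_measurable borel"
    using assms by (auto simp: L2_def)
  have i: "integrable lborel (\<lambda>x. (norm (f x))\<^sup>2 + (norm (g x))\<^sup>2)"
    using assms by (auto simp: L2_def)
  have le: "norm (f x) * norm (g x) \<le> (norm (f x))\<^sup>2 + (norm (g x))\<^sup>2" for x
    by (rule mult_le_sum_squares)
  show "integrable lborel (\<lambda>x. f x * cnj (g x))"
    by (rule Bochner_Integration.integrable_bound[OF i]) (use le in \<open>auto simp: norm_mult abs_of_nonneg\<close>)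
  show "integrable lborel (\<lambda>x. norm (f x) * norm (g x))"
    by (rule Bochner_Integration.integrable_bound[OF i]) (use le in \<open>auto simp: norm_mult abs_of_nonneg\<close>)
qed

lemma L2_add:
  assumes "f \<in> L2" "g \<in> L2"
  shows "(\<lambda>x. f x + g x) \<in> L2"
proof -
  have [measurable]: "f \<in> borel_measurable borel" "g \<in> borel_measurable borel"
    using assms by (auto simp: L2_def)
  have i: "integrable lborel (\<lambda>x. 2 * (norm (f x))\<^sup>2 + 2 * (norm (g x))\<^sup>2)"
    using assms by (auto simp: L2_def)
  have "(norm (f x + g x))\<^sup>2 \<le> 2 * (norm (f x))\<^sup>2 + 2 * (norm (g x))\<^sup>2" for x
  proof -
    have "(norm (f x + g x))\<^sup>2 \<le> (norm (f x) + norm (g x))\<^sup>2"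
      by (intro power_mono norm_triangle_ineq) auto
    also have "\<dots> \<le> 2 * (norm (f x))\<^sup>2 + 2 * (norm (g x))\<^sup>2"
      using sum_squares_bound[of "norm (f x)" "norm (g x)"] by (simp add: power2_sum)
    finally show ?thesis .
  qed
  then have "integrable lborel (\<lambda>x. (norm (f x + g x))\<^sup>2)"
    by (intro Bochner_Integration.integrable_bound[OF i]) (auto simp: abs_of_nonneg)
  then show ?thesis by (simp add: L2_def)
qed

lemma L2_scale: "f \<in> L2 \<Longrightarrow> (\<lambda>x. c * f x) \<in> L2"
  by (auto simp: L2_def norm_mult power_mult_distrib)

lemma L2_zero: "(\<lambda>x. 0) \<in> L2"
  by (simp add: L2_def)

lemma L2_sum: "(\<And>i. i \<in> A \<Longrightarrow> f i \<in> L2) \<Longrightarrow> (\<lambda>x. \<Sum>i\<in>A. f i x) \<in> L2"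
  by (induction A rule: infinite_finite_induct) (auto simp: L2_zero intro!: L2_add)

lemma L2_diff:
  assumes "f \<in> L2" "g \<in> L2"
  shows "(\<lambda>x. f x - g x) \<in> L2"
  using L2_add[OF assms(1) L2_scale[OF assms(2), of "-1"]] by simp

lemma bracket_cnj: "bracket g f = cnj (bracket f g)"
  unfolding bracket_def by (subst Bochner_Integration.integral_cnj[symmetric]) (simp add: mult.commute)

lemma bracket_add: "f \<in> L2 \<Longrightarrow> g \<in> L2 \<Longrightarrow> h \<in> L2 \<Longrightarrow> bracket (\<lambda>x. f x + g x) h = bracket f h + bracket g h"
  unfolding bracket_def using L2_integrable_mult(1)[of f h] L2_integrable_mult(1)[of g h]
  by (simp add: distrib_right)

lemma bracket_diff: "f \<in> L2 \<Longrightarrow> g \<in> L2 \<Longrightarrow> h \<in> L2 \<Longrightarrow> bracket (\<lambda>x. f x - g x) h = bracket f h - bracket g h"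
  unfolding bracket_def using L2_integrable_mult(1)[of f h] L2_integrable_mult(1)[of g h]
  by (simp add: left_diff_distrib)

lemma bracket_scale: "bracket (\<lambda>x. c * f x) h = c * bracket f h"
  unfolding bracket_def by (simp add: mult.assoc)

lemma bracket_sum:
  "(\<And>i. i \<in> A \<Longrightarrow> f i \<in> L2) \<Longrightarrow> h \<in> L2 \<Longrightarrow> bracket (\<lambda>x. \<Sum>i\<in>A. f i x) h = (\<Sum>i\<in>A. bracket (f i) h)"
  by (induction A rule: infinite_finite_induct) (auto simp: bracket_add L2_sum, auto simp: bracket_def)

lemma bracket_sum_right:
  assumes "\<And>i. i \<in> A \<Longrightarrow> f i \<in> L2" "h \<in> L2"
  shows "bracket h (\<lambda>x. \<Sum>i\<in>A. c i * f i x) = (\<Sum>i\<in>A. cnj (c i) * bracket h (f i))"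
proof -
  have "bracket h (\<lambda>x. \<Sum>i\<in>A. c i * f i x) = cnj (\<Sum>i\<in>A. c i * bracket (f i) h)"
    by (subst bracket_cnj, subst bracket_sum) (use assms in \<open>auto intro: L2_scale simp: bracket_scale\<close>)
  then show ?thesis by (simp add: bracket_cnj[of h])
qed

lemma bracket_self: "bracket f f = of_real (LINT x|lborel. (norm (f x))\<^sup>2)"
  unfolding bracket_def by (simp add: complex_norm_square[symmetric] flip: of_real_power)

text \<open>Cauchy-Schwarz in the form of a weighted arithmetic-geometric inequality; the free
  parameter e takes the place of the square roots.\<close>

lemma norm_bracket_le:
  assumes "f \<in> L2" "g \<in> L2" "0 < e"
  shows "norm (bracket f g) \<le> inverse e * (LINT x|lborel. (norm (f x))\<^sup>2) + e * (LINT x|lborel. (norm (g x))\<^sup>2)"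
proof -
  have "norm (bracket f g) \<le> (LINT x|lborel. norm (f x) * norm (g x))"
    unfolding bracket_def by (rule order_trans[OF integral_norm_bound]) (simp add: norm_mult)
  also have "\<dots> \<le> (LINT x|lborel. inverse e * (norm (f x))\<^sup>2 + e * (norm (g x))\<^sup>2)"
  proof (rule integral_mono)
    fix x
    have "0 \<le> (norm (f x) - e * norm (g x))\<^sup>2 / e" using assms(3) by simp
    also have "\<dots> = inverse e * (norm (f x))\<^sup>2 + e * (norm (g x))\<^sup>2 - 2 * (norm (f x) * norm (g x))"
      using assms(3) by (simp add: power2_eq_square field_simps)
    finally show "norm (f x) * norm (g x) \<le> inverse e * (norm (f x))\<^sup>2 + e * (norm (g x))\<^sup>2"
      using mult_nonneg_nonneg[of "norm (f x)" "norm (g x)"] by (simp del: mult_nonneg_nonneg)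
    show "integrable lborel (\<lambda>x. inverse e * (norm (f x))\<^sup>2 + e * (norm (g x))\<^sup>2)"
      by (intro Bochner_Integration.integrable_add integrable_mult_right L2_integrable assms)
  qed (rule L2_integrable_mult[OF assms(1,2)])
  also have "\<dots> = inverse e * (LINT x|lborel. (norm (f x))\<^sup>2) + e * (LINT x|lborel. (norm (g x))\<^sup>2)"
    using assms L2_integrable by (subst Bochner_Integration.integral_add) auto
  finally show ?thesis .
qed

lemma L2_lim_bracket:
  assumes "L2_lim F h" "g \<in> L2"
  shows "(\<lambda>N. bracket (F N) g) \<longlonglongrightarrow> bracket h g"
proof (rule LIM_zero_cancel, rule tendstoI)
  fix e :: real assume "e > 0"
  have h: "h \<in> L2" and F: "\<And>N. F N \<in> L2"
    and lim: "(\<lambda>N. LINT x|lborel. (norm (F N x - h x))\<^sup>2) \<longlonglongrightarrow> 0"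
    using assms(1) by (auto simp: L2_lim_def)
  define G where "G = (LINT x|lborel. (norm (g x))\<^sup>2)"
  have G: "0 \<le> G" unfolding G_def by simp
  \<comment> \<open>The \<open>+ 1\<close> guards against G = 0. With this d the second term of
    \<open>norm_bracket_le\<close> is at most e / 2, and the threshold d * e / 4 below makes the
    first one less than e / 4.\<close>
  define d where "d = e / (2 * (G + 1))"
  have d: "d > 0" using \<open>e > 0\<close> G by (simp add: d_def)
  have dG: "d * G < e / 2 + e / 4"
  proof -
    have "d * G \<le> d * (G + 1)" using d by simp
    also have "\<dots> = e / 2" using G by (simp add: d_def field_simps)
    finally show ?thesis using \<open>e > 0\<close> by linarith
  qed
  have "d * e / 4 > 0" using d \<open>e > 0\<close> by simp
  from order_tendstoD(2)[OF lim this]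
  show "\<forall>\<^sub>F N in sequentially. dist (bracket (F N) g - bracket h g) 0 < e"
  proof eventually_elim
    case (elim N)
    have "dist (bracket (F N) g - bracket h g) 0 = norm (bracket (\<lambda>x. F N x - h x) g)"
      using F h assms(2) by (simp add: bracket_diff)
    also have "\<dots> \<le> inverse d * (LINT x|lborel. (norm (F N x - h x))\<^sup>2) + d * G"
      unfolding G_def using F h assms(2) d by (intro norm_bracket_le L2_diff)
    also have "\<dots> < inverse d * (d * e / 4) + (e / 2 + e / 4)"
      using elim d dG by (intro add_strict_mono mult_strict_left_mono) auto
    also have "\<dots> = e" using d by (simp add: field_simps)
    finally show ?case .
  qed
qed

text \<open>Riesz-Fischer for functions instead of classes. A subsequence with squared steps at most
  4^(-j) has an integrable sum of 2^j \<delta>_j^2, and \<delta>_j \<le> 2^(-j) + 2^j \<delta>_j^2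
  gives convergence almost everywhere. Fatou's lemma then yields both square integrability of the
  limit and convergence of the full sequence.\<close>

lemma L2_complete:
  fixes F :: "nat \<Rightarrow> 'a::euclidean_space \<Rightarrow> complex"
  assumes F: "\<And>N. F N \<in> L2"
    and cauchy: "\<And>e. e > 0 \<Longrightarrow> \<exists>N. \<forall>m\<ge>N. \<forall>n\<ge>N. (LINT x|lborel. (norm (F m x - F n x))\<^sup>2) \<le> e"
  shows "\<exists>g. L2_lim F g"
proof -
  have [measurable]: "F N \<in> borel_measurable borel" for N using F by (rule L2_measurable)
  define I where "I m n = (LINT x|lborel. (norm (F m x - F n x))\<^sup>2)" for m n
  have nnI: "(\<integral>\<^sup>+x. ennreal ((norm (F m x - F n x))\<^sup>2) \<partial>lborel) = ennreal (I m n)" for m n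
    unfolding I_def using L2_integrable[OF L2_diff[OF F F]] by (intro nn_integral_eq_integral) auto
  have "\<exists>N. \<forall>m\<ge>N. \<forall>n\<ge>N. I m n \<le> (1/4) ^ j" for j :: nat
    unfolding I_def by (rule cauchy) simp
  then obtain N where N: "\<And>j m n. m \<ge> N j \<Longrightarrow> n \<ge> N j \<Longrightarrow> I m n \<le> (1/4) ^ j" by metis
  define r where "r j = (\<Sum>i\<le>j. N i) + j" for j
  have r: "strict_mono r" unfolding strict_mono_Suc_iff r_def by simp
  have rN: "N j \<le> r j" "N j \<le> r (Suc j)" for j
    using member_le_sum[of j "{..j}" N] by (auto simp: r_def)
  define \<delta> where "\<delta> j x = norm (F (r (Suc j)) x - F (r j) x)" for j x
  have \<delta>m [measurable]: "\<delta> j \<in> borel_measurable borel" for j unfolding \<delta>_def by measurable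
  have "(\<integral>\<^sup>+x. (\<Sum>j. ennreal (2 ^ j * (\<delta> j x)\<^sup>2)) \<partial>lborel) = (\<Sum>j. \<integral>\<^sup>+x. ennreal (2 ^ j * (\<delta> j x)\<^sup>2) \<partial>lborel)"
    by (intro nn_integral_suminf) measurable
  also have "\<dots> \<le> (\<Sum>j. ennreal ((1/2) ^ j))"
  proof (intro suminf_le)
    fix j
    have "(\<integral>\<^sup>+x. ennreal (2 ^ j * (\<delta> j x)\<^sup>2) \<partial>lborel) = ennreal (2 ^ j) * (\<integral>\<^sup>+x. ennreal ((\<delta> j x)\<^sup>2) \<partial>lborel)"
      by (subst nn_integral_cmult[symmetric]) (auto simp: ennreal_mult)
    also have "\<dots> = ennreal (2 ^ j * I (r (Suc j)) (r j))"
      unfolding \<delta>_def nnI by (simp add: ennreal_mult' I_def)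
    also have "\<dots> \<le> ennreal ((1/2) ^ j)"
    proof (rule ennreal_leI)
      have "2 ^ j * I (r (Suc j)) (r j) \<le> 2 ^ j * (1/4) ^ j"
        using N[OF rN(2) rN(1)] by (intro mult_left_mono) auto
      also have "\<dots> = (1/2) ^ j" by (simp flip: power_mult_distrib)
      finally show "2 ^ j * I (r (Suc j)) (r j) \<le> (1/2) ^ j" .
    qed
    finally show "(\<integral>\<^sup>+x. ennreal (2 ^ j * (\<delta> j x)\<^sup>2) \<partial>lborel) \<le> ennreal ((1/2) ^ j)" .
  qed auto
  also have "\<dots> < \<infinity>"
    by (subst suminf_ennreal_eq[OF _ geometric_sums[of "1/2"]]) auto
  finally have "AE x in lborel. (\<Sum>j. ennreal (2 ^ j * (\<delta> j x)\<^sup>2)) \<noteq> \<infinity>"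
    by (intro nn_integral_noteq_infinite) (auto simp: less_top)
  then have AE_lim: "AE x in lborel. (\<lambda>j. F (r j) x) \<longlonglongrightarrow> lim (\<lambda>j. F (r j) x)"
  proof eventually_elim
    case (elim x)
    then have s: "summable (\<lambda>j. 2 ^ j * (\<delta> j x)\<^sup>2)"
      by (intro summable_suminf_not_top) auto
    have "summable (\<lambda>j. F (r (Suc j)) x - F (r j) x)"
    proof (rule summable_comparison_test)
      show "summable (\<lambda>j. (1/2) ^ j + 2 ^ j * (\<delta> j x)\<^sup>2)"
        by (intro summable_add s summable_geometric) simp
      have "\<delta> j x \<le> (1/2) ^ j + 2 ^ j * (\<delta> j x)\<^sup>2" for j
      proof -
        have "0 \<le> 2 ^ j * (\<delta> j x - (1/2) ^ j)\<^sup>2" by simp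
        also have "\<dots> = 2 ^ j * (\<delta> j x)\<^sup>2 - 2 * \<delta> j x * (2 ^ j * (1/2) ^ j) + (2 ^ j * (1/2) ^ j) * (1/2) ^ j"
          by (simp add: power2_eq_square algebra_simps)
        also have "(2::real) ^ j * (1/2) ^ j = 1" by (simp flip: power_mult_distrib)
        finally have "2 * \<delta> j x \<le> 2 ^ j * (\<delta> j x)\<^sup>2 + (1/2) ^ j" by simp
        moreover have "0 \<le> \<delta> j x" by (simp add: \<delta>_def)
        ultimately show ?thesis by linarith
      qed
      then show "\<exists>N. \<forall>n\<ge>N. norm (F (r (Suc n)) x - F (r n) x) \<le> (1/2) ^ n + 2 ^ n * (\<delta> n x)\<^sup>2"
        unfolding \<delta>_def by blast
    qed
    then have "convergent (\<lambda>n. \<Sum>j<n. F (r (Suc j)) x - F (r j) x)"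
      by (simp add: summable_iff_convergent)
    then have "convergent (\<lambda>n. (F (r n) x - F (r 0) x) + F (r 0) x)"
      unfolding sum_lessThan_telescope[of "\<lambda>j. F (r j) x"] by (intro convergent_add convergent_const)
    then show ?case by (simp add: convergent_LIMSEQ_iff)
  qed
  define g where "g x = lim (\<lambda>j. F (r j) x)" for x
  have gm [measurable]: "g \<in> borel_measurable borel" unfolding g_def by measurable
  have fatou: "(\<integral>\<^sup>+x. ennreal ((norm (F m x - g x))\<^sup>2) \<partial>lborel) \<le> ennreal e"
    if m: "\<And>n. n \<ge> K \<Longrightarrow> I m n \<le> e" for m K e
  proof -
    have "(\<integral>\<^sup>+x. ennreal ((norm (F m x - g x))\<^sup>2) \<partial>lborel)
       = (\<integral>\<^sup>+x. liminf (\<lambda>j. ennreal ((norm (F m x - F (r j) x))\<^sup>2)) \<partial>lborel)"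
    proof (rule nn_integral_cong_AE)
      show "AE x in lborel. ennreal ((norm (F m x - g x))\<^sup>2) = liminf (\<lambda>j. ennreal ((norm (F m x - F (r j) x))\<^sup>2))"
        using AE_lim
      proof eventually_elim
        case (elim x)
        have "(\<lambda>j. ennreal ((norm (F m x - F (r j) x))\<^sup>2)) \<longlonglongrightarrow> ennreal ((norm (F m x - g x))\<^sup>2)"
          using elim unfolding g_def by (intro tendsto_intros)
        then show ?case by (intro lim_imp_Liminf[symmetric]) auto
      qed
    qed
    also have "\<dots> \<le> liminf (\<lambda>j. \<integral>\<^sup>+x. ennreal ((norm (F m x - F (r j) x))\<^sup>2) \<partial>lborel)"
      by (intro nn_integral_liminf) measurable
    also have "\<dots> = liminf (\<lambda>j. ennreal (I m (r j)))" by (simp add: nnI)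
    also have "\<dots> \<le> liminf (\<lambda>j. ennreal e)"
    proof (rule Liminf_mono)
      show "\<forall>\<^sub>F j in sequentially. ennreal (I m (r j)) \<le> ennreal e"
        using eventually_ge_at_top[of K]
        by eventually_elim (use strict_mono_imp_increasing[OF r] m order_trans in \<open>blast intro: ennreal_leI\<close>)
    qed
    also have "\<dots> = ennreal e" by (simp add: Liminf_const)
    finally show ?thesis .
  qed
  have FgL2: "(\<lambda>x. F m x - g x) \<in> L2" if "m \<ge> N 0" for m
  proof -
    have "(\<integral>\<^sup>+x. ennreal ((norm (F m x - g x))\<^sup>2) \<partial>lborel) \<le> ennreal 1"
      by (rule fatou[of "N 0"]) (use N[of 0 m] that in auto)
    then have "integrable lborel (\<lambda>x. (norm (F m x - g x))\<^sup>2)"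
      by (intro integrableI_bounded) (auto simp: le_less_trans)
    then show ?thesis by (simp add: L2_def)
  qed
  have g: "g \<in> L2"
    using L2_diff[OF F FgL2[OF order_refl], of "N 0"] by simp
  have "(\<lambda>m. LINT x|lborel. (norm (F m x - g x))\<^sup>2) \<longlonglongrightarrow> 0"
  proof (rule tendstoI)
    fix e :: real assume e: "e > 0"
    obtain K where K: "\<And>m n. m \<ge> K \<Longrightarrow> n \<ge> K \<Longrightarrow> I m n \<le> e / 2"
      unfolding I_def using cauchy[of "e / 2"] e by auto
    show "\<forall>\<^sub>F m in sequentially. dist (LINT x|lborel. (norm (F m x - g x))\<^sup>2) 0 < e"
      using eventually_ge_at_top[of "max K (N 0)"]
    proof eventually_elim
      case (elim m)
      have "ennreal (LINT x|lborel. (norm (F m x - g x))\<^sup>2) = (\<integral>\<^sup>+x. ennreal ((norm (F m x - g x))\<^sup>2) \<partial>lborel)"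
        by (rule nn_integral_eq_integral[symmetric]) (use FgL2[of m] elim in \<open>auto simp: L2_def\<close>)
      also have "\<dots> \<le> ennreal (e / 2)" by (rule fatou[of K]) (use K elim in auto)
      finally have "(LINT x|lborel. (norm (F m x - g x))\<^sup>2) \<le> e / 2" using e by simp
      moreover have "0 \<le> (LINT x|lborel. (norm (F m x - g x))\<^sup>2)" by simp
      ultimately show ?case using e by (simp add: dist_norm)
    qed
  qed
  with g F show ?thesis unfolding L2_lim_def by blast
qed

section \<open>Hermite expansions\<close>

abbreviation degree_set :: "nat \<Rightarrow> ('n::finite \<Rightarrow> nat) set" where
  "degree_set k \<equiv> {\<alpha>. (\<Sum>i\<in>UNIV. \<alpha> i) = k}"

lemma finite_degree_set: "finite (degree_set k :: ('n::finite \<Rightarrow> nat) set)"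
proof (rule finite_subset)
  show "degree_set k \<subseteq> (UNIV :: 'n set) \<rightarrow>\<^sub>E {..k}"
  proof
    fix \<alpha> :: "'n \<Rightarrow> nat" assume "\<alpha> \<in> degree_set k"
    then have "\<alpha> i \<le> k" for i using member_le_sum[of i UNIV \<alpha>] by auto
    then show "\<alpha> \<in> UNIV \<rightarrow>\<^sub>E {..k}" by auto
  qed
  show "finite ((UNIV :: 'n set) \<rightarrow>\<^sub>E {..k})" by (intro finite_PiE) auto
qed

lemma continuous_hermite_fun1 [continuous_intros]: "continuous_on S (hermite_fun1 k)"
proof -
  have "hermite_fun1 k = (\<lambda>x. poly (herm k) x * exp (- x\<^sup>2 / 2) / sqrt (2 ^ k * fact k * sqrt pi))"
    by (simp add: fun_eq_iff hermite_fun1_eq)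
  then show ?thesis by (auto intro!: continuous_intros)
qed

lemma borel_measurable_hermite_fun1 [measurable]: "hermite_fun1 k \<in> borel_measurable borel"
  by (intro borel_measurable_continuous_onI continuous_intros)

lemma borel_measurable_hermite_fun [measurable]: "hermite_fun \<alpha> \<in> borel_measurable borel"
  unfolding hermite_fun_def by measurable

lemma cnj_hermite_fun [simp]: "cnj (hermite_fun \<alpha> x) = hermite_fun \<alpha> x"
  by (simp add: hermite_fun_def)

lemma hermite_fun_mult_integral:
  fixes \<alpha> \<gamma> :: "'n::finite \<Rightarrow> nat"
  shows "integrable lborel (\<lambda>x::real^'n. hermite_fun \<alpha> x * hermite_fun \<gamma> x)"
    and "(LINT x|lborel. hermite_fun \<alpha> (x::real^'n) * hermite_fun \<gamma> x) = (if \<alpha> = \<gamma> then 1 else 0)"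
proof -
  let ?f = "\<lambda>i s. hermite_fun1 (\<alpha> i) s * hermite_fun1 (\<gamma> i) s"
  have eq: "hermite_fun \<alpha> x * hermite_fun \<gamma> x = of_real (\<Prod>i\<in>UNIV. ?f i (x $ i))" for x :: "real^'n"
    by (simp add: hermite_fun_def prod.distrib)
  note P = lborel_prod_vec[of ?f, OF hermite_fun1_orthonormal(1)]
  show "integrable lborel (\<lambda>x::real^'n. hermite_fun \<alpha> x * hermite_fun \<gamma> x)"
    unfolding eq using P(1) by (rule integrable_of_real)
  have "(LINT x|lborel. hermite_fun \<alpha> (x::real^'n) * hermite_fun \<gamma> x) = of_real (\<Prod>i\<in>UNIV. LINT s|lborel. ?f i s)"
    unfolding eq using P by (subst integral_of_real) auto
  also have "(\<Prod>i\<in>UNIV. LINT s|lborel. ?f i s) = (\<Prod>i\<in>UNIV. if \<alpha> i = \<gamma> i then 1 else 0)"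
    by (simp add: hermite_fun1_orthonormal(2))
  also have "\<dots> = (if \<alpha> = \<gamma> then 1 else 0)"
    by (auto simp: fun_eq_iff prod_zero_iff)
  finally show "(LINT x|lborel. hermite_fun \<alpha> (x::real^'n) * hermite_fun \<gamma> x) = (if \<alpha> = \<gamma> then 1 else 0)" by simp
qed

lemma mult_cnj_norm: "z * cnj z = (of_real (norm z))\<^sup>2"
  using complex_norm_square[of z] by simp

lemma hermite_fun_L2:
  fixes \<alpha> :: "'n::finite \<Rightarrow> nat"
  shows "(hermite_fun \<alpha> :: real^'n \<Rightarrow> complex) \<in> L2"
proof -
  have "(norm (hermite_fun \<alpha> x))\<^sup>2 = Re (hermite_fun \<alpha> x * hermite_fun \<alpha> x)" for x :: "real^'n"
  proof -
    have "complex_of_real ((norm (hermite_fun \<alpha> x))\<^sup>2) = hermite_fun \<alpha> x * hermite_fun \<alpha> x"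
      using mult_cnj_norm[of "hermite_fun \<alpha> x"] by simp
    then show ?thesis by (metis Re_complex_of_real)
  qed
  then show ?thesis
    using integrable_Re[OF hermite_fun_mult_integral(1)[of \<alpha> \<alpha>]] by (simp add: L2_def)
qed

lemma bracket_hermite_fun:
  fixes \<alpha> \<gamma> :: "'n::finite \<Rightarrow> nat"
  shows "bracket (hermite_fun \<alpha>) (hermite_fun \<gamma> :: real^'n \<Rightarrow> complex) = (if \<alpha> = \<gamma> then 1 else 0)"
  using hermite_fun_mult_integral(2)[of \<alpha> \<gamma>] by (simp add: bracket_def)

definition hermite_coeff :: "(real^'n \<Rightarrow> complex) \<Rightarrow> ('n \<Rightarrow> nat) \<Rightarrow> complex" where
  "hermite_coeff f \<alpha> = bracket f (hermite_fun \<alpha>)"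

definition hermite_sum :: "('n::finite \<Rightarrow> nat) set \<Rightarrow> (('n \<Rightarrow> nat) \<Rightarrow> complex) \<Rightarrow> real^'n \<Rightarrow> complex" where
  "hermite_sum A c = (\<lambda>x. \<Sum>\<alpha>\<in>A. c \<alpha> * hermite_fun \<alpha> x)"

lemma hermite_sum_L2: "hermite_sum A c \<in> L2"
  unfolding hermite_sum_def by (intro L2_sum L2_scale hermite_fun_L2)

lemma bracket_hermite_sum:
  assumes "g \<in> L2"
  shows "bracket (hermite_sum A c) g = (\<Sum>\<alpha>\<in>A. c \<alpha> * cnj (hermite_coeff g \<alpha>))"
  unfolding hermite_sum_def using assms
  by (subst bracket_sum) (auto intro!: L2_scale hermite_fun_L2 simp: bracket_scale hermite_coeff_def bracket_cnj[of _ g])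

lemma hermite_coeff_hermite_sum:
  assumes "finite A"
  shows "hermite_coeff (hermite_sum A c) \<alpha> = (if \<alpha> \<in> A then c \<alpha> else 0)"
  unfolding hermite_coeff_def[of "hermite_sum A c"] bracket_hermite_sum[OF hermite_fun_L2]
  using assms by (simp add: hermite_coeff_def bracket_hermite_fun if_distrib[of cnj]
      if_distrib[of "\<lambda>c. _ * c"] sum.delta' cong: if_cong)

text \<open>Expand 0 \<le> ||f - S||^2 with S the partial expansion. The bound makes Hermite series
  of pairs in \<open>L2\<close> converge absolutely.\<close>

lemma hermite_bessel:
  assumes f: "f \<in> L2" and A: "finite A"
  shows "(\<Sum>\<alpha>\<in>A. (norm (hermite_coeff f \<alpha>))\<^sup>2) \<le> (LINT x|lborel. (norm (f x))\<^sup>2)"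
proof -
  let ?c = "hermite_coeff f"
  define S where "S = hermite_sum A ?c"
  have S: "S \<in> L2" unfolding S_def by (rule hermite_sum_L2)
  have SS: "bracket S f = of_real (\<Sum>\<alpha>\<in>A. (norm (?c \<alpha>))\<^sup>2)"
    unfolding S_def bracket_hermite_sum[OF f] by (simp add: mult_cnj_norm)
  have "bracket S S = of_real (\<Sum>\<alpha>\<in>A. (norm (?c \<alpha>))\<^sup>2)"
    unfolding S_def bracket_hermite_sum[OF hermite_sum_L2] hermite_coeff_hermite_sum[OF A]
    by (simp add: mult_cnj_norm)
  moreover have "bracket f S = of_real (\<Sum>\<alpha>\<in>A. (norm (?c \<alpha>))\<^sup>2)"
    by (subst bracket_cnj) (simp add: SS)
  moreover have "bracket (\<lambda>x. f x - S x) (\<lambda>x. f x - S x) = bracket f f - bracket S f - (bracket f S - bracket S S)"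
  proof -
    have fS: "(\<lambda>x. f x - S x) \<in> L2" using f S by (rule L2_diff)
    have "bracket g (\<lambda>x. f x - S x) = bracket g f - bracket g S" if "g \<in> L2" for g
      by (subst (1 2 3) bracket_cnj) (simp add: bracket_diff f S that)
    then show ?thesis using f S fS by (simp add: bracket_diff)
  qed
  ultimately have "complex_of_real (LINT x|lborel. (norm (f x - S x))\<^sup>2) =
     of_real ((LINT x|lborel. (norm (f x))\<^sup>2) - (\<Sum>\<alpha>\<in>A. (norm (?c \<alpha>))\<^sup>2))"
    by (simp add: SS bracket_self)
  then have "(LINT x|lborel. (norm (f x - S x))\<^sup>2) = (LINT x|lborel. (norm (f x))\<^sup>2) - (\<Sum>\<alpha>\<in>A. (norm (?c \<alpha>))\<^sup>2)"
    by (simp only: of_real_eq_iff)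
  moreover have "0 \<le> (LINT x|lborel. (norm (f x - S x))\<^sup>2)" by simp
  ultimately show ?thesis by linarith
qed

lemma hermite_space_eq: "hermite_space k = range (hermite_sum (degree_set k))"
  by (auto simp: hermite_space_def hermite_sum_def)

text \<open>Orthogonality of the remainder to each Hermite function of degree k forces the
  coefficients, which settles the uniqueness that \<open>THE\<close> asks for.\<close>

lemma hermite_proj_eq:
  fixes f :: "real^'n \<Rightarrow> complex"
  assumes f: "f \<in> L2"
  shows "hermite_proj k f = hermite_sum (degree_set k) (hermite_coeff f)"
  unfolding hermite_proj_def
proof (rule the_equality)
  have fS: "(\<lambda>x. f x - hermite_sum A c x) \<in> L2" for A c
    by (intro L2_diff f hermite_sum_L2)
  have coeff: "hermite_coeff (\<lambda>x. f x - hermite_sum (degree_set k) c x) \<alpha> = hermite_coeff f \<alpha> - c \<alpha>"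
    if "\<alpha> \<in> degree_set k" for c \<alpha>
    using that hermite_coeff_hermite_sum[OF finite_degree_set, of k c \<alpha>]
    by (simp add: hermite_coeff_def bracket_diff f hermite_sum_L2 hermite_fun_L2)
  show "hermite_sum (degree_set k) (hermite_coeff f) \<in> hermite_space k \<and>
    (\<forall>h\<in>hermite_space k. bracket (\<lambda>x. f x - hermite_sum (degree_set k) (hermite_coeff f) x) h = 0)"
  proof (intro conjI ballI)
    fix h :: "real^'n \<Rightarrow> complex" assume "h \<in> hermite_space k"
    then obtain c where h: "h = hermite_sum (degree_set k) c" by (auto simp: hermite_space_eq)
    have "bracket h (\<lambda>x. f x - hermite_sum (degree_set k) (hermite_coeff f) x) = 0"
      unfolding h bracket_hermite_sum[OF fS] by (auto intro!: sum.neutral simp: coeff)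
    then show "bracket (\<lambda>x. f x - hermite_sum (degree_set k) (hermite_coeff f) x) h = 0"
      by (subst bracket_cnj) simp
  qed (auto simp: hermite_space_eq)
  fix p assume p: "p \<in> hermite_space k \<and> (\<forall>h\<in>hermite_space k. bracket (\<lambda>x. f x - p x) h = 0)"
  then obtain c where c: "p = hermite_sum (degree_set k) c" by (auto simp: hermite_space_eq)
  have "c \<alpha> = hermite_coeff f \<alpha>" if \<alpha>: "\<alpha> \<in> degree_set k" for \<alpha>
  proof -
    have "(hermite_fun \<alpha> :: real^'n \<Rightarrow> complex) = hermite_sum (degree_set k) (\<lambda>\<gamma>. if \<gamma> = \<alpha> then 1 else 0)"
    proof
      fix x
      have "hermite_sum (degree_set k) (\<lambda>\<gamma>. if \<gamma> = \<alpha> then 1 else 0) x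
          = (\<Sum>\<gamma>\<in>degree_set k. if \<gamma> = \<alpha> then hermite_fun \<gamma> x else 0)"
        unfolding hermite_sum_def by (rule sum.cong) auto
      then show "hermite_fun \<alpha> x = hermite_sum (degree_set k) (\<lambda>\<gamma>. if \<gamma> = \<alpha> then 1 else 0) x"
        using \<alpha> by (simp only: sum.delta[OF finite_degree_set] if_True)
    qed
    then have "hermite_coeff (\<lambda>x. f x - p x) \<alpha> = 0"
      unfolding hermite_coeff_def using p by (auto simp: hermite_space_eq)
    then show ?thesis using coeff[OF \<alpha>, of c] c by simp
  qed
  then show "p = hermite_sum (degree_set k) (hermite_coeff f)"
    unfolding c hermite_sum_def by (auto intro!: sum.cong)
qed

text \<open>For f and g in \<open>L2\<close> this is <P_k f, g>, the quantity in which both sides of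
  the Weyl identity are expanded.\<close>

definition hermite_level :: "(real^'n \<Rightarrow> complex) \<Rightarrow> (real^'n \<Rightarrow> complex) \<Rightarrow> nat \<Rightarrow> complex" where
  "hermite_level f g k = (\<Sum>\<alpha>\<in>degree_set k. hermite_coeff f \<alpha> * cnj (hermite_coeff g \<alpha>))"

definition hermite_energy :: "(real^'n \<Rightarrow> complex) \<Rightarrow> nat \<Rightarrow> real" where
  "hermite_energy f k = (\<Sum>\<alpha>\<in>degree_set k. (norm (hermite_coeff f \<alpha>))\<^sup>2)"

lemma hermite_energy_nonneg: "0 \<le> hermite_energy f k"
  by (simp add: hermite_energy_def sum_nonneg)

lemma summable_hermite_energy:
  fixes f :: "real^'n \<Rightarrow> complex"
  assumes f: "f \<in> L2"
  shows "summable (hermite_energy f)"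
proof (rule summableI_nonneg_bounded)
  fix n
  have "(\<Sum>k<n. hermite_energy f k) = (\<Sum>\<alpha>\<in>(\<Union>k<n. degree_set k). (norm (hermite_coeff f \<alpha>))\<^sup>2)"
    unfolding hermite_energy_def using finite_degree_set
    by (subst sum.UNION_disjoint) auto
  also have "\<dots> \<le> (LINT x|lborel. (norm (f x))\<^sup>2)"
    using finite_degree_set by (intro hermite_bessel f) auto
  finally show "(\<Sum>k<n. hermite_energy f k) \<le> (LINT x|lborel. (norm (f x))\<^sup>2)" .
qed (rule hermite_energy_nonneg)

lemma summable_hermite_level:
  assumes "f \<in> L2" "g \<in> L2"
  shows "summable (\<lambda>k. norm (hermite_level f g k))"
proof (rule summable_comparison_test)
  show "summable (\<lambda>k. hermite_energy f k + hermite_energy g k)"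
    by (intro summable_add summable_hermite_energy assms)
  have "norm (hermite_level f g k) \<le> hermite_energy f k + hermite_energy g k" for k
  proof -
    have "norm (hermite_level f g k) \<le> (\<Sum>\<alpha>\<in>degree_set k. (norm (hermite_coeff f \<alpha>))\<^sup>2 + (norm (hermite_coeff g \<alpha>))\<^sup>2)"
      unfolding hermite_level_def
      by (rule sum_norm_le) (simp add: norm_mult mult_le_sum_squares)
    then show ?thesis by (simp add: hermite_energy_def sum.distrib)
  qed
  then show "\<exists>N. \<forall>k\<ge>N. norm (norm (hermite_level f g k)) \<le> hermite_energy f k + hermite_energy g k"
    by auto
qed

lemma bracket_hermite_proj:
  assumes "f \<in> L2" "g \<in> L2"
  shows "bracket (hermite_proj k f) g = hermite_level f g k"
  unfolding hermite_proj_eq[OF assms(1)] bracket_hermite_sum[OF assms(2)] hermite_level_def ..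

lemma hermite_proj_L2: "f \<in> L2 \<Longrightarrow> hermite_proj k f \<in> L2"
  by (simp add: hermite_proj_eq hermite_sum_L2)

lemma bracket_hermite_proj_proj:
  assumes "f \<in> L2"
  shows "bracket (hermite_proj j f) (hermite_proj k f) = (if j = k then of_real (hermite_energy f k) else 0)"
proof -
  have "bracket (hermite_proj j f) (hermite_proj k f) = hermite_level f (hermite_proj k f) j"
    by (intro bracket_hermite_proj assms hermite_proj_L2)
  also have "\<dots> = (\<Sum>\<alpha>\<in>degree_set j. if j = k then of_real ((norm (hermite_coeff f \<alpha>))\<^sup>2) else 0)"
    unfolding hermite_level_def hermite_proj_eq[OF assms] hermite_coeff_hermite_sum[OF finite_degree_set]
    by (rule sum.cong) (auto simp: mult_cnj_norm)
  finally show ?thesis by (simp add: hermite_energy_def)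
qed

text \<open>The levels are orthogonal and the multipliers lie in [0, 1] for t \<ge> 0, so the
  partial sums are Cauchy and \<open>SOME\<close> has a limit to pick. The pairing with g does not
  depend on the representative picked.\<close>

lemma hermite_semigroup_bracket:
  fixes f g :: "real^'n \<Rightarrow> complex"
  assumes f: "f \<in> L2" and g: "g \<in> L2" and t: "0 \<le> t"
  shows "(\<lambda>k. of_real (exp (- t * real (2 * k + CARD('n)) powr \<beta>)) * hermite_level f g k)
     sums bracket (hermite_semigroup \<beta> t f) g"
proof -
  define e where "e k = exp (- t * real (2 * k + CARD('n)) powr \<beta>)" for k
  have e: "0 \<le> e k" "e k \<le> 1" for k using t by (auto simp: e_def)
  define F where "F N x = (\<Sum>k<N. complex_of_real (e k) * hermite_proj k f x)" for N x
  have pL2: "(\<lambda>x. complex_of_real (e k) * hermite_proj k f x) \<in> L2" for k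
    by (intro L2_scale hermite_proj_L2 f)
  have FL2: "F N \<in> L2" for N unfolding F_def by (intro L2_sum pL2)
  have Fdiff: "(LINT x|lborel. (norm (F m x - F n x))\<^sup>2) \<le> (\<Sum>k\<in>{n..<m}. hermite_energy f k)" if "n \<le> m" for m n
  proof -
    let ?u = "\<lambda>x. \<Sum>k\<in>{n..<m}. complex_of_real (e k) * hermite_proj k f x"
    have u: "F m x - F n x = ?u x" for x
      unfolding F_def using sum_diff_nat_ivl[of 0 n m] that by (simp add: atLeast0LessThan)
    have "bracket ?u ?u = (\<Sum>j\<in>{n..<m}. of_real (e j) * (\<Sum>k\<in>{n..<m}. of_real (e k) * bracket (hermite_proj j f) (hermite_proj k f)))"
      by (subst bracket_sum, intro pL2, intro L2_sum pL2)
         (simp add: bracket_scale bracket_sum_right hermite_proj_L2 f)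
    also have "\<dots> = of_real (\<Sum>k\<in>{n..<m}. (e k)\<^sup>2 * hermite_energy f k)"
      by (simp add: bracket_hermite_proj_proj[OF f] if_distrib[of "\<lambda>c. _ * c"] sum.delta power2_eq_square mult.assoc cong: if_cong)
    finally have "(LINT x|lborel. (norm (?u x))\<^sup>2) = (\<Sum>k\<in>{n..<m}. (e k)\<^sup>2 * hermite_energy f k)"
      unfolding bracket_self by (simp only: of_real_eq_iff)
    also have "\<dots> \<le> (\<Sum>k\<in>{n..<m}. 1 * hermite_energy f k)"
      using e by (intro sum_mono mult_right_mono hermite_energy_nonneg) (auto simp: power_le_one)
    finally show ?thesis by (simp add: u)
  qed
  have "\<exists>h. L2_lim F h"
  proof (rule L2_complete[OF FL2])
    fix \<epsilon> :: real assume "\<epsilon> > 0"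
    then obtain N where N: "\<And>m n. m \<ge> N \<Longrightarrow> norm (\<Sum>k\<in>{m..<n}. hermite_energy f k) < \<epsilon>"
      using summable_hermite_energy[OF f] unfolding summable_Cauchy by blast
    have le: "(LINT x|lborel. (norm (F m x - F n x))\<^sup>2) \<le> \<epsilon>" if "N \<le> n" "n \<le> m" for m n
      using Fdiff[OF that(2)] N[OF that(1), of m] by simp
    have "(LINT x|lborel. (norm (F m x - F n x))\<^sup>2) \<le> \<epsilon>" if "N \<le> n" "N \<le> m" for m n
      using le[of n m] le[of m n] that by (cases "n \<le> m") (auto simp: norm_minus_commute)
    then show "\<exists>N. \<forall>m\<ge>N. \<forall>n\<ge>N. (LINT x|lborel. (norm (F m x - F n x))\<^sup>2) \<le> \<epsilon>" by blast
  qed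
  from someI_ex[OF this] have "L2_lim F (hermite_semigroup \<beta> t f)"
    unfolding hermite_semigroup_def F_def e_def .
  from L2_lim_bracket[OF this g]
  have "(\<lambda>N. bracket (F N) g) \<longlonglongrightarrow> bracket (hermite_semigroup \<beta> t f) g" .
  moreover have "bracket (F N) g = (\<Sum>k<N. of_real (e k) * hermite_level f g k)" for N
    unfolding F_def by (subst bracket_sum, intro pL2, rule g)
      (simp add: bracket_scale bracket_hermite_proj f g)
  ultimately show ?thesis by (simp add: sums_def e_def)
qed

section \<open>The multi-dimensional Mehler kernel\<close>

definition mehler_vec :: "real \<Rightarrow> real^'n \<Rightarrow> real^'n \<Rightarrow> real" where
  "mehler_vec r u v = (\<Prod>i\<in>UNIV. mehler r (u $ i) (v $ i))"

lemma mehler_nonneg: "\<bar>r\<bar> \<le> 1 \<Longrightarrow> 0 \<le> mehler r x y"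
  by (simp add: mehler_def abs_square_le_1)

lemma mehler_le:
  assumes "0 \<le> r" "r < 1"
  shows "mehler r x y \<le> inverse (sqrt (pi * (1 - r\<^sup>2)))"
proof -
  have "0 < 1 - r\<^sup>2" using assms by (simp add: power_less_one_iff abs_square_less_1)
  moreover have "- ((1 - r) / (1 + r) * (x + y)\<^sup>2 / 4) - (1 + r) / (1 - r) * (x - y)\<^sup>2 / 4 \<le> 0"
  proof -
    have "0 \<le> (1 - r) / (1 + r) * (x + y)\<^sup>2 / 4" "0 \<le> (1 + r) / (1 - r) * (x - y)\<^sup>2 / 4"
      using assms by auto
    then show ?thesis by linarith
  qed
  ultimately show ?thesis
    unfolding mehler_def inverse_eq_divide by (intro divide_right_mono) auto
qed

lemma mehler_vec_measurable [measurable]: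
  "(\<lambda>p. mehler_vec r (fst p) (snd p)) \<in> borel_measurable (borel \<Otimes>\<^sub>M borel :: ((real^'n) \<times> (real^'n)) measure)"
  unfolding mehler_vec_def mehler_def divide_inverse borel_prod
  by (intro borel_measurable_continuous_onI continuous_intros)

text \<open>Absolute convergence in every coordinate makes the sum over all multi-indices
  unconditional and equal to the product of the coordinate sums; it may then be regrouped by total
  degree, each class being finite.\<close>

lemma sums_degree:
  fixes f :: "'n::finite \<Rightarrow> nat \<Rightarrow> real"
  assumes abs: "\<And>i. summable (\<lambda>k. norm (f i k))" and S: "\<And>i. f i sums S i"
  shows "(\<lambda>k. \<Sum>\<alpha>\<in>degree_set k. \<Prod>i\<in>UNIV. f i (\<alpha> i)) sums (\<Prod>i\<in>UNIV. S i)"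
proof -
  define F where "F \<alpha> = (\<Prod>i\<in>UNIV. f i (\<alpha> i))" for \<alpha> :: "'n \<Rightarrow> nat"
  have hs: "(f i has_sum S i) UNIV" for i
    by (intro norm_summable_imp_has_sum abs S)
  have abs': "Infinite_Sum.abs_summable_on (f i) UNIV" for i
    using abs[of i] norm_summable_imp_summable_on[of "\<lambda>k. norm (f i k)"] by simp
  have univ: "PiE UNIV (\<lambda>_::'n. UNIV) = (UNIV :: ('n \<Rightarrow> nat) set)" by auto
  have "Infinite_Sum.abs_summable_on F UNIV"
    using abs_summable_on_prod_PiE[of UNIV "\<lambda>_. UNIV" f] abs'
    unfolding abs_summable_equivalent univ F_def by simp
  then have "F summable_on UNIV" by (rule abs_summable_summable)
  moreover have "infsum F UNIV = (\<Prod>i\<in>UNIV. S i)"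
    using infsum_prod_PiE_abs[of UNIV f "\<lambda>_. UNIV"] abs' hs
    unfolding univ F_def by (simp add: infsumI[OF hs])
  ultimately have "(F has_sum (\<Prod>i\<in>UNIV. S i)) UNIV"
    by (metis has_sum_infsum)
  moreover have "bij_betw snd (SIGMA k:UNIV. degree_set k) (UNIV :: ('n \<Rightarrow> nat) set)"
    by (rule bij_betwI[of _ _ _ "\<lambda>\<alpha>. (\<Sum>i\<in>UNIV. \<alpha> i, \<alpha>)"]) auto
  ultimately have "((\<lambda>p. F (snd p)) has_sum (\<Prod>i\<in>UNIV. S i)) (SIGMA k:UNIV. degree_set k)"
    by (subst has_sum_reindex_bij_betw[where f = F])
  then have "((\<lambda>k. \<Sum>\<alpha>\<in>degree_set k. F \<alpha>) has_sum (\<Prod>i\<in>UNIV. S i)) UNIV"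
    by (rule has_sum_SigmaD) (auto intro!: has_sum_finite finite_degree_set)
  then show ?thesis
    unfolding F_def by (rule has_sum_imp_sums)
qed

lemma mehler_hermite_fun:
  fixes u v :: "real^'n"
  assumes r: "0 \<le> r" "r < 1"
  shows "(\<lambda>k. of_real r ^ k * (\<Sum>\<alpha>\<in>degree_set k. hermite_fun \<alpha> u * hermite_fun \<alpha> v)) sums of_real (mehler_vec r u v)"
proof -
  define f where "f i k = r ^ k * (hermite_fun1 k (u $ i) * hermite_fun1 k (v $ i))" for i k
  define F where "F \<alpha> = (\<Prod>i\<in>UNIV. f i (\<alpha> i))" for \<alpha> :: "'n \<Rightarrow> nat"
  have "(\<lambda>k. \<Sum>\<alpha>\<in>degree_set k. F \<alpha>) sums mehler_vec r u v"
    unfolding F_def mehler_vec_def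
    by (rule sums_degree) (auto simp only: f_def intro: mehler_abs_summable[OF r] mehler_hermite_fun1[OF r])
  then have "(\<lambda>k. complex_of_real (\<Sum>\<alpha>\<in>degree_set k. F \<alpha>)) sums of_real (mehler_vec r u v)"
    by (rule sums_of_real)
  moreover have "complex_of_real (\<Sum>\<alpha>\<in>degree_set k. F \<alpha>)
      = of_real r ^ k * (\<Sum>\<alpha>\<in>degree_set k. hermite_fun \<alpha> u * hermite_fun \<alpha> v)" for k
    unfolding of_real_sum sum_distrib_left
  proof (rule sum.cong)
    fix \<alpha> :: "'n \<Rightarrow> nat" assume "\<alpha> \<in> degree_set k"
    then have "(\<Prod>i\<in>UNIV. r ^ \<alpha> i) = r ^ k" by (simp flip: power_sum)
    then have "F \<alpha> = r ^ k * ((\<Prod>i\<in>UNIV. hermite_fun1 (\<alpha> i) (u $ i)) * (\<Prod>i\<in>UNIV. hermite_fun1 (\<alpha> i) (v $ i)))"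
      by (simp add: F_def f_def prod.distrib)
    then show "complex_of_real (F \<alpha>) = of_real r ^ k * (hermite_fun \<alpha> u * hermite_fun \<alpha> v)"
      unfolding hermite_fun_def by (simp only: of_real_mult of_real_power)
  qed simp
  ultimately show ?thesis by simp
qed

text \<open>The number of multi-indices of degree k has the generating function (1 - r)^(-d),
  obtained from a geometric series in each coordinate.\<close>

lemma summable_card_degree_set:
  assumes "0 \<le> r" "r < 1"
  shows "summable (\<lambda>k. r ^ k * real (card (degree_set k :: ('n::finite \<Rightarrow> nat) set)))"
proof -
  have "(\<lambda>k. \<Sum>\<alpha>\<in>(degree_set k :: ('n \<Rightarrow> nat) set). \<Prod>i\<in>UNIV. r ^ \<alpha> i) sums (\<Prod>i\<in>(UNIV :: 'n set). 1 / (1 - r))"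
    using assms by (intro sums_degree geometric_sums) (auto simp: power_abs[symmetric] intro!: summable_geometric)
  moreover have "(\<Sum>\<alpha>\<in>(degree_set k :: ('n \<Rightarrow> nat) set). \<Prod>i\<in>UNIV. r ^ \<alpha> i)
      = r ^ k * real (card (degree_set k :: ('n \<Rightarrow> nat) set))" for k
    by (simp flip: power_sum)
  ultimately show ?thesis by (simp add: sums_iff)
qed

lemma integral_norm_hermite_fun_le:
  assumes "f \<in> L2"
  shows "(LINT x|lborel. norm (f x) * norm (hermite_fun \<alpha> x)) \<le> (LINT x|lborel. (norm (f x))\<^sup>2) + 1"
proof -
  have "(LINT x|lborel. norm (f x) * norm (hermite_fun \<alpha> x)) \<le>
     (LINT x|lborel. (norm (f x))\<^sup>2 + (norm (hermite_fun \<alpha> x))\<^sup>2)"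
  proof (rule integral_mono)
    show "norm (f x) * norm (hermite_fun \<alpha> x) \<le> (norm (f x))\<^sup>2 + (norm (hermite_fun \<alpha> x))\<^sup>2" for x
      by (rule mult_le_sum_squares)
  qed (use assms hermite_fun_L2 in \<open>auto intro!: L2_integrable_mult L2_integrable Bochner_Integration.integrable_add\<close>)
  also have "\<dots> = (LINT x|lborel. (norm (f x))\<^sup>2) + (LINT x|lborel. (norm (hermite_fun \<alpha> x))\<^sup>2)"
    using assms hermite_fun_L2 L2_integrable by (intro Bochner_Integration.integral_add) blast+
  also have "(LINT x|lborel. (norm (hermite_fun \<alpha> x))\<^sup>2) = 1"
    using bracket_hermite_fun[of \<alpha> \<alpha>] unfolding bracket_self by (simp only: if_True refl of_real_eq_1_iff simp_thms)
  finally show ?thesis .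
qed

text \<open>Sum and integral are exchanged. Each product of Hermite functions with f and g has an L1
  norm at most K, a constant independent of the multi-index, so level k contributes at most K r^k
  times the number of multi-indices.\<close>

lemma hermite_level_kernel:
  fixes f g :: "real^'n \<Rightarrow> complex"
  assumes f: "f \<in> L2" and g: "g \<in> L2" and r: "0 \<le> r" "r < 1"
  shows "(\<lambda>k. of_real r ^ k * hermite_level f g k) sums
    (LINT p|(lborel \<Otimes>\<^sub>M lborel). of_real (mehler_vec r (fst p) (snd p)) * (cnj (g (fst p)) * f (snd p)))"
proof -
  let ?M = "lborel \<Otimes>\<^sub>M lborel :: ((real^'n) \<times> (real^'n)) measure"
  let ?h = "\<lambda>\<alpha> p. (hermite_fun \<alpha> (fst p) * cnj (g (fst p))) * (f (snd p) * hermite_fun \<alpha> (snd p))"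
  let ?S = "\<lambda>k p. \<Sum>\<alpha>\<in>degree_set k. ?h \<alpha> p"
  let ?T = "\<lambda>k p. of_real r ^ k * ?S k p"
  have i1: "integrable lborel (\<lambda>u. hermite_fun \<alpha> u * cnj (g u))" for \<alpha>
    by (intro L2_integrable_mult hermite_fun_L2 g)
  have i2: "integrable lborel (\<lambda>v. f v * hermite_fun \<alpha> v)" for \<alpha>
    using L2_integrable_mult(1)[OF f hermite_fun_L2[of \<alpha>]] by simp
  have hi: "integrable ?M (?h \<alpha>)" for \<alpha>
    using lborel_pair_mult(1)[OF i1 i2] by (simp add: case_prod_unfold)
  have hI: "(LINT p|?M. ?h \<alpha> p) = hermite_coeff f \<alpha> * cnj (hermite_coeff g \<alpha>)" for \<alpha>
  proof -
    have "(LINT p|?M. ?h \<alpha> p) = bracket (hermite_fun \<alpha>) g * bracket f (hermite_fun \<alpha>)"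
      using lborel_pair_mult(2)[OF i1[of \<alpha>] i2[of \<alpha>]] by (simp add: case_prod_unfold bracket_def)
    then show ?thesis by (simp add: hermite_coeff_def bracket_cnj[of "hermite_fun \<alpha>" g])
  qed
  define K where "K = ((LINT x|lborel. (norm (f x))\<^sup>2) + 1) * ((LINT x|lborel. (norm (g x))\<^sup>2) + 1)"
  have K: "0 \<le> K" by (simp add: K_def)
  have hn: "(LINT p|?M. norm (?h \<alpha> p)) \<le> K" for \<alpha>
  proof -
    have "(LINT p|?M. norm (?h \<alpha> p)) = (LINT u|lborel. norm (hermite_fun \<alpha> u * cnj (g u))) * (LINT v|lborel. norm (f v * hermite_fun \<alpha> v))"
      using lborel_pair_mult(2)[OF integrable_norm[OF i1[of \<alpha>]] integrable_norm[OF i2[of \<alpha>]]]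
      by (simp add: case_prod_unfold norm_mult)
    also have "\<dots> = (LINT u|lborel. norm (g u) * norm (hermite_fun \<alpha> u)) * (LINT v|lborel. norm (f v) * norm (hermite_fun \<alpha> v))"
      by (simp add: norm_mult mult.commute)
    also have "\<dots> \<le> ((LINT x|lborel. (norm (g x))\<^sup>2) + 1) * ((LINT x|lborel. (norm (f x))\<^sup>2) + 1)"
      by (intro mult_mono integral_norm_hermite_fun_le f g add_nonneg_nonneg Bochner_Integration.integral_nonneg) auto
    finally show ?thesis by (simp add: K_def mult.commute)
  qed
  have Ti: "integrable ?M (?T k)" for k
    by (intro integrable_mult_right Bochner_Integration.integrable_sum hi)
  have TI: "(LINT p|?M. ?T k p) = of_real r ^ k * hermite_level f g k" for k
    by (subst integral_mult_right_zero, subst Bochner_Integration.integral_sum)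
       (auto simp only: hi hI hermite_level_def)
  have Tn: "(LINT p|?M. norm (?T k p)) \<le> r ^ k * (real (card (degree_set k :: ('n \<Rightarrow> nat) set)) * K)" for k
  proof -
    have "(LINT p|?M. norm (?T k p)) \<le> (LINT p|?M. r ^ k * (\<Sum>\<alpha>\<in>degree_set k. norm (?h \<alpha> p)))"
    proof (rule integral_mono)
      show "norm (?T k p) \<le> r ^ k * (\<Sum>\<alpha>\<in>degree_set k. norm (?h \<alpha> p))" for p
        unfolding norm_mult[of "of_real r ^ k"] norm_power norm_of_real using r
        by (intro mult_mono norm_sum) auto
    qed (intro integrable_norm Ti integrable_mult_right Bochner_Integration.integrable_sum hi)+
    also have "\<dots> = r ^ k * (\<Sum>\<alpha>\<in>degree_set k. LINT p|?M. norm (?h \<alpha> p))"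
      by (subst integral_mult_right_zero, subst Bochner_Integration.integral_sum)
         (auto intro: integrable_norm[OF hi])
    also have "\<dots> \<le> r ^ k * (real (card (degree_set k :: ('n \<Rightarrow> nat) set)) * K)"
      using sum_mono[of "degree_set k :: ('n \<Rightarrow> nat) set" "\<lambda>\<alpha>. LINT p|?M. norm (?h \<alpha> p)" "\<lambda>_. K"] hn r
      by (intro mult_left_mono) auto
    finally show ?thesis by simp
  qed
  have TS: "(\<lambda>k. of_real r ^ k * ?S k p) sums (of_real (mehler_vec r (fst p) (snd p)) * (cnj (g (fst p)) * f (snd p)))"
    if r: "0 \<le> r" "r < 1" for p r
  proof -
    have "of_real r ^ k * ?S k p = of_real r ^ k * (\<Sum>\<alpha>\<in>degree_set k. hermite_fun \<alpha> (fst p) * hermite_fun \<alpha> (snd p)) * (cnj (g (fst p)) * f (snd p))" for k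
      by (simp add: sum_distrib_left sum_distrib_right mult_ac)
    then show ?thesis
      using sums_mult2[OF mehler_hermite_fun[OF r], of "fst p" "snd p" "cnj (g (fst p)) * f (snd p)"]
      by (simp only:)
  qed
  have sm: "summable (\<lambda>k. r ^ k * (real (card (degree_set k :: ('n \<Rightarrow> nat) set)) * K))"
    using summable_mult2[OF summable_card_degree_set[where 'n = 'n, OF r], of K] by (simp add: mult.assoc)
  have "(\<lambda>k. LINT p|?M. ?T k p) sums (LINT p|?M. (\<Sum>k. ?T k p))"
  proof (rule sums_integral[OF Ti])
    show "AE p in ?M. summable (\<lambda>k. norm (?T k p))"
    proof (intro AE_I2)
      fix p :: "(real^'n) \<times> (real^'n)"
      \<comment> \<open>For fixed p this is a power series in r. Mehler's formula at a point s
        strictly between r and 1 gives convergence there, hence absolute convergence at r.\<close>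
      define s where "s = (1 + r) / 2"
      have s: "0 \<le> s" "s < 1" "r < s" using r by (auto simp: s_def)
      from powser_insidea[OF sums_summable[OF TS[OF s(1,2), of p, unfolded mult.commute[of "of_real s ^ _"]]], of "of_real r"]
      show "summable (\<lambda>k. norm (?T k p))" using s r by (simp add: mult.commute)
    qed
    show "summable (\<lambda>k. LINT p|?M. norm (?T k p))"
      by (rule summable_comparison_test[OF _ sm]) (use Tn in auto)
  qed
  then show ?thesis unfolding TI by (simp only: sums_unique[OF TS[OF r], symmetric])
qed

section \<open>Symbols that are functions of a quadratic form\<close>

lemma japanese_ge_1: "1 \<le> japanese z"
  by (simp add: japanese_def)

lemma japanese_pos: "0 < japanese z"
  using japanese_ge_1[of z] by linarith

lemma norm_le_japanese: "norm z \<le> japanese z"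
  unfolding japanese_def by (rule real_le_rsqrt) simp

lemma basis_list: "distinct (basis_list :: 'a::euclidean_space list)" "set (basis_list :: 'a list) = Basis"
proof -
  have "\<exists>bs::'a list. distinct bs \<and> set bs = Basis"
    using finite_distinct_list[OF finite_Basis] by blast
  from someI_ex[OF this] show "distinct (basis_list :: 'a list)" "set (basis_list :: 'a list) = Basis"
    unfolding basis_list_def by auto
qed

lemma mi_deriv_list:
  fixes \<alpha> :: "'a::euclidean_space \<Rightarrow> nat"
  defines "bs \<equiv> concat (map (\<lambda>b. replicate (\<alpha> b) b) basis_list)"
  shows "mi_deriv \<alpha> f = iter_partial bs f" "set bs \<subseteq> Basis" "length bs = mi_order \<alpha>"
proof -
  show "mi_deriv \<alpha> f = iter_partial bs f" by (simp add: mi_deriv_def bs_def)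
  show "set bs \<subseteq> Basis" by (auto simp: bs_def basis_list)
  show "length bs = mi_order \<alpha>"
    unfolding bs_def mi_order_def
    by (simp add: length_concat o_def sum_list_distinct_conv_sum_set basis_list)
qed

text \<open>
  Functions of a parameter \<open>t\<close> and of \<open>z\<close> that are sums of products of \<open>\<phi> t m (Q z)\<close> with
  linear forms; \<open>k\<close> is the order of decay when \<open>\<phi> t m q\<close> is of size \<open>(1 + q)\<^sup>- \<^sup>m\<close> and \<open>Q\<close> is
  a definite quadratic form.
\<close>

inductive weighted :: "(real \<Rightarrow> nat \<Rightarrow> real \<Rightarrow> real) \<Rightarrow> ('a::euclidean_space \<Rightarrow> real) \<Rightarrow> int \<Rightarrow> (real \<Rightarrow> 'a \<Rightarrow> real) \<Rightarrow> bool"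
  for \<phi> Q where
  base: "weighted \<phi> Q (2 * int m) (\<lambda>t z. \<phi> t m (Q z))"
| linear: "weighted \<phi> Q k p \<Longrightarrow> weighted \<phi> Q (k - 1) (\<lambda>t z. (z \<bullet> u) * p t z)"
| scale: "weighted \<phi> Q k p \<Longrightarrow> weighted \<phi> Q k (\<lambda>t z. c * p t z)"
| add: "weighted \<phi> Q k p \<Longrightarrow> weighted \<phi> Q k q \<Longrightarrow> weighted \<phi> Q k (\<lambda>t z. p t z + q t z)"

text \<open>A factor \<open>z \<bullet> u\<close> costs one power of \<open>japanese z\<close>,
  matching the drop of k by one. Exponents are integers because linear factors can take k below
  0.\<close>

lemma weighted_bound:
  assumes \<phi>: "\<And>m. \<exists>C. \<forall>t\<in>S. \<forall>q\<ge>0. \<bar>\<phi> t m q\<bar> * (1 + q) ^ m \<le> C"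
    and Q: "\<And>z. (norm z)\<^sup>2 \<le> Q z"
    and "weighted \<phi> Q k p"
  shows "\<exists>C. \<forall>t\<in>S. \<forall>z. \<bar>p t z\<bar> * japanese z powi k \<le> C"
  using assms(3)
proof induction
  case (base m)
  obtain C where C: "\<And>t q. t \<in> S \<Longrightarrow> q \<ge> 0 \<Longrightarrow> \<bar>\<phi> t m q\<bar> * (1 + q) ^ m \<le> C"
    using \<phi> by meson
  have "\<bar>\<phi> t m (Q z)\<bar> * japanese z powi (2 * int m) \<le> C" if "t \<in> S" for t z
  proof -
    have "0 \<le> Q z" using Q[of z] zero_le_power2[of "norm z"] by linarith
    have "japanese z powi (2 * int m) = (1 + (norm z)\<^sup>2) ^ m"
    proof -
      have "japanese z powi (2 * int m) = ((japanese z)\<^sup>2) ^ m"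
        by (simp add: power_int_mult flip: power_mult)
      then show ?thesis by (simp add: japanese_def)
    qed
    also have "\<dots> \<le> (1 + Q z) ^ m" using Q by (intro power_mono) auto
    finally have "\<bar>\<phi> t m (Q z)\<bar> * japanese z powi (2 * int m) \<le> \<bar>\<phi> t m (Q z)\<bar> * (1 + Q z) ^ m"
      by (intro mult_left_mono) auto
    also have "\<dots> \<le> C" using C that \<open>0 \<le> Q z\<close> by blast
    finally show ?thesis .
  qed
  then show ?case by blast
next
  case (linear k p u)
  then obtain C where C: "\<And>t z. t \<in> S \<Longrightarrow> \<bar>p t z\<bar> * japanese z powi k \<le> C" by meson
  have "\<bar>(z \<bullet> u) * p t z\<bar> * japanese z powi (k - 1) \<le> norm u * C" if t: "t \<in> S" for t z
  proof -
    have "\<bar>z \<bullet> u\<bar> \<le> norm u * japanese z"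
      using Cauchy_Schwarz_ineq2[of z u] norm_le_japanese[of z]
      by (metis mult.commute mult_left_mono norm_ge_zero order_trans)
    then have "\<bar>(z \<bullet> u) * p t z\<bar> * japanese z powi (k - 1) \<le> norm u * japanese z * \<bar>p t z\<bar> * japanese z powi (k - 1)"
      unfolding abs_mult using japanese_pos[of z] by (intro mult_right_mono) auto
    also have "\<dots> = norm u * (\<bar>p t z\<bar> * (japanese z * japanese z powi (k - 1)))" by simp
    also have "japanese z * japanese z powi (k - 1) = japanese z powi k"
      using japanese_pos[of z] by (simp add: power_int_diff)
    also have "norm u * (\<bar>p t z\<bar> * japanese z powi k) \<le> norm u * C"
      using C[OF t] by (intro mult_left_mono) auto
    finally show ?thesis .
  qed
  then show ?case by blast
next
  case (scale k p c)
  then obtain C where C: "\<And>t z. t \<in> S \<Longrightarrow> \<bar>p t z\<bar> * japanese z powi k \<le> C" by meson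
  have "\<bar>c * p t z\<bar> * japanese z powi k \<le> \<bar>c\<bar> * C" if "t \<in> S" for t z
    using mult_left_mono[OF C[OF that, of z], of "\<bar>c\<bar>"] by (simp add: abs_mult mult.assoc)
  then show ?case by blast
next
  case (add k p q)
  then obtain C D where C: "\<And>t z. t \<in> S \<Longrightarrow> \<bar>p t z\<bar> * japanese z powi k \<le> C"
    and D: "\<And>t z. t \<in> S \<Longrightarrow> \<bar>q t z\<bar> * japanese z powi k \<le> D" by meson
  have "\<bar>p t z + q t z\<bar> * japanese z powi k \<le> C + D" if t: "t \<in> S" for t z
  proof -
    have "\<bar>p t z + q t z\<bar> * japanese z powi k \<le> (\<bar>p t z\<bar> + \<bar>q t z\<bar>) * japanese z powi k"
      using japanese_pos[of z] by (intro mult_right_mono) auto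
    then show ?thesis using C[OF t, of z] D[OF t, of z] by (simp add: algebra_simps)
  qed
  then show ?case by blast
qed

text \<open>Differentiating \<phi> t m (Q z) raises m, a gain of 2, and produces a linear factor, a
  loss of 1; differentiating a linear factor removes it, again a net gain of 1. So each derivative
  improves the decay by one order, as the Shubin class requires.\<close>

lemma weighted_derivative:
  assumes \<phi>: "\<And>t m q. t \<in> S \<Longrightarrow> (\<phi> t m has_real_derivative - \<phi> t (Suc m) q) (at q)"
    and Q: "\<And>z. (Q has_derivative (\<lambda>h. z \<bullet> L h)) (at z)"
    and "weighted \<phi> Q k p"
  shows "\<exists>D. (\<forall>t\<in>S. \<forall>z. (p t has_derivative (\<lambda>h. D h t z)) (at z)) \<and> (\<forall>h. weighted \<phi> Q (k + 1) (D h))"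
  using assms(3)
proof induction
  case (base m)
  let ?D = "\<lambda>h t z. (z \<bullet> L h) * (- 1 * \<phi> t (Suc m) (Q z))"
  have "((\<lambda>z. \<phi> t m (Q z)) has_derivative (\<lambda>h. ?D h t z)) (at z)" if "t \<in> S" for t z
    using diff_chain_at[OF Q \<phi>[OF that, unfolded has_field_derivative_def]]
    by (simp add: o_def mult.commute)
  moreover have "weighted \<phi> Q (2 * int m + 1) (?D h)" for h
    using weighted.linear[OF weighted.scale[OF weighted.base[of \<phi> Q "Suc m"]], of "L h" "-1"]
    by (simp add: algebra_simps)
  ultimately show ?case by (intro exI[of _ ?D]) auto
next
  case (linear k p u)
  then obtain D where D: "\<And>t z. t \<in> S \<Longrightarrow> (p t has_derivative (\<lambda>h. D h t z)) (at z)"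
    and W: "\<And>h. weighted \<phi> Q (k + 1) (D h)" by blast
  let ?D = "\<lambda>h t z. (z \<bullet> u) * D h t z + (h \<bullet> u) * p t z"
  have "((\<lambda>z. (z \<bullet> u) * p t z) has_derivative (\<lambda>h. ?D h t z)) (at z)" if "t \<in> S" for t z
    by (auto intro!: derivative_eq_intros D[OF that])
  moreover have "weighted \<phi> Q (k - 1 + 1) (?D h)" for h
    using weighted.linear[OF W[of h], of u] weighted.scale[OF linear.hyps, of "h \<bullet> u"]
    by (intro weighted.add) simp_all
  ultimately show ?case by (intro exI[of _ ?D]) auto
next
  case (scale k p c)
  then obtain D where D: "\<And>t z. t \<in> S \<Longrightarrow> (p t has_derivative (\<lambda>h. D h t z)) (at z)"
    and W: "\<And>h. weighted \<phi> Q (k + 1) (D h)" by blast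
  have "((\<lambda>z. c * p t z) has_derivative (\<lambda>h. c * D h t z)) (at z)" if "t \<in> S" for t z
    by (auto intro!: derivative_eq_intros D[OF that])
  with weighted.scale[OF W] show ?case by (intro exI[of _ "\<lambda>h t z. c * D h t z"]) auto
next
  case (add k p q)
  then obtain D E where D: "\<And>t z. t \<in> S \<Longrightarrow> (p t has_derivative (\<lambda>h. D h t z)) (at z)"
    and E: "\<And>t z. t \<in> S \<Longrightarrow> (q t has_derivative (\<lambda>h. E h t z)) (at z)"
    and W: "\<And>h. weighted \<phi> Q (k + 1) (D h)" "\<And>h. weighted \<phi> Q (k + 1) (E h)" by blast
  have "((\<lambda>z. p t z + q t z) has_derivative (\<lambda>h. D h t z + E h t z)) (at z)" if "t \<in> S" for t z
    by (auto intro!: derivative_eq_intros D[OF that] E[OF that])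
  with weighted.add[OF W] show ?case by (intro exI[of _ "\<lambda>h t z. D h t z + E h t z"]) auto
qed

text \<open>One family p serves all t in S at once; this is what makes the constants of the later
  bounds independent of t.\<close>

lemma weighted_iter_partial:
  assumes \<phi>: "\<And>t m q. t \<in> S \<Longrightarrow> (\<phi> t m has_real_derivative - \<phi> t (Suc m) q) (at q)"
    and Q: "\<And>z. (Q has_derivative (\<lambda>h. z \<bullet> L h)) (at z)"
  shows "\<exists>p. weighted \<phi> Q (int (length bs)) p \<and>
    (\<forall>t\<in>S. iter_partial bs (\<lambda>z. complex_of_real (\<phi> t 0 (Q z))) = (\<lambda>z. of_real (p t z)))"
proof (induction bs)
  case Nil
  show ?case using weighted.base[of \<phi> Q 0] by (auto simp: iter_partial_def)
next
  case (Cons b bs)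
  then obtain p where p: "weighted \<phi> Q (int (length bs)) p"
    and eq: "\<And>t. t \<in> S \<Longrightarrow> iter_partial bs (\<lambda>z. complex_of_real (\<phi> t 0 (Q z))) = (\<lambda>z. of_real (p t z))" by blast
  from weighted_derivative[where S = S and \<phi> = \<phi> and Q = Q and L = L, OF \<phi> Q p]
  obtain D where D: "\<And>t z. t \<in> S \<Longrightarrow> (p t has_derivative (\<lambda>h. D h t z)) (at z)"
    and W: "\<And>h. weighted \<phi> Q (int (length bs) + 1) (D h)" by blast
  have "iter_partial (b # bs) (\<lambda>z. complex_of_real (\<phi> t 0 (Q z))) = (\<lambda>z. of_real (D b t z))" if "t \<in> S" for t
  proof -
    have step: "iter_partial (b # bs) (\<lambda>z. complex_of_real (\<phi> t 0 (Q z))) = partial_deriv b (\<lambda>z. of_real (p t z))"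
      using eq[OF that] by (simp add: iter_partial_def)
    have "((\<lambda>z. complex_of_real (p t z)) has_derivative (\<lambda>h. of_real (D h t z))) (at z)" for z
      by (rule has_derivative_of_real[OF D[OF that]])
    from fun_cong[OF frechet_derivative_at[OF this]]
    have "frechet_derivative (\<lambda>z. complex_of_real (p t z)) (at z) b = of_real (D b t z)" for z
      by (rule sym)
    with step show ?thesis
      unfolding partial_deriv_def by simp
  qed
  with W[of b] show ?case by (intro exI[of _ "D b"]) (auto simp: add.commute)
qed

lemma shubin_of_quadratic:
  fixes Q :: "(real^'n) \<times> (real^'n) \<Rightarrow> real" and S :: "real set"
  assumes \<phi>d: "\<And>t m q. t \<in> S \<Longrightarrow> (\<phi> t m has_real_derivative - \<phi> t (Suc m) q) (at q)"
    and \<phi>b: "\<And>m. \<exists>C. \<forall>t\<in>S. \<forall>q\<ge>0. \<bar>\<phi> t m q\<bar> * (1 + q) ^ m \<le> C"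
    and Qd: "\<And>z. (Q has_derivative (\<lambda>h. z \<bullet> L h)) (at z)"
    and Qb: "\<And>z. (norm z)\<^sup>2 \<le> Q z"
  defines "b \<equiv> \<lambda>t z. complex_of_real (\<phi> t 0 (Q z))"
  shows "t \<in> S \<Longrightarrow> b t \<in> shubin_class"
    and "(SUP t\<in>S. shubin_seminorm k (b t)) < \<infinity>"
proof -
  have "\<exists>C. \<forall>t\<in>S. \<forall>z. norm (iter_partial bs (b t) z) * japanese z ^ length bs \<le> C" for bs
  proof -
    from weighted_iter_partial[where S = S and \<phi> = \<phi> and Q = Q and L = L and bs = bs, OF \<phi>d Qd]
    obtain p where p: "weighted \<phi> Q (int (length bs)) p"
      "\<And>t. t \<in> S \<Longrightarrow> iter_partial bs (b t) = (\<lambda>z. of_real (p t z))"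
      unfolding b_def by blast
    from weighted_bound[where S = S and \<phi> = \<phi> and Q = Q, OF \<phi>b Qb p(1)] p(2) show ?thesis by (simp add: power_int_def)
  qed
  then obtain C where C: "\<And>bs t z. t \<in> S \<Longrightarrow> norm (iter_partial bs (b t) z) * japanese z ^ length bs \<le> C bs"
    by metis
  have smooth: "smooth_fun (b t)" if "t \<in> S" for t
    unfolding smooth_fun_def
  proof (intro allI impI)
    fix bs
    from weighted_iter_partial[where S = S and \<phi> = \<phi> and Q = Q and L = L and bs = bs, OF \<phi>d Qd]
    obtain p where p: "weighted \<phi> Q (int (length bs)) p"
      "\<And>t. t \<in> S \<Longrightarrow> iter_partial bs (b t) = (\<lambda>z. of_real (p t z))"
      unfolding b_def by blast
    from weighted_derivative[where S = S and \<phi> = \<phi> and Q = Q and L = L, OF \<phi>d Qd p(1)] that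
    obtain D where "\<And>z. (p t has_derivative (\<lambda>h. D h t z)) (at z)" by blast
    then have "((\<lambda>z. complex_of_real (p t z)) has_derivative (\<lambda>h. of_real (D h t z))) (at z)" for z
      by (rule has_derivative_of_real)
    then show "iter_partial bs (b t) differentiable_on UNIV"
      unfolding p(2)[OF that] by (auto intro!: differentiableI differentiable_at_imp_differentiable_on)
  qed
  show "b t \<in> shubin_class" if "t \<in> S" for t
    unfolding shubin_class_def
  proof (intro CollectI conjI allI smooth that)
    fix \<alpha> :: "(real^'n) \<times> (real^'n) \<Rightarrow> nat"
    let ?bs = "concat (map (\<lambda>b. replicate (\<alpha> b) b) basis_list)"
    have "norm (mi_deriv \<alpha> (b t) z) \<le> max 0 (C ?bs) * japanese z powr - real (mi_order \<alpha>)" for z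
    proof -
      have "norm (mi_deriv \<alpha> (b t) z) * japanese z ^ mi_order \<alpha> \<le> max 0 (C ?bs)"
        using C[OF that, of ?bs z] by (simp add: mi_deriv_list)
      then show ?thesis
        using japanese_pos[of z]
        by (simp add: powr_minus powr_realpow field_simps)
    qed
    then show "\<exists>C\<ge>0. \<forall>z. norm (mi_deriv \<alpha> (b t) z) \<le> C * japanese z powr - real (mi_order \<alpha>)"
      by (intro exI[of _ "max 0 (C ?bs)"]) auto
  qed
  \<comment> \<open>There are infinitely many functions \<open>\<alpha>\<close> of order at most k,
    since values off \<open>Basis\<close> are free. The derivative depends only on the list of
    directions, and of these there are finitely many, so a finite sum bounds all cases.\<close>
  define N where "N = {bs :: ((real^'n) \<times> (real^'n)) list. set bs \<subseteq> Basis \<and> length bs \<le> k}"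
  have fin: "finite N" unfolding N_def by (rule finite_lists_length_le) simp
  have "shubin_seminorm k (b t) \<le> ennreal (\<Sum>bs\<in>N. \<bar>C bs\<bar>)" if "t \<in> S" for t
    unfolding shubin_seminorm_def
  proof (intro SUP_least)
    fix \<alpha> :: "(real^'n) \<times> (real^'n) \<Rightarrow> nat" and z
    let ?bs = "concat (map (\<lambda>b. replicate (\<alpha> b) b) basis_list)"
    assume "\<alpha> \<in> {\<alpha>. mi_order \<alpha> \<le> k}"
    then have N: "?bs \<in> N" using mi_deriv_list(2,3)[of \<alpha>] by (auto simp: N_def)
    have "norm (mi_deriv \<alpha> (b t) z) * japanese z ^ mi_order \<alpha> \<le> \<bar>C ?bs\<bar>"
      using C[OF that, of ?bs z] by (simp add: mi_deriv_list)
    also have "\<dots> \<le> (\<Sum>bs\<in>N. \<bar>C bs\<bar>)"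
      by (rule member_le_sum[OF N]) (use fin in auto)
    finally show "ennreal (norm (mi_deriv \<alpha> (b t) z) * japanese z ^ mi_order \<alpha>) \<le> ennreal (\<Sum>bs\<in>N. \<bar>C bs\<bar>)"
      by (rule ennreal_leI)
  qed
  then have "(SUP t\<in>S. shubin_seminorm k (b t)) \<le> ennreal (\<Sum>bs\<in>N. \<bar>C bs\<bar>)"
    by (rule SUP_least)
  then show "(SUP t\<in>S. shubin_seminorm k (b t)) < \<infinity>"
    by (rule le_less_trans) simp
qed

section \<open>The Wigner transform of Schwartz functions\<close>

text \<open>An integrable majorant whose integral factorizes over the coordinates, unlike that of a
  power of \<open>japanese\<close>.\<close>

definition inv_square_prod :: "real^'n \<Rightarrow> real" where
  "inv_square_prod x = (\<Prod>i\<in>UNIV. inverse (1 + (x $ i)\<^sup>2))"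

lemma inv_square_prod_pos: "0 < inv_square_prod x"
  unfolding inv_square_prod_def by (intro prod_pos) (auto intro: add_pos_nonneg)

lemma continuous_inv_square_prod [continuous_intros]: "continuous_on S inv_square_prod"
proof -
  have "1 + a\<^sup>2 \<noteq> 0" for a :: real using zero_le_power2[of a] by linarith
  then show ?thesis unfolding inv_square_prod_def by (auto intro!: continuous_intros)
qed

lemma borel_measurable_inv_square_prod [measurable]: "inv_square_prod \<in> borel_measurable borel"
  by (intro borel_measurable_continuous_onI continuous_intros)

lemma integrable_inv_square_prod: "integrable lborel inv_square_prod"
  using integrable_prod_vec_inverse_square unfolding inv_square_prod_def .

lemma integrable_inv_square_prod_scaled: "c \<noteq> 0 \<Longrightarrow> integrable lborel (\<lambda>x. inv_square_prod (c *\<^sub>R x))"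
  using lborel_affine_integrable[OF _ integrable_inv_square_prod, of c 0] by simp

lemma japanese_square: "(japanese x)\<^sup>2 = 1 + (norm x)\<^sup>2"
  by (simp add: japanese_def)

text \<open>Each of the d factors 1 + x_i^2 is at most the square of \<open>japanese x\<close>,
  whence the exponent 2 d.\<close>

lemma inverse_japanese_le: "inverse (japanese x ^ (2 * CARD('n))) \<le> inv_square_prod (x :: real^'n)"
proof -
  have pos: "0 < (\<Prod>i\<in>UNIV. 1 + (x $ i)\<^sup>2)" by (intro prod_pos) (auto intro: add_pos_nonneg)
  have "(\<Prod>i\<in>UNIV. 1 + (x $ i)\<^sup>2) \<le> (\<Prod>i\<in>(UNIV :: 'n set). 1 + (norm x)\<^sup>2)"
    using component_le_norm_cart[of x] by (intro prod_mono) (auto simp: abs_le_square_iff[symmetric])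
  also have "\<dots> = japanese x ^ (2 * CARD('n))"
    by (simp add: power_mult japanese_square)
  finally have "inverse (japanese x ^ (2 * CARD('n))) \<le> inverse (\<Prod>i\<in>UNIV. 1 + (x $ i)\<^sup>2)"
    using pos by (rule le_imp_inverse_le)
  then show ?thesis
    unfolding inv_square_prod_def by (simp flip: prod_inversef add: o_def)
qed

text \<open>Integration by parts along an axis controls powers of a single coordinate only, hence
  this form of the bound. The product is at most (1 + m^2)^d with m the largest |x_i|, and m^(2 d)
  is one term of the sum of coordinate powers.\<close>

lemma inverse_inv_square_prod_le:
  "inverse (inv_square_prod (x :: real^'n)) \<le> 2 ^ CARD('n) * (1 + (\<Sum>i\<in>UNIV. \<bar>x $ i\<bar> ^ (2 * CARD('n))))"
proof -
  define m where "m = Max (range (\<lambda>i. \<bar>x $ i\<bar>))"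
  have m: "\<bar>x $ i\<bar> \<le> m" for i unfolding m_def by (rule Max_ge) auto
  have "m \<in> range (\<lambda>i. \<bar>x $ i\<bar>)" unfolding m_def by (rule Max_in) auto
  then obtain j where j: "m = \<bar>x $ j\<bar>" by auto
  have "inverse (inv_square_prod x) = (\<Prod>i\<in>UNIV. 1 + (x $ i)\<^sup>2)"
    unfolding inv_square_prod_def by (simp flip: prod_inversef)
  also have "\<dots> \<le> (\<Prod>i\<in>(UNIV :: 'n set). 1 + m\<^sup>2)"
    using m j by (intro prod_mono) (auto simp: abs_le_square_iff[symmetric])
  also have "\<dots> = (1 + m\<^sup>2) ^ CARD('n)" by simp
  also have "\<dots> \<le> (2 * max 1 (m\<^sup>2)) ^ CARD('n)"
    by (intro power_mono) auto
  also have "\<dots> = 2 ^ CARD('n) * (max 1 (m\<^sup>2)) ^ CARD('n)" by (simp add: power_mult_distrib)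
  also have "(max 1 (m\<^sup>2)) ^ CARD('n) \<le> 1 + m ^ (2 * CARD('n))"
    using j by (auto simp: max_def power_mult)
  also have "m ^ (2 * CARD('n)) \<le> (\<Sum>i\<in>UNIV. \<bar>x $ i\<bar> ^ (2 * CARD('n)))"
    unfolding j by (rule member_le_sum) auto
  finally show ?thesis by simp
qed

text \<open>By the parallelogram law J^2 \<ge> 1 + 2 |x|^2 + 2 |y/2|^2. Decay of two functions at x
  + y/2 and x - y/2 thus becomes decay in x and in y separately.\<close>

lemma japanese_product_bounds:
  fixes x y :: "'a::real_inner"
  defines "J \<equiv> japanese (x + (1/2) *\<^sub>R y) * japanese (x - (1/2) *\<^sub>R y)"
  shows "japanese x \<le> J" "japanese ((1/2) *\<^sub>R y) \<le> J"
proof -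
  let ?h = "(1/2) *\<^sub>R y"
  have par: "(norm (x + ?h))\<^sup>2 + (norm (x - ?h))\<^sup>2 = 2 * (norm x)\<^sup>2 + 2 * (norm ?h)\<^sup>2"
    unfolding power2_norm_eq_inner by (simp add: inner_add inner_diff inner_commute algebra_simps)
  have "J\<^sup>2 = (1 + (norm (x + ?h))\<^sup>2) * (1 + (norm (x - ?h))\<^sup>2)"
    by (simp add: J_def power_mult_distrib japanese_square)
  also have "\<dots> \<ge> 1 + ((norm (x + ?h))\<^sup>2 + (norm (x - ?h))\<^sup>2)"
    by (simp add: algebra_simps)
  finally have "1 + (2 * (norm x)\<^sup>2 + 2 * (norm ?h)\<^sup>2) \<le> J\<^sup>2" unfolding par .
  then have "(japanese x)\<^sup>2 \<le> J\<^sup>2" "(japanese ?h)\<^sup>2 \<le> J\<^sup>2"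
    unfolding japanese_square using zero_le_power2[of "norm x"] zero_le_power2[of "norm ?h"] by linarith+
  moreover have "0 \<le> J" unfolding J_def by (intro mult_nonneg_nonneg less_imp_le japanese_pos)
  ultimately show "japanese x \<le> J" "japanese ?h \<le> J"
    by (auto intro: power2_le_imp_le)
qed

section \<open>Derivatives of Schwartz functions along a coordinate axis\<close>

abbreviation dpow :: "'a::euclidean_space \<Rightarrow> nat \<Rightarrow> ('a \<Rightarrow> complex) \<Rightarrow> 'a \<Rightarrow> complex" where
  "dpow b m f \<equiv> iter_partial (replicate m b) f"

lemma concat_replicate_single:
  "distinct bs \<Longrightarrow> concat (map (\<lambda>c. replicate (if c = b then m else 0) c) bs) = (if b \<in> set bs then replicate m b else [])"
  by (induction bs) auto

lemma schwartz_dpow: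
  fixes f :: "'a::euclidean_space \<Rightarrow> complex"
  assumes f: "f \<in> schwartz" and b: "b \<in> Basis"
  shows "dpow b m f differentiable (at x)"
    and "continuous_on S (dpow b m f)"
    and "\<exists>C\<ge>0. \<forall>x. norm (dpow b m f x) \<le> C * inverse (japanese x ^ N)"
proof -
  have "set (replicate m b) \<subseteq> Basis" using b by auto
  with f have d: "dpow b m f differentiable_on UNIV" by (auto simp: schwartz_def smooth_fun_def)
  then show "dpow b m f differentiable (at x)" by (simp add: differentiable_on_def)
  show "continuous_on S (dpow b m f)"
    using differentiable_imp_continuous_on[OF d] continuous_on_subset by blast
  \<comment> \<open>This multi-index is concentrated on one direction, so the unspecified order of
    \<open>basis_list\<close> has no influence on the derivative.\<close>
  let ?\<alpha> = "\<lambda>c. if c = b then m else 0"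
  have "mi_deriv ?\<alpha> f = dpow b m f"
    unfolding mi_deriv_def using basis_list[where 'a = 'a] b by (simp add: concat_replicate_single)
  moreover obtain C where "\<And>x. japanese x ^ N * norm (mi_deriv ?\<alpha> f x) \<le> C"
    using f unfolding schwartz_def by blast
  ultimately have C: "japanese x ^ N * norm (dpow b m f x) \<le> C" for x by simp
  have "norm (dpow b m f x) \<le> \<bar>C\<bar> * inverse (japanese x ^ N)" for x
  proof -
    have "norm (dpow b m f x) * japanese x ^ N \<le> \<bar>C\<bar>"
      using C[of x] abs_ge_self[of C] by (simp add: mult.commute)
    then show ?thesis
      using japanese_pos[of x] by (simp add: pos_le_divide_eq flip: divide_inverse)
  qed
  then show "\<exists>C\<ge>0. \<forall>x. norm (dpow b m f x) \<le> C * inverse (japanese x ^ N)"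
    by (intro exI[of _ "\<bar>C\<bar>"]) auto
qed

lemma schwartz_dpow_derivative:
  assumes f: "f \<in> schwartz" and b: "b \<in> Basis"
  shows "((\<lambda>s. dpow b m f (x + (c * s) *\<^sub>R b)) has_vector_derivative c *\<^sub>R dpow b (Suc m) f x) (at 0)"
proof -
  have "(dpow b m f has_derivative frechet_derivative (dpow b m f) (at x)) (at (x + (c * 0) *\<^sub>R b))"
    using schwartz_dpow(1)[OF f b, of m x] by (simp add: frechet_derivative_works)
  moreover have "((\<lambda>s. x + (c * s) *\<^sub>R b) has_derivative (\<lambda>h. (c * h) *\<^sub>R b)) (at 0)"
    by (auto intro!: derivative_eq_intros)
  ultimately have "((\<lambda>s. dpow b m f (x + (c * s) *\<^sub>R b)) has_derivative
     (\<lambda>h. frechet_derivative (dpow b m f) (at x) ((c * h) *\<^sub>R b))) (at 0)"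
    using diff_chain_at[of "\<lambda>s. x + (c * s) *\<^sub>R b" _ 0 "dpow b m f"] by (simp add: o_def)
  moreover have "frechet_derivative (dpow b m f) (at x) ((c * h) *\<^sub>R b) = h *\<^sub>R c *\<^sub>R dpow b (Suc m) f x" for h
  proof -
    have "linear (frechet_derivative (dpow b m f) (at x))"
      by (rule linear_frechet_derivative[OF schwartz_dpow(1)[OF f b]])
    then show ?thesis by (simp add: linear_cmul iter_partial_def partial_deriv_def)
  qed
  ultimately show ?thesis by (simp add: has_vector_derivative_def)
qed

section \<open>Decay of Wigner integrals in position and frequency\<close>

definition wig_integrand :: "(real^'n \<Rightarrow> complex) \<Rightarrow> (real^'n \<Rightarrow> complex) \<Rightarrow> real^'n \<Rightarrow> real^'n \<Rightarrow> real^'n \<Rightarrow> complex" where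
  "wig_integrand f g x \<omega> y = exp (- 2 * complex_of_real pi * \<i> * complex_of_real (y \<bullet> \<omega>))
     * f (x + (1/2) *\<^sub>R y) * cnj (g (x - (1/2) *\<^sub>R y))"

lemma wigner_eq: "wigner f g (x, \<omega>) = (LINT y|lborel. wig_integrand f g x \<omega> y)"
  by (simp add: wigner_def wig_integrand_def)

lemma norm_wig_integrand:
  "norm (wig_integrand f g x \<omega> y) = norm (f (x + (1/2) *\<^sub>R y)) * norm (g (x - (1/2) *\<^sub>R y))"
proof -
  have "norm (exp (- 2 * complex_of_real pi * \<i> * complex_of_real (y \<bullet> \<omega>))) = 1"
    by (simp add: norm_exp_eq_Re)
  then show ?thesis by (simp add: wig_integrand_def norm_mult)
qed

text \<open>Decay of order 4 d in both factors leaves J^(-4 d), split into J^(-2 d) for x and J^(-2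
  d) for y; 2 d is the exponent in \<open>inverse_japanese_le\<close>.\<close>

lemma wig_integrand_bound:
  fixes f g :: "real^'n \<Rightarrow> complex"
  assumes f: "\<And>u. norm (f u) \<le> C * inverse (japanese u ^ (4 * CARD('n)))"
    and g: "\<And>u. norm (g u) \<le> D * inverse (japanese u ^ (4 * CARD('n)))"
    and C: "0 \<le> C" and D: "0 \<le> D"
  shows "norm (wig_integrand f g x \<omega> y) \<le> C * D * inv_square_prod x * inv_square_prod ((1/2) *\<^sub>R y)"
proof -
  let ?u = "x + (1/2) *\<^sub>R y" and ?v = "x - (1/2) *\<^sub>R y" and ?d = "2 * CARD('n)"
  define J where "J = japanese ?u * japanese ?v"
  have J: "japanese x \<le> J" "japanese ((1/2) *\<^sub>R y) \<le> J"
    unfolding J_def by (rule japanese_product_bounds)+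
  have "norm (wig_integrand f g x \<omega> y) \<le> (C * inverse (japanese ?u ^ (4 * CARD('n)))) * (D * inverse (japanese ?v ^ (4 * CARD('n))))"
    unfolding norm_wig_integrand using C japanese_pos[of ?u] by (intro mult_mono f g) auto
  also have "\<dots> = C * D * (inverse (J ^ ?d) * inverse (J ^ ?d))"
  proof -
    have e: "4 * CARD('n) = ?d + ?d" by simp
    show ?thesis unfolding e power_add J_def power_mult_distrib by (simp add: mult_ac)
  qed
  also have "\<dots> \<le> C * D * (inverse (japanese x ^ ?d) * inverse (japanese ((1/2) *\<^sub>R y) ^ ?d))"
    using C D J japanese_pos[of x] japanese_pos[of "(1/2) *\<^sub>R y"]
    by (intro mult_left_mono mult_mono le_imp_inverse_le power_mono) auto
  also have "\<dots> \<le> C * D * (inv_square_prod x * inv_square_prod ((1/2) *\<^sub>R y))"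
    using C D japanese_pos[of x] japanese_pos[of "(1/2) *\<^sub>R y"] inv_square_prod_pos[of x]
    by (intro mult_left_mono mult_mono inverse_japanese_le) auto
  finally show ?thesis by (simp add: mult.assoc)
qed

lemma wig_integrand_measurable:
  assumes [measurable]: "f \<in> borel_measurable borel" "g \<in> borel_measurable borel"
  shows "wig_integrand f g x \<omega> \<in> borel_measurable borel"
  unfolding wig_integrand_def[abs_def] by measurable

lemma continuous_wig_integrand:
  assumes "continuous_on UNIV f" "continuous_on UNIV g"
  shows "continuous_on UNIV (wig_integrand f g x \<omega>)"
  unfolding wig_integrand_def[abs_def]
  by (intro continuous_intros continuous_on_compose2[OF assms(1)] continuous_on_compose2[OF assms(2)]) auto

lemma schwartz_dpow_decay:
  fixes f :: "real^'n \<Rightarrow> complex"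
  assumes "f \<in> schwartz" "b \<in> Basis"
  obtains C where "0 \<le> C" "\<And>u. norm (dpow b m f u) \<le> C * inverse (japanese u ^ (4 * CARD('n)))"
  using schwartz_dpow(3)[OF assms, of m "4 * CARD('n)"] by blast

lemma wig_integrable:
  fixes f g :: "real^'n \<Rightarrow> complex"
  assumes f: "f \<in> schwartz" and g: "g \<in> schwartz" and b: "b \<in> Basis"
  shows "integrable lborel (wig_integrand (dpow b i f) (dpow b k g) x \<omega>)"
    and "\<exists>C\<ge>0. \<forall>x \<omega>. (LINT y|lborel. norm (wig_integrand (dpow b i f) (dpow b k g) x \<omega> y)) \<le> C * inv_square_prod x"
proof -
  obtain C where C: "0 \<le> C" "\<And>u. norm (dpow b i f u) \<le> C * inverse (japanese u ^ (4 * CARD('n)))"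
    using schwartz_dpow_decay[OF f b, of i] by blast
  obtain D where D: "0 \<le> D" "\<And>u. norm (dpow b k g u) \<le> D * inverse (japanese u ^ (4 * CARD('n)))"
    using schwartz_dpow_decay[OF g b, of k] by blast
  let ?E = "wig_integrand (dpow b i f) (dpow b k g)"
  let ?B = "\<lambda>x y :: real^'n. C * D * inv_square_prod x * inv_square_prod ((1/2) *\<^sub>R y)"
  have bound: "norm (?E x \<omega> y) \<le> ?B x y" for x \<omega> y
    by (rule wig_integrand_bound[OF C(2) D(2) C(1) D(1)])
  have Bi: "integrable lborel (?B x)" for x
    by (intro integrable_mult_right integrable_inv_square_prod_scaled) simp
  have meas: "?E x \<omega> \<in> borel_measurable lborel" for x \<omega>
    using schwartz_dpow(2)[OF f b] schwartz_dpow(2)[OF g b]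
    by (simp add: wig_integrand_measurable borel_measurable_continuous_onI)
  show int: "integrable lborel (?E x \<omega>)" for x \<omega>
    by (rule Bochner_Integration.integrable_bound[OF Bi[of x] meas])
       (use bound order_trans[OF bound abs_ge_self] in auto)
  define K where "K = (LINT y|lborel. inv_square_prod ((1/2) *\<^sub>R (y :: real^'n)))"
  have K: "0 \<le> K" unfolding K_def by (intro Bochner_Integration.integral_nonneg less_imp_le inv_square_prod_pos)
  have "(LINT y|lborel. norm (?E x \<omega> y)) \<le> C * D * K * inv_square_prod x" for x \<omega>
  proof -
    have "(LINT y|lborel. norm (?E x \<omega> y)) \<le> (LINT y|lborel. ?B x y)"
      by (intro integral_mono integrable_norm int Bi bound)
    also have "\<dots> = C * D * K * inv_square_prod x" by (simp add: K_def mult_ac)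
    finally show ?thesis .
  qed
  then show "\<exists>C\<ge>0. \<forall>x \<omega>. (LINT y|lborel. norm (?E x \<omega> y)) \<le> C * inv_square_prod x"
    using C(1) D(1) K by (intro exI[of _ "C * D * K"]) auto
qed

text \<open>The y-derivative of the integrand along b integrates to zero. The phase contributes - 2
  pi i (\<omega> \<bullet> b), the arguments x + y/2 and x - y/2 the factors 1/2 and - 1/2; so a
  power of \<omega> is traded for a derivative of f or g.\<close>

lemma wig_integration_by_parts:
  fixes f g :: "real^'n \<Rightarrow> complex"
  assumes f: "f \<in> schwartz" and g: "g \<in> schwartz" and b: "b \<in> Basis"
  shows "2 * of_real pi * \<i> * of_real (\<omega> \<bullet> b) * (LINT y|lborel. wig_integrand (dpow b i f) (dpow b k g) x \<omega> y)
     = (1/2) * (LINT y|lborel. wig_integrand (dpow b (Suc i) f) (dpow b k g) x \<omega> y)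
     - (1/2) * (LINT y|lborel. wig_integrand (dpow b i f) (dpow b (Suc k) g) x \<omega> y)"
proof -
  let ?E = "\<lambda>i k. wig_integrand (dpow b i f) (dpow b k g) x \<omega>"
  let ?c = "2 * of_real pi * \<i> * of_real (\<omega> \<bullet> b) :: complex"
  have int: "integrable lborel (?E i k)" for i k by (rule wig_integrable[OF f g b])
  have "(LINT y|lborel. (1/2) * ?E (Suc i) k y - (1/2) * ?E i (Suc k) y - ?c * ?E i k y) = 0"
  proof (rule integral_directional_derivative_zero[where b = b and G = "?E i k"])
    fix y
    let ?e = "\<lambda>s. exp (- 2 * complex_of_real pi * \<i> * complex_of_real ((y + s *\<^sub>R b) \<bullet> \<omega>))"
    have e: "(?e has_vector_derivative - ?c * ?e 0) (at 0)"
    proof -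
      have "((\<lambda>z. exp (- 2 * complex_of_real pi * \<i> * (of_real (y \<bullet> \<omega>) + z * of_real (\<omega> \<bullet> b)))) has_field_derivative
          - ?c * ?e 0) (at (complex_of_real 0))"
        by (auto intro!: derivative_eq_intros simp: algebra_simps)
      from has_vector_derivative_real_field[OF this]
      show ?thesis by (simp add: inner_add_left inner_commute[of b])
    qed
    have F: "((\<lambda>s. dpow b i f (x + (1/2) *\<^sub>R (y + s *\<^sub>R b))) has_vector_derivative
        (1/2) *\<^sub>R dpow b (Suc i) f (x + (1/2) *\<^sub>R y)) (at 0)"
      using schwartz_dpow_derivative[OF f b, of i "x + (1/2) *\<^sub>R y" "1/2"] by (simp add: algebra_simps)
    have G: "((\<lambda>s. cnj (dpow b k g (x - (1/2) *\<^sub>R (y + s *\<^sub>R b)))) has_vector_derivative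
        cnj ((-1/2) *\<^sub>R dpow b (Suc k) g (x - (1/2) *\<^sub>R y))) (at 0)"
      using has_vector_derivative_cnj[OF schwartz_dpow_derivative[OF g b, of k "x - (1/2) *\<^sub>R y" "-1/2"]]
      by (simp add: algebra_simps)
    show "((\<lambda>s. ?E i k (y + s *\<^sub>R b)) has_vector_derivative
        (1/2) * ?E (Suc i) k y - (1/2) * ?E i (Suc k) y - ?c * ?E i k y) (at 0)"
      unfolding wig_integrand_def
      by (rule has_vector_derivative_eq_rhs[OF has_vector_derivative_mult[OF has_vector_derivative_mult[OF e F] G]])
         (simp add: scaleR_conv_of_real algebra_simps)
  next
    show "continuous_on UNIV (\<lambda>y. (1/2) * ?E (Suc i) k y - (1/2) * ?E i (Suc k) y - ?c * ?E i k y)"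
      by (intro continuous_intros continuous_wig_integrand schwartz_dpow(2)[OF f b] schwartz_dpow(2)[OF g b])
  next
    show "integrable lborel (\<lambda>y. (1/2) * ?E (Suc i) k y - (1/2) * ?E i (Suc k) y - ?c * ?E i k y)"
      by (intro Bochner_Integration.integrable_diff integrable_mult_right int)
  qed (rule int)
  moreover have "(LINT y|lborel. (1/2) * ?E (Suc i) k y - (1/2) * ?E i (Suc k) y - ?c * ?E i k y)
     = (LINT y|lborel. (1/2) * ?E (Suc i) k y - (1/2) * ?E i (Suc k) y) - (LINT y|lborel. ?c * ?E i k y)"
    by (intro Bochner_Integration.integral_diff Bochner_Integration.integrable_diff integrable_mult_right int)
  moreover have "(LINT y|lborel. (1/2) * ?E (Suc i) k y - (1/2) * ?E i (Suc k) y)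
     = (LINT y|lborel. (1/2) * ?E (Suc i) k y) - (LINT y|lborel. (1/2) * ?E i (Suc k) y)"
    by (intro Bochner_Integration.integral_diff integrable_mult_right int)
  ultimately show ?thesis by (simp only: integral_mult_right_zero) simp
qed

text \<open>Each power of \<omega> \<bullet> b is paid for by one more derivative of f or of g, so
  the induction has to cover all orders i and k.\<close>

lemma wig_decay:
  fixes f g :: "real^'n \<Rightarrow> complex"
  assumes f: "f \<in> schwartz" and g: "g \<in> schwartz" and b: "b \<in> Basis"
  shows "\<exists>C\<ge>0. \<forall>x \<omega>. \<bar>\<omega> \<bullet> b\<bar> ^ m * norm (LINT y|lborel. wig_integrand (dpow b i f) (dpow b k g) x \<omega> y) \<le> C * inv_square_prod x"
proof (induction m arbitrary: i k)
  case 0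
  obtain C where "0 \<le> C" "\<And>x \<omega>. (LINT y|lborel. norm (wig_integrand (dpow b i f) (dpow b k g) x \<omega> y)) \<le> C * inv_square_prod x"
    using wig_integrable(2)[OF f g b, of i k] by blast
  then show ?case by (intro exI[of _ C]) (auto intro: order_trans[OF integral_norm_bound])
next
  case (Suc m)
  let ?I = "\<lambda>i k x \<omega>. LINT y|lborel. wig_integrand (dpow b i f) (dpow b k g) x \<omega> y"
  obtain C where C: "0 \<le> C" "\<And>x \<omega>. \<bar>\<omega> \<bullet> b\<bar> ^ m * norm (?I (Suc i) k x \<omega>) \<le> C * inv_square_prod x"
    using Suc.IH[of "Suc i" k] by blast
  obtain D where D: "0 \<le> D" "\<And>x \<omega>. \<bar>\<omega> \<bullet> b\<bar> ^ m * norm (?I i (Suc k) x \<omega>) \<le> D * inv_square_prod x"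
    using Suc.IH[of i "Suc k"] by blast
  have "\<bar>\<omega> \<bullet> b\<bar> ^ Suc m * norm (?I i k x \<omega>) \<le> (C + D) * inv_square_prod x" for x \<omega>
  proof -
    have "\<bar>\<omega> \<bullet> b\<bar> * norm (?I i k x \<omega>) \<le> 2 * pi * \<bar>\<omega> \<bullet> b\<bar> * norm (?I i k x \<omega>)"
      using pi_ge_two by (intro mult_right_mono) (auto intro!: mult_right_mono simp: mult_le_cancel_right1)
    also have "\<dots> = norm ((1/2) * ?I (Suc i) k x \<omega> - (1/2) * ?I i (Suc k) x \<omega>)"
      unfolding wig_integration_by_parts[OF f g b, symmetric] by (simp add: norm_mult)
    also have "\<dots> \<le> norm (?I (Suc i) k x \<omega>) + norm (?I i (Suc k) x \<omega>)"
      by (rule order_trans[OF norm_triangle_ineq4]) (auto simp: norm_mult intro!: add_mono)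
    finally have "\<bar>\<omega> \<bullet> b\<bar> ^ m * (\<bar>\<omega> \<bullet> b\<bar> * norm (?I i k x \<omega>)) \<le>
        \<bar>\<omega> \<bullet> b\<bar> ^ m * (norm (?I (Suc i) k x \<omega>) + norm (?I i (Suc k) x \<omega>))"
      by (intro mult_left_mono) auto
    then show ?thesis using C(2)[of \<omega> x] D(2)[of \<omega> x] by (simp add: algebra_simps)
  qed
  then show ?case using C(1) D(1) by (intro exI[of _ "C + D"]) auto
qed

section \<open>Integrability of Schwartz functions and of their Wigner transforms\<close>

lemma iter_partial_Nil [simp]: "iter_partial [] f = f"
  by (simp add: iter_partial_def)

lemma continuous_schwartz: "f \<in> schwartz \<Longrightarrow> continuous_on S f"
proof -
  assume f: "f \<in> schwartz"
  obtain b :: 'a where "b \<in> Basis" using nonempty_Basis by blast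
  from schwartz_dpow(2)[OF f this, of S 0] show ?thesis by simp
qed

lemma borel_measurable_schwartz: "f \<in> schwartz \<Longrightarrow> f \<in> borel_measurable borel"
  by (intro borel_measurable_continuous_onI continuous_schwartz)

lemma schwartz_decay:
  fixes f :: "real^'n \<Rightarrow> complex"
  assumes f: "f \<in> schwartz"
  obtains C where "0 \<le> C" "\<And>u. norm (f u) \<le> C * inverse (japanese u ^ (4 * CARD('n)))"
proof -
  obtain b :: "real^'n" where "b \<in> Basis" using nonempty_Basis by blast
  from schwartz_dpow(3)[OF f this, of 0 "4 * CARD('n)"] that show thesis by auto
qed

lemma schwartz_bound:
  fixes f :: "real^'n \<Rightarrow> complex"
  assumes f: "f \<in> schwartz"
  obtains C where "0 \<le> C" "\<And>u. norm (f u) \<le> C * inv_square_prod u" "\<And>u. norm (f u) \<le> C"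
proof -
  obtain C where C: "0 \<le> C" "\<And>u. norm (f u) \<le> C * inverse (japanese u ^ (4 * CARD('n)))"
    using schwartz_decay[OF f] by blast
  have le: "inverse (japanese u ^ (4 * CARD('n))) \<le> inverse (japanese u ^ (2 * CARD('n)))" for u :: "real^'n"
    using japanese_ge_1[of u] by (intro le_imp_inverse_le power_increasing zero_less_power) auto
  have le1: "inverse (japanese u ^ (4 * CARD('n))) \<le> 1" for u :: "real^'n"
    using japanese_ge_1[of u] by (intro inverse_le_1_iff[THEN iffD2] disjI2 one_le_power)
  show thesis
  proof
    fix u
    show "norm (f u) \<le> C * inv_square_prod u"
      using C(2)[of u] mult_left_mono[OF order_trans[OF le inverse_japanese_le[of u]] C(1)] by linarith
    show "norm (f u) \<le> C" using C(2)[of u] mult_left_mono[OF le1 C(1), of u] by linarith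
  qed (rule C)
qed

lemma schwartz_integrable:
  fixes f :: "real^'n \<Rightarrow> complex"
  assumes f: "f \<in> schwartz"
  shows "integrable lborel f" and "f \<in> L2"
proof -
  obtain C where C: "0 \<le> C" "\<And>u. norm (f u) \<le> C * inv_square_prod u" "\<And>u. norm (f u) \<le> C"
    using schwartz_bound[OF f] by blast
  have m[measurable]: "f \<in> borel_measurable borel" by (rule borel_measurable_schwartz[OF f])
  have i: "integrable lborel (\<lambda>u::real^'n. C * inv_square_prod u)"
    by (intro integrable_mult_right integrable_inv_square_prod)
  show fi: "integrable lborel f"
    by (rule Bochner_Integration.integrable_bound[OF i])
       (use C order_trans[OF C(2) abs_ge_self] in auto)
  have "integrable lborel (\<lambda>u. (norm (f u))\<^sup>2)"
  proof (rule Bochner_Integration.integrable_bound)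
    show "integrable lborel (\<lambda>u. C * norm (f u))" by (intro integrable_mult_right integrable_norm fi)
    show "AE u in lborel. norm ((norm (f u))\<^sup>2) \<le> norm (C * norm (f u))"
      using C(1,3) by (auto simp: power2_eq_square abs_mult intro!: mult_right_mono)
  qed measurable
  then show "f \<in> L2" by (simp add: L2_def)
qed

lemma wigner_measurable:
  assumes [measurable]: "f \<in> borel_measurable borel" "g \<in> borel_measurable borel"
  shows "wigner f g \<in> borel_measurable (borel :: ((real^'n) \<times> (real^'n)) measure)"
proof -
  have "(\<lambda>p. LINT y|lborel. wig_integrand f g (fst p) (snd p) y) \<in> borel_measurable (borel \<Otimes>\<^sub>M borel)"
    unfolding wig_integrand_def by measurable
  then show ?thesis by (simp add: borel_prod wigner_def wig_integrand_def case_prod_unfold)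
qed

text \<open>The plain bound and the bounds with the 2 d-th power of each \<omega>_j together control
  the product of all 1 + \<omega>_j^2 by \<open>inverse_inv_square_prod_le\<close>; this gives a
  majorant that is a product in x and \<omega>.\<close>

lemma wigner_integrable:
  fixes f g :: "real^'n \<Rightarrow> complex"
  assumes f: "f \<in> schwartz" and g: "g \<in> schwartz"
  shows "integrable lborel (wigner f g)"
proof -
  have "\<exists>C\<ge>0. \<forall>x \<omega>. \<bar>\<omega> $ j\<bar> ^ (2 * CARD('n)) * norm (wigner f g (x, \<omega>)) \<le> C * inv_square_prod x" for j
    using wig_decay[OF f g axis_in_Basis_iff[of j 1, THEN iffD2], of "2 * CARD('n)" 0 0]
    by (simp add: wigner_eq cart_eq_inner_axis)
  then obtain C where C: "\<And>j. 0 \<le> C j" "\<And>j x \<omega>. \<bar>\<omega> $ j\<bar> ^ (2 * CARD('n)) * norm (wigner f g (x, \<omega>)) \<le> C j * inv_square_prod x"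
    by metis
  obtain b :: "real^'n" where b: "b \<in> Basis" using nonempty_Basis by blast
  obtain D where D: "0 \<le> D" "\<And>x \<omega>. norm (wigner f g (x, \<omega>)) \<le> D * inv_square_prod x"
    using wig_decay[OF f g b, of 0 0 0] by (auto simp: wigner_eq)
  define K where "K = 2 ^ CARD('n) * (D + (\<Sum>j\<in>UNIV. C j))"
  have bound: "norm (wigner f g (x, \<omega>)) \<le> K * (inv_square_prod x * inv_square_prod \<omega>)" for x \<omega>
  proof -
    let ?W = "norm (wigner f g (x, \<omega>))"
    have "inverse (inv_square_prod \<omega>) * ?W \<le> 2 ^ CARD('n) * (1 + (\<Sum>j\<in>UNIV. \<bar>\<omega> $ j\<bar> ^ (2 * CARD('n)))) * ?W"
      by (intro mult_right_mono inverse_inv_square_prod_le) auto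
    also have "\<dots> = 2 ^ CARD('n) * (?W + (\<Sum>j\<in>UNIV. \<bar>\<omega> $ j\<bar> ^ (2 * CARD('n)) * ?W))"
      by (simp add: algebra_simps sum_distrib_left)
    also have "\<dots> \<le> 2 ^ CARD('n) * (D * inv_square_prod x + (\<Sum>j\<in>UNIV. C j * inv_square_prod x))"
      by (intro mult_left_mono add_mono sum_mono C D) auto
    also have "\<dots> = K * inv_square_prod x"
      unfolding K_def sum_distrib_right[symmetric] by (simp add: algebra_simps)
    finally show ?thesis using inv_square_prod_pos[of \<omega>] by (simp add: field_simps)
  qed
  have "integrable (lborel \<Otimes>\<^sub>M lborel) (\<lambda>(x::real^'n, \<omega>::real^'n). inv_square_prod x * inv_square_prod \<omega>)"
    by (intro lborel_pair_mult integrable_inv_square_prod)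
  then have i: "integrable lborel (\<lambda>p::(real^'n) \<times> (real^'n). K * (inv_square_prod (fst p) * inv_square_prod (snd p)))"
    by (simp add: lborel_prod case_prod_unfold)
  show ?thesis
  proof (rule Bochner_Integration.integrable_bound[OF i])
    show "wigner f g \<in> borel_measurable lborel"
      using wigner_measurable[OF borel_measurable_schwartz[OF f] borel_measurable_schwartz[OF g]] by simp
    show "AE p in lborel. norm (wigner f g p) \<le> norm (K * (inv_square_prod (fst p) * inv_square_prod (snd p)))"
      using bound order_trans[OF bound abs_ge_self] by (intro AE_I2) (auto simp: split_paired_all)
  qed
qed

section \<open>Averages of Mehler symbols\<close>

text \<open>A mean value estimate from 1 + u \<le> exp u; it dominates difference quotients
  uniformly in the increment.\<close>

lemma exp_diff_bound:
  fixes a b B :: real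
  assumes "a \<le> B" "b \<le> B"
  shows "\<bar>exp a - exp b\<bar> \<le> \<bar>a - b\<bar> * exp B"
proof -
  have main: "exp y - exp x \<le> (y - x) * exp B" if "x \<le> y" "y \<le> B" for x y :: real
  proof -
    have "1 - (y - x) \<le> exp (x - y)" using exp_ge_add_one_self[of "x - y"] by linarith
    then have "exp y * (1 - exp (x - y)) \<le> exp y * (y - x)" by (intro mult_left_mono) auto
    also have "\<dots> \<le> exp B * (y - x)" using that by (intro mult_right_mono) auto
    finally show ?thesis by (simp add: algebra_simps flip: exp_add)
  qed
  show ?thesis using main[of a b] main[of b a] assms by (cases "a \<le> b") (auto simp: abs_if algebra_simps)
qed

locale unit_distribution = real_distribution M for M :: "real measure" +
  assumes unit: "AE r in M. 0 \<le> r \<and> r \<le> 1"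
begin

lemma integrable_bounded_unit:
  fixes f :: "real \<Rightarrow> 'b::{banach,second_countable_topology}"
  assumes "f \<in> borel_measurable borel" "\<And>r. 0 \<le> r \<Longrightarrow> r \<le> 1 \<Longrightarrow> norm (f r) \<le> C"
  shows "integrable M f"
  by (rule integrable_const_bound[of _ C]) (use assms unit in \<open>auto elim!: AE_mp\<close>)

lemma integral_bounded_unit:
  fixes f :: "real \<Rightarrow> 'b::{banach,second_countable_topology}"
  assumes "f \<in> borel_measurable borel" "\<And>r. 0 \<le> r \<Longrightarrow> r \<le> 1 \<Longrightarrow> norm (f r) \<le> C"
  shows "norm (LINT r|M. f r) \<le> C"
proof -
  have "norm (LINT r|M. f r) \<le> (LINT r|M. norm (f r))" by (rule integral_norm_bound)
  also have "\<dots> \<le> (LINT r|M. C)"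
    by (rule integral_mono_AE) (use unit integrable_bounded_unit[OF assms] assms in \<open>auto elim!: AE_mp\<close>)
  finally show ?thesis using prob_space by simp
qed

end

text \<open>With r = exp (- 2 s) this is tanh s.\<close>

definition cayley :: "real \<Rightarrow> real" where
  "cayley r = (1 - r) / (1 + r)"

lemma cayley_unit: "0 \<le> r \<Longrightarrow> r \<le> 1 \<Longrightarrow> 0 \<le> cayley r \<and> cayley r \<le> 1"
  by (auto simp: cayley_def)

lemma cayley_measurable [measurable]: "cayley \<in> borel_measurable borel"
  unfolding cayley_def by measurable

text \<open>The case m = 0 is the averaged profile as a function of q. The index m counts
  derivatives in q, each of which brings down a factor - \<open>cayley r\<close>; the sign is left
  to \<open>radial_symbol_derivative\<close>.\<close>

definition radial_symbol :: "nat \<Rightarrow> real measure \<Rightarrow> nat \<Rightarrow> real \<Rightarrow> real" where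
  "radial_symbol d M m q = (LINT r|M. (2 / (1 + r)) ^ d * cayley r ^ m * exp (- cayley r * q))"

context unit_distribution
begin

lemma weight_bound:
  assumes "0 \<le> r" "r \<le> 1"
  shows "0 \<le> (2 / (1 + r)) ^ d * cayley r ^ m" "(2 / (1 + r)) ^ d * cayley r ^ m \<le> 2 ^ d"
proof -
  have "(2 / (1 + r)) ^ d \<le> 2 ^ d" using assms by (intro power_mono) (auto simp: field_simps)
  moreover have "cayley r ^ m \<le> 1" "0 \<le> cayley r ^ m" using cayley_unit[OF assms] by (auto simp: power_le_one)
  ultimately have "(2 / (1 + r)) ^ d * cayley r ^ m \<le> 2 ^ d * 1"
    using assms by (intro mult_mono) auto
  then show "(2 / (1 + r)) ^ d * cayley r ^ m \<le> 2 ^ d" by simp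
  show "0 \<le> (2 / (1 + r)) ^ d * cayley r ^ m" using assms cayley_unit[OF assms] by simp
qed

text \<open>Differentiation under the integral, by dominated convergence along sequences. It covers
  all real q, as \<open>weighted_derivative\<close> asks, so the exponential is bounded by exp (|q|
  + B) rather than by 1; B bounds the increments.\<close>

lemma radial_symbol_derivative:
  "(radial_symbol d M m has_real_derivative - radial_symbol d M (Suc m) q) (at q)"
  unfolding DERIV_def tendsto_at_iff_sequentially
proof (intro allI impI)
  fix X :: "nat \<Rightarrow> real"
  assume X: "\<forall>i. X i \<in> UNIV - {0}" "X \<longlonglongrightarrow> 0"
  let ?w = "\<lambda>r. (2 / (1 + r)) ^ d * cayley r ^ m"
  obtain B where B: "\<And>n. \<bar>X n\<bar> \<le> B"
    using X(2) by (metis convergentI convergent_imp_Bseq BseqE real_norm_def)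
  have int: "integrable M (\<lambda>r. ?w r * exp (- cayley r * q))" for q
  proof (rule integrable_bounded_unit)
    fix r :: real assume r: "0 \<le> r" "r \<le> 1"
    have "- cayley r * q \<le> cayley r * \<bar>q\<bar>" using cayley_unit[OF r]
      by (metis abs_ge_minus_self minus_mult_commute mult_left_mono)
    also have "\<dots> \<le> 1 * \<bar>q\<bar>" using cayley_unit[OF r] by (intro mult_right_mono) auto
    finally show "norm (?w r * exp (- cayley r * q)) \<le> 2 ^ d * exp \<bar>q\<bar>"
      using weight_bound[OF r, of d m] by (auto simp: abs_mult intro!: mult_mono)
  qed measurable
  have "(\<lambda>n. LINT r|M. ?w r * ((exp (- cayley r * (q + X n)) - exp (- cayley r * q)) / X n))
     \<longlonglongrightarrow> (LINT r|M. ?w r * (- cayley r * exp (- cayley r * q)))"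
  proof (rule integral_dominated_convergence[where w = "\<lambda>_. 2 ^ d * exp (\<bar>q\<bar> + B)"])
    show "AE r in M. (\<lambda>n. ?w r * ((exp (- cayley r * (q + X n)) - exp (- cayley r * q)) / X n))
          \<longlonglongrightarrow> ?w r * (- cayley r * exp (- cayley r * q))"
    proof (intro AE_I2 tendsto_mult tendsto_const)
      fix r
      have "((\<lambda>q. exp (- cayley r * q)) has_real_derivative (- cayley r * exp (- cayley r * q))) (at q)"
        by (auto intro!: derivative_eq_intros)
      then show "(\<lambda>n. (exp (- cayley r * (q + X n)) - exp (- cayley r * q)) / X n)
          \<longlonglongrightarrow> - cayley r * exp (- cayley r * q)"
        unfolding DERIV_def tendsto_at_iff_sequentially using X by (auto simp: o_def)
    qed
    show "AE r in M. norm (?w r * ((exp (- cayley r * (q + X n)) - exp (- cayley r * q)) / X n)) \<le> 2 ^ d * exp (\<bar>q\<bar> + B)" for n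
      using unit
    proof eventually_elim
      case (elim r)
      then have r: "0 \<le> r" "r \<le> 1" by auto
      have c: "0 \<le> cayley r" "cayley r \<le> 1" using cayley_unit[OF r] by auto
      have le: "- cayley r * y \<le> \<bar>y\<bar>" for y
      proof -
        have "- cayley r * y \<le> cayley r * \<bar>y\<bar>" using c
          by (metis abs_ge_minus_self minus_mult_commute mult_left_mono)
        also have "\<dots> \<le> 1 * \<bar>y\<bar>" using c by (intro mult_right_mono) auto
        finally show ?thesis by simp
      qed
      have "\<bar>exp (- cayley r * (q + X n)) - exp (- cayley r * q)\<bar> \<le>
          \<bar>- cayley r * (q + X n) - (- cayley r * q)\<bar> * exp (\<bar>q\<bar> + B)"
        using le[of "q + X n"] le[of q] B[of n] by (intro exp_diff_bound) linarith+
      also have "\<dots> = cayley r * \<bar>X n\<bar> * exp (\<bar>q\<bar> + B)"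
        using c by (simp add: algebra_simps abs_mult)
      also have "\<dots> \<le> 1 * \<bar>X n\<bar> * exp (\<bar>q\<bar> + B)"
        using c by (intro mult_right_mono) auto
      finally have "\<bar>(exp (- cayley r * (q + X n)) - exp (- cayley r * q)) / X n\<bar> \<le> exp (\<bar>q\<bar> + B)"
        using X(1) by (simp add: abs_divide divide_le_eq mult.commute)
      then show ?case
        unfolding real_norm_def abs_mult[of "?w r"] using weight_bound[OF r, of d m]
        by (intro mult_mono) auto
    qed
  qed auto
  moreover have "(LINT r|M. ?w r * (- cayley r * exp (- cayley r * q))) = - radial_symbol d M (Suc m) q"
    by (simp add: radial_symbol_def algebra_simps flip: integral_minus)
  moreover have "(LINT r|M. ?w r * ((exp (- cayley r * (q + X n)) - exp (- cayley r * q)) / X n))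
      = (radial_symbol d M m (q + X n) - radial_symbol d M m q) / X n" for n
  proof -
    have "(LINT r|M. ?w r * ((exp (- cayley r * (q + X n)) - exp (- cayley r * q)) / X n))
      = (LINT r|M. (?w r * exp (- cayley r * (q + X n)) - ?w r * exp (- cayley r * q)) / X n)"
      by (simp add: diff_divide_distrib right_diff_distrib)
    also have "\<dots> = (LINT r|M. ?w r * exp (- cayley r * (q + X n)) - ?w r * exp (- cayley r * q)) / X n"
      by (rule integral_divide_zero)
    also have "\<dots> = (radial_symbol d M m (q + X n) - radial_symbol d M m q) / X n"
      unfolding radial_symbol_def by (subst Bochner_Integration.integral_diff[OF int int]) simp
    finally show ?thesis .
  qed
  ultimately show "((\<lambda>h. (radial_symbol d M m (q + h) - radial_symbol d M m q) / h) \<circ> X)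
      \<longlonglongrightarrow> - radial_symbol d M (Suc m) q"
    by (simp only: o_def)
qed

text \<open>With c = \<open>cayley r\<close> and x = c (1 + q) the integrand times (1 + q)^m is x^m
  exp (- x) exp c times the weight. Here x^m exp (- x) \<le> m! since x^m / m! is one term of the
  exponential series, exp c \<le> e as c \<le> 1, and the weight is at most 2^d. The estimate is
  uniform down to c = 0, that is r = 1.\<close>

lemma radial_symbol_bound:
  assumes "0 \<le> q"
  shows "\<bar>radial_symbol d M m q\<bar> * (1 + q) ^ m \<le> 2 ^ d * (fact m * exp 1)"
proof -
  have "\<bar>radial_symbol d M m q\<bar> * (1 + q) ^ m
     = norm (LINT r|M. ((2 / (1 + r)) ^ d * cayley r ^ m * exp (- cayley r * q)) * (1 + q) ^ m)"
    using assms by (simp add: radial_symbol_def abs_mult)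
  also have "\<dots> \<le> 2 ^ d * (fact m * exp 1)"
  proof (rule integral_bounded_unit)
    fix r :: real assume r: "0 \<le> r" "r \<le> 1"
    have c: "0 \<le> cayley r" "cayley r \<le> 1" using cayley_unit[OF r] by auto
    define x where "x = cayley r * (1 + q)"
    have x: "0 \<le> x" using c assms by (simp add: x_def)
    have "x ^ m / fact m \<le> exp x"
    proof -
      have "(\<Sum>k\<in>{m}. inverse (fact k) * x ^ k) \<le> exp x"
        unfolding exp_def using sum_le_suminf[OF summable_exp[of x], of "{m}"] x by (simp add: divide_inverse mult.commute)
      then show ?thesis by (simp add: divide_inverse mult.commute)
    qed
    then have "x ^ m * exp (- x) \<le> fact m"
      by (simp add: exp_minus field_simps)
    moreover have "exp (- cayley r * q) = exp (- x) * exp (cayley r)"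
      by (simp add: x_def algebra_simps flip: exp_add)
    ultimately have *: "cayley r ^ m * exp (- cayley r * q) * (1 + q) ^ m \<le> fact m * exp 1"
      using mult_mono[of "x ^ m * exp (- x)" "fact m" "exp (cayley r)" "exp 1"] c x
      by (simp add: x_def power_mult_distrib mult_ac)
    have "(2 / (1 + r)) ^ d * (cayley r ^ m * exp (- cayley r * q) * (1 + q) ^ m) \<le> 2 ^ d * (fact m * exp 1)"
      using weight_bound[OF r, of d 0] * c assms mult_mono[OF weight_bound(2)[OF r, of d 0] *] by auto
    then show "norm ((2 / (1 + r)) ^ d * cayley r ^ m * exp (- cayley r * q) * (1 + q) ^ m) \<le> 2 ^ d * (fact m * exp 1)"
      using r c assms by (simp add: mult_ac)
  qed measurable
  finally show ?thesis .
qed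

end

section \<open>The Weyl symbol of the Mehler kernel\<close>

text \<open>The linear map has determinant of modulus 1. It is carried out as two affine
  substitutions, v = x - y/2 for fixed x and u = 2 x - v for fixed v, whose Jacobian factors 2^d and
  2^(-d) cancel.\<close>

lemma lborel_pair_change_of_variables:
  fixes H :: "('a::euclidean_space) \<times> 'a \<Rightarrow> complex"
  assumes H: "integrable (lborel \<Otimes>\<^sub>M lborel) H"
  shows "(LINT x|lborel. LINT y|lborel. H (x + (1/2) *\<^sub>R y, x - (1/2) *\<^sub>R y)) = (LINT p|(lborel \<Otimes>\<^sub>M lborel). H p)"
proof -
  let ?c = "2 ^ DIM('a) :: real"
  have Hm [measurable]: "H \<in> borel_measurable (borel \<Otimes>\<^sub>M borel)"
    using borel_measurable_integrable[OF H] by (simp add: lborel_prod borel_prod)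
  have inner: "(LINT y|lborel. H (x + (1/2) *\<^sub>R y, x - (1/2) *\<^sub>R y)) = ?c *\<^sub>R (LINT v|lborel. H (2 *\<^sub>R x - v, v))" for x
  proof -
    have "(\<lambda>y. H (x + (1/2) *\<^sub>R y, x - (1/2) *\<^sub>R y)) \<in> borel_measurable borel" by measurable
    note affine = lborel_affine_integral[OF _ this, of "-2" "2 *\<^sub>R x"]
    have "(LINT v|lborel. H (2 *\<^sub>R x - v, v)) = (LINT y|lborel. H (x + (1/2) *\<^sub>R y, x - (1/2) *\<^sub>R y)) /\<^sub>R ?c"
    proof -
      have "x + (1/2) *\<^sub>R (2 *\<^sub>R x + (- 2) *\<^sub>R v) = 2 *\<^sub>R x - v" "x - (1/2) *\<^sub>R (2 *\<^sub>R x + (- 2) *\<^sub>R v) = v" for v :: 'a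
      proof -
        have half: "(1/2) *\<^sub>R (2 *\<^sub>R x + (- 2) *\<^sub>R v) = x - v" by (simp only: scaleR_right_distrib scaleR_scaleR) simp
        show "x + (1/2) *\<^sub>R (2 *\<^sub>R x + (- 2) *\<^sub>R v) = 2 *\<^sub>R x - v" "x - (1/2) *\<^sub>R (2 *\<^sub>R x + (- 2) *\<^sub>R v) = v"
          unfolding half by (simp_all add: scaleR_2)
      qed
      with affine show ?thesis by simp
    qed
    then show ?thesis by simp
  qed
  have shear: "(LINT x|lborel. G (2 *\<^sub>R x - v)) = (LINT u|lborel. G u) /\<^sub>R ?c"
    if "G \<in> borel_measurable borel" for G :: "'a \<Rightarrow> 'b::euclidean_space" and v
    using lborel_affine_integral[OF _ that, of 2 "- v"] by (simp add: add.commute)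
  have sliceable: "AE v in lborel. integrable lborel (\<lambda>u. H (u, v))"
    using lborel_pair.AE_integrable_snd[of "\<lambda>u v. H (u, v)"] H by simp
  have int: "integrable (lborel \<Otimes>\<^sub>M lborel) (\<lambda>(v, x). H (2 *\<^sub>R x - v, v))"
  proof (rule lborel_pair.Fubini_integrable)
    show "AE v in lborel. integrable lborel (\<lambda>x. case (v, x) of (v, x) \<Rightarrow> H (2 *\<^sub>R x - v, v))"
      using sliceable
    proof eventually_elim
      case (elim v)
      from lborel_affine_integrable[OF _ elim, of 2 "- v"] show ?case by (simp add: add.commute)
    qed
    have "integrable lborel (\<lambda>v. LINT u|lborel. norm (H (u, v)))"
      using lborel_pair.integrable_snd[of "\<lambda>u v. norm (H (u, v))"] integrable_norm[OF H]
      by (simp add: case_prod_unfold)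
    then have "integrable lborel (\<lambda>v. (LINT u|lborel. norm (H (u, v))) /\<^sub>R ?c)"
      by (rule integrable_scaleR_right)
    moreover have "(LINT x|lborel. norm (H (2 *\<^sub>R x - v, v))) = (LINT u|lborel. norm (H (u, v))) /\<^sub>R ?c" for v
      by (rule shear[of "\<lambda>u. norm (H (u, v))"]) measurable
    ultimately show "integrable lborel (\<lambda>v. LINT x|lborel. norm (case (v, x) of (v, x) \<Rightarrow> H (2 *\<^sub>R x - v, v)))"
      by simp
  qed measurable
  have "(LINT x|lborel. LINT y|lborel. H (x + (1/2) *\<^sub>R y, x - (1/2) *\<^sub>R y))
      = ?c *\<^sub>R (LINT x|lborel. LINT v|lborel. H (2 *\<^sub>R x - v, v))"
    unfolding inner by simp
  also have "(LINT x|lborel. LINT v|lborel. H (2 *\<^sub>R x - v, v)) = (LINT v|lborel. LINT x|lborel. H (2 *\<^sub>R x - v, v))"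
    using lborel_pair.Fubini_integral[OF int] by simp
  also have "\<dots> = (LINT v|lborel. (LINT u|lborel. H (u, v)) /\<^sub>R ?c)"
    by (intro Bochner_Integration.integral_cong refl shear[of "\<lambda>u. H (u, _)"]) measurable
  also have "?c *\<^sub>R \<dots> = (LINT v|lborel. LINT u|lborel. H (u, v))" by simp
  also have "\<dots> = (LINT p|(lborel \<Otimes>\<^sub>M lborel). H p)"
    using lborel_pair.integral_snd[of "\<lambda>u v. H (u, v)"] H by simp
  finally show ?thesis .
qed

section \<open>Mehler symbols and their partial Fourier transform\<close>

definition phase_form :: "(real^'n) \<times> (real^'n) \<Rightarrow> real" where
  "phase_form z = (norm (fst z))\<^sup>2 + 4 * pi\<^sup>2 * (norm (snd z))\<^sup>2"

definition mehler_symbol :: "real \<Rightarrow> (real^'n) \<times> (real^'n) \<Rightarrow> real" where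
  "mehler_symbol r z = (2 / (1 + r)) ^ CARD('n) * exp (- cayley r * phase_form z)"

lemma phase_form_nonneg: "0 \<le> phase_form z"
  by (simp add: phase_form_def)

lemma mehler_symbol_bounds:
  assumes "0 \<le> r" "r \<le> 1"
  shows "0 \<le> mehler_symbol r (z :: (real^'n) \<times> (real^'n))" "mehler_symbol r z \<le> 2 ^ CARD('n)"
proof -
  show "0 \<le> mehler_symbol r z" using assms by (simp add: mehler_symbol_def)
  have "(2 / (1 + r)) ^ CARD('n) \<le> 2 ^ CARD('n)" using assms by (intro power_mono) (auto simp: field_simps)
  moreover have "exp (- cayley r * phase_form z) \<le> 1"
    using cayley_unit[OF assms] phase_form_nonneg[of z] by simp
  ultimately have "mehler_symbol r z \<le> 2 ^ CARD('n) * 1"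
    unfolding mehler_symbol_def using assms by (intro mult_mono) auto
  then show "mehler_symbol r z \<le> 2 ^ CARD('n)" by simp
qed

lemma mehler_symbol_measurable [measurable]:
  "(\<lambda>p. mehler_symbol (fst p) (snd p)) \<in> borel_measurable (borel \<Otimes>\<^sub>M borel)"
proof -
  have "phase_form \<in> borel_measurable borel"
    unfolding phase_form_def[abs_def] by (intro borel_measurable_continuous_onI continuous_intros)
  then show ?thesis unfolding mehler_symbol_def by measurable
qed

lemma mehler_symbol_measurable' [measurable]: "mehler_symbol r \<in> borel_measurable borel"
  unfolding mehler_symbol_def[abs_def] phase_form_def
  by (intro borel_measurable_continuous_onI continuous_intros)

text \<open>Weyl symbol and integral kernel are linked by a Fourier transform in the difference
  variable. It splits into one Gaussian integral per coordinate, convergent since r < 1 gives c >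
  0.\<close>

lemma mehler_symbol_fourier:
  fixes x y :: "real^'n"
  assumes r: "0 \<le> r" "r < 1"
  shows "integrable lborel (\<lambda>\<omega>. of_real (mehler_symbol r (x, \<omega>)) * exp (\<i> * of_real (2 * pi * (y \<bullet> \<omega>))))"
    and "(LINT \<omega>|lborel. of_real (mehler_symbol r (x, \<omega>)) * exp (\<i> * of_real (2 * pi * (y \<bullet> \<omega>))))
      = complex_of_real (mehler_vec r (x + (1/2) *\<^sub>R y) (x - (1/2) *\<^sub>R y))"
proof -
  define c where "c = cayley r"
  have c: "c > 0" using r by (simp add: c_def cayley_def)
  then have a: "0 < 4 * pi\<^sup>2 * c" by simp
  define A where "A = complex_of_real ((2 / (1 + r)) ^ CARD('n) * exp (- c * (norm x)\<^sup>2))"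
  let ?g = "\<lambda>i s. exp (complex_of_real (- (4 * pi\<^sup>2 * c) * s\<^sup>2) + \<i> * complex_of_real (2 * pi * y $ i * s))"
  have norm2: "(norm z)\<^sup>2 = (\<Sum>i\<in>UNIV. (z $ i)\<^sup>2)" for z :: "real^'n"
    unfolding power2_norm_eq_inner inner_vec_def by (simp add: power2_eq_square)
  have eq: "of_real (mehler_symbol r (x, \<omega>)) * exp (\<i> * of_real (2 * pi * (y \<bullet> \<omega>))) = A * (\<Prod>i\<in>UNIV. ?g i (\<omega> $ i))" for \<omega> :: "real^'n"
  proof -
    have "(\<Prod>i\<in>UNIV. ?g i (\<omega> $ i)) = exp (\<Sum>i\<in>UNIV. complex_of_real (- (4 * pi\<^sup>2 * c) * (\<omega> $ i)\<^sup>2) + \<i> * complex_of_real (2 * pi * y $ i * \<omega> $ i))"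
      by (simp add: exp_sum)
    also have "(\<Sum>i\<in>UNIV. complex_of_real (- (4 * pi\<^sup>2 * c) * (\<omega> $ i)\<^sup>2) + \<i> * complex_of_real (2 * pi * y $ i * \<omega> $ i))
        = complex_of_real (- (4 * pi\<^sup>2 * c) * (norm \<omega>)\<^sup>2) + \<i> * of_real (2 * pi * (y \<bullet> \<omega>))"
      unfolding norm2 inner_vec_def sum.distrib sum_distrib_left[symmetric] of_real_sum[symmetric]
      by (simp add: sum_distrib_left mult_ac)
    also have "exp \<dots> = of_real (exp (- (4 * pi\<^sup>2 * c) * (norm \<omega>)\<^sup>2)) * exp (\<i> * of_real (2 * pi * (y \<bullet> \<omega>)))"
      by (simp only: exp_add exp_of_real)
    moreover have "mehler_symbol r (x, \<omega>) = (2 / (1 + r)) ^ CARD('n) * exp (- c * (norm x)\<^sup>2) * exp (- (4 * pi\<^sup>2 * c) * (norm \<omega>)\<^sup>2)"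
      by (simp add: mehler_symbol_def phase_form_def c_def algebra_simps flip: exp_add)
    ultimately show ?thesis unfolding A_def by (simp only: of_real_mult mult.assoc)
  qed
  note G = lborel_prod_vec[of ?g, OF gaussian_fourier(1)[OF a]]
  show "integrable lborel (\<lambda>\<omega>. of_real (mehler_symbol r (x, \<omega>)) * exp (\<i> * of_real (2 * pi * (y \<bullet> \<omega>))))"
    unfolding eq by (intro integrable_mult_right G(1))
  have "(LINT \<omega>|lborel. of_real (mehler_symbol r (x, \<omega>)) * exp (\<i> * of_real (2 * pi * (y \<bullet> \<omega>))))
      = A * (\<Prod>i\<in>UNIV. LINT s|lborel. ?g i s)"
    unfolding eq by (simp only: integral_mult_right_zero G(2))
  also have "\<dots> = A * of_real (\<Prod>i\<in>UNIV. sqrt (pi / (4 * pi\<^sup>2 * c)) * exp (- (2 * pi * y $ i)\<^sup>2 / (4 * (4 * pi\<^sup>2 * c))))"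
    by (simp only: gaussian_fourier(2)[OF a] of_real_prod)
  also have "\<dots> = of_real (\<Prod>i\<in>UNIV. (2 / (1 + r)) * exp (- c * (x $ i)\<^sup>2) * (sqrt (pi / (4 * pi\<^sup>2 * c)) * exp (- (2 * pi * y $ i)\<^sup>2 / (4 * (4 * pi\<^sup>2 * c)))))"
  proof -
    have "(2 / (1 + r)) ^ CARD('n) * exp (- c * (norm x)\<^sup>2) = (\<Prod>i\<in>UNIV. (2 / (1 + r)) * exp (- c * (x $ i)\<^sup>2))"
    proof -
      have "- c * (norm x)\<^sup>2 = (\<Sum>i\<in>UNIV. - c * (x $ i)\<^sup>2)"
        by (simp only: norm2 sum_distrib_left)
      then have "exp (- c * (norm x)\<^sup>2) = (\<Prod>i\<in>UNIV. exp (- c * (x $ i)\<^sup>2))"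
        by (simp only: exp_sum[OF finite])
      then show ?thesis by (simp only: prod.distrib prod_constant)
    qed
    then show ?thesis unfolding A_def of_real_mult[symmetric] by (simp only: prod.distrib)
  qed
  also have "\<dots> = of_real (mehler_vec r (x + (1/2) *\<^sub>R y) (x - (1/2) *\<^sub>R y))"
    unfolding mehler_vec_def
  proof (intro arg_cong[of _ _ of_real] prod.cong refl)
    fix i
    let ?X = "x $ i" and ?Y = "y $ i"
    \<comment> \<open>Because (1 + r)^2 c = 1 - r^2; this identity fixes the constant 2 / (1 + r) in
      the symbol.\<close>
    have "(2 / (1 + r)) * sqrt (pi / (4 * pi\<^sup>2 * c)) = 1 / sqrt (pi * (1 - r\<^sup>2))"
    proof -
      have "(2 / (1 + r)) * sqrt (pi / (4 * pi\<^sup>2 * c)) = sqrt ((2 / (1 + r))\<^sup>2 * (pi / (4 * pi\<^sup>2 * c)))"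
        using r by (subst real_sqrt_mult) simp
      also have "(2 / (1 + r))\<^sup>2 * (pi / (4 * pi\<^sup>2 * c)) = 1 / (pi * (1 - r\<^sup>2))"
      proof -
        have "1 - r\<^sup>2 = (1 + r) * (1 - r)" by (simp add: algebra_simps power2_eq_square)
        moreover have "(2 / a)\<^sup>2 * (pi / (4 * pi\<^sup>2 * (b / a))) = 1 / (pi * (a * b))" if "a > 0" "b > 0" for a b :: real
          using that by (simp add: power2_eq_square field_simps)
        ultimately show ?thesis using r by (simp add: c_def cayley_def)
      qed
      finally show ?thesis by (simp add: real_sqrt_divide)
    qed
    moreover have "exp (- c * ?X\<^sup>2) * exp (- (2 * pi * ?Y)\<^sup>2 / (4 * (4 * pi\<^sup>2 * c)))
      = exp (- ((1 - r) / (1 + r) * ((?X + ?Y / 2) + (?X - ?Y / 2))\<^sup>2 / 4) - (1 + r) / (1 - r) * ((?X + ?Y / 2) - (?X - ?Y / 2))\<^sup>2 / 4)"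
    proof -
      have q1: "(2 * pi * ?Y)\<^sup>2 / (4 * (4 * pi\<^sup>2 * c)) = (1 + r) / (1 - r) * ?Y\<^sup>2 / 4"
      proof -
        have "(2 * pi * s)\<^sup>2 / (4 * (4 * pi\<^sup>2 * (b / a))) = a / b * s\<^sup>2 / 4" if "a > 0" "b > 0" for a b s :: real
          using that by (simp add: power2_eq_square field_simps)
        then show ?thesis using r by (simp add: c_def cayley_def)
      qed
      have q2: "c * ?X\<^sup>2 = (1 - r) / (1 + r) * (4 * ?X\<^sup>2) / 4"
      proof -
        have "a * s = a * (4 * s) / 4" for a s :: real by simp
        then show ?thesis unfolding c_def cayley_def .
      qed
      have q3: "((?X + ?Y / 2) + (?X - ?Y / 2))\<^sup>2 = 4 * ?X\<^sup>2" "((?X + ?Y / 2) - (?X - ?Y / 2))\<^sup>2 = ?Y\<^sup>2"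
        by (simp_all add: power2_eq_square)
      show ?thesis
        unfolding mult_exp_exp q3 minus_mult_left[symmetric] minus_divide_left[symmetric] q1 q2
        by simp
    qed
    moreover have "(2 / (1 + r)) * exp (- c * ?X\<^sup>2) * (sqrt (pi / (4 * pi\<^sup>2 * c)) * exp (- (2 * pi * ?Y)\<^sup>2 / (4 * (4 * pi\<^sup>2 * c))))
      = ((2 / (1 + r)) * sqrt (pi / (4 * pi\<^sup>2 * c))) * (exp (- c * ?X\<^sup>2) * exp (- (2 * pi * ?Y)\<^sup>2 / (4 * (4 * pi\<^sup>2 * c))))"
      by (simp only: mult_ac)
    moreover have "(x + (1/2) *\<^sub>R y) $ i = ?X + ?Y / 2" "(x - (1/2) *\<^sub>R y) $ i = ?X - ?Y / 2" by simp_all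
    ultimately show "(2 / (1 + r)) * exp (- c * ?X\<^sup>2) * (sqrt (pi / (4 * pi\<^sup>2 * c)) * exp (- (2 * pi * ?Y)\<^sup>2 / (4 * (4 * pi\<^sup>2 * c))))
      = mehler r ((x + (1/2) *\<^sub>R y) $ i) ((x - (1/2) *\<^sub>R y) $ i)"
      unfolding mehler_def by (simp only: times_divide_eq_left mult_1_left)
  qed
  finally show "(LINT \<omega>|lborel. of_real (mehler_symbol r (x, \<omega>)) * exp (\<i> * of_real (2 * pi * (y \<bullet> \<omega>))))
      = complex_of_real (mehler_vec r (x + (1/2) *\<^sub>R y) (x - (1/2) *\<^sub>R y))" .
qed


lemma mehler_vec_bounds:
  assumes "0 \<le> r" "r < 1"
  shows "0 \<le> mehler_vec r u v" "mehler_vec r u (v :: real^'n) \<le> inverse (sqrt (pi * (1 - r\<^sup>2))) ^ CARD('n)"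
proof -
  show "0 \<le> mehler_vec r u v"
    unfolding mehler_vec_def using assms by (intro prod_nonneg mehler_nonneg ballI) auto
  have "mehler_vec r u v \<le> (\<Prod>i\<in>(UNIV :: 'n set). inverse (sqrt (pi * (1 - r\<^sup>2))))"
    unfolding mehler_vec_def using assms by (intro prod_mono conjI mehler_nonneg mehler_le) auto
  then show "mehler_vec r u v \<le> inverse (sqrt (pi * (1 - r\<^sup>2))) ^ CARD('n)" by simp
qed

lemma cnj_wig_integrand:
  "cnj (wig_integrand g f x \<omega> y)
     = exp (\<i> * of_real (2 * pi * (y \<bullet> \<omega>))) * (cnj (g (x + (1/2) *\<^sub>R y)) * f (x - (1/2) *\<^sub>R y))"
  by (simp add: wig_integrand_def exp_cnj mult_ac)

lemma integrable_mehler_symbol_wigner: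
  fixes f g :: "real^'n \<Rightarrow> complex"
  assumes f: "f \<in> schwartz" and g: "g \<in> schwartz" and r: "0 \<le> r" "r \<le> 1"
  shows "integrable lborel (\<lambda>z. of_real (mehler_symbol r z) * cnj (wigner g f z))"
proof (rule Bochner_Integration.integrable_bound)
  have W: "integrable lborel (wigner g f)" by (rule wigner_integrable[OF g f])
  then have [measurable]: "wigner g f \<in> borel_measurable borel" by simp
  show "integrable lborel (\<lambda>z. 2 ^ CARD('n) * norm (wigner g f z))"
    by (intro integrable_mult_right integrable_norm W)
  show "(\<lambda>z. of_real (mehler_symbol r z) * cnj (wigner g f z)) \<in> borel_measurable lborel"
    by measurable
  show "AE z in lborel. norm (of_real (mehler_symbol r z) * cnj (wigner g f z)) \<le> norm (2 ^ CARD('n) * norm (wigner g f z))"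
    using mehler_symbol_bounds[where 'n = 'n, OF r] by (intro AE_I2) (auto simp: norm_mult intro!: mult_right_mono)
qed

text \<open>For fixed x the integral over \<omega> and y converges absolutely, a Gaussian in
  \<omega> against an integrable function of y, so Fubini is applied slice by slice. What remains is
  the kernel at x + y/2 and x - y/2, bounded for r < 1, so the change of variables applies.\<close>

lemma mehler_symbol_wigner_open:
  fixes f g :: "real^'n \<Rightarrow> complex"
  assumes f: "f \<in> schwartz" and g: "g \<in> schwartz" and r: "0 \<le> r" "r < 1"
  shows "(\<lambda>k. of_real r ^ k * hermite_level f g k) sums
    (LINT z|lborel. of_real (mehler_symbol r z) * cnj (wigner g f z))"
proof -
  let ?M = "lborel \<Otimes>\<^sub>M lborel :: ((real^'n) \<times> (real^'n)) measure"
  have [measurable]: "f \<in> borel_measurable borel" "g \<in> borel_measurable borel"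
    using f g by (auto intro: borel_measurable_schwartz)
  define P where "P x y = cnj (g (x + (1/2) *\<^sub>R y)) * f (x - (1/2) *\<^sub>R y)" for x y
  define H where "H p = of_real (mehler_vec r (fst p) (snd p)) * (cnj (g (fst p)) * f (snd p))" for p
  let ?e = "\<lambda>y \<omega>. exp (\<i> * complex_of_real (2 * pi * (y \<bullet> \<omega>)))"
  let ?S = "\<lambda>x \<omega>. complex_of_real (mehler_symbol r (x, \<omega>))"
  obtain b :: "real^'n" where b: "b \<in> Basis" using nonempty_Basis by blast
  have wi: "integrable lborel (wig_integrand g f x \<omega>)" for x \<omega>
    using wig_integrable(1)[OF g f b, of 0 0] by simp
  have Pi: "integrable lborel (P x)" for x
  proof (rule Bochner_Integration.integrable_bound[OF wi[of x 0]])
    show "P x \<in> borel_measurable lborel" unfolding P_def[abs_def] by measurable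
  qed (auto simp: norm_wig_integrand P_def norm_mult)
  have W: "cnj (wigner g f (x, \<omega>)) = (LINT y|lborel. ?e y \<omega> * P x y)" for x \<omega>
    unfolding wigner_eq Bochner_Integration.integral_cnj[symmetric] cnj_wig_integrand P_def ..
  have Hi: "integrable ?M H"
  proof (rule Bochner_Integration.integrable_bound)
    let ?K = "inverse (sqrt (pi * (1 - r\<^sup>2))) ^ CARD('n)"
    have "integrable lborel (\<lambda>u. cnj (g u))"
      using schwartz_integrable(1)[OF g] by (simp add: integrable_cnj)
    from lborel_pair_mult(1)[OF this schwartz_integrable(1)[OF f]]
    show "integrable ?M (\<lambda>p. of_real ?K * (cnj (g (fst p)) * f (snd p)))"
      by (intro integrable_mult_right) (simp add: case_prod_unfold)
    have "(\<lambda>p. mehler_vec r (fst p) (snd p)) \<in> borel_measurable ?M"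
      using mehler_vec_measurable[of r] by (simp add: lborel_prod borel_prod)
    then show "H \<in> borel_measurable ?M" unfolding H_def[abs_def] by measurable
    show "AE p in ?M. norm (H p) \<le> norm (of_real ?K * (cnj (g (fst p)) * f (snd p)))"
    proof (intro AE_I2)
      fix p :: "(real^'n) \<times> (real^'n)"
      have "\<bar>mehler_vec r (fst p) (snd p)\<bar> \<le> \<bar>?K\<bar>"
        using mehler_vec_bounds[OF r, of "fst p" "snd p"] by linarith
      then show "norm (H p) \<le> norm (of_real ?K * (cnj (g (fst p)) * f (snd p)))"
        unfolding H_def norm_mult[of "of_real _"] norm_of_real by (intro mult_right_mono) auto
    qed
  qed
  have slice: "(LINT \<omega>|lborel. ?S x \<omega> * cnj (wigner g f (x, \<omega>))) = (LINT y|lborel. H (x + (1/2) *\<^sub>R y, x - (1/2) *\<^sub>R y))" for x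
  proof -
    have Si: "integrable lborel (?S x)"
      using mehler_symbol_fourier(1)[OF r, of x 0] by simp
    have int: "integrable ?M (\<lambda>(\<omega>, y). ?S x \<omega> * (?e y \<omega> * P x y))"
    proof (rule Bochner_Integration.integrable_bound[OF lborel_pair_mult(1)[OF Si Pi[of x]]])
      have [measurable]: "P x \<in> borel_measurable borel" unfolding P_def[abs_def] by measurable
      have [measurable]: "?S x \<in> borel_measurable borel" using Si by auto
      show "(\<lambda>(\<omega>, y). ?S x \<omega> * (?e y \<omega> * P x y)) \<in> borel_measurable ?M" by measurable
    qed (auto simp: norm_mult)
    have "(LINT \<omega>|lborel. ?S x \<omega> * cnj (wigner g f (x, \<omega>))) = (LINT \<omega>|lborel. LINT y|lborel. ?S x \<omega> * (?e y \<omega> * P x y))"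
      unfolding W by simp
    also have "\<dots> = (LINT y|lborel. LINT \<omega>|lborel. ?S x \<omega> * (?e y \<omega> * P x y))"
      using lborel_pair.Fubini_integral[OF int] by simp
    also have "\<dots> = (LINT y|lborel. (LINT \<omega>|lborel. ?S x \<omega> * ?e y \<omega>) * P x y)"
      by (simp only: mult.assoc[symmetric] integral_mult_left_zero)
    also have "\<dots> = (LINT y|lborel. H (x + (1/2) *\<^sub>R y, x - (1/2) *\<^sub>R y))"
      unfolding mehler_symbol_fourier(2)[OF r] by (simp add: H_def P_def)
    finally show ?thesis .
  qed
  have "(LINT z|lborel. of_real (mehler_symbol r z) * cnj (wigner g f z))
      = (LINT x|lborel. LINT \<omega>|lborel. ?S x \<omega> * cnj (wigner g f (x, \<omega>)))"
    using integrable_mehler_symbol_wigner[OF f g r(1) less_imp_le[OF r(2)]]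
      lborel_pair.integral_fst'[of "\<lambda>z. of_real (mehler_symbol r z) * cnj (wigner g f z)"]
    by (simp add: lborel_prod)
  also have "\<dots> = (LINT x|lborel. LINT y|lborel. H (x + (1/2) *\<^sub>R y, x - (1/2) *\<^sub>R y))"
    unfolding slice ..
  also have "\<dots> = (LINT p|?M. H p)"
    by (rule lborel_pair_change_of_variables[OF Hi])
  finally show ?thesis
    using hermite_level_kernel[OF schwartz_integrable(2)[OF f] schwartz_integrable(2)[OF g] r]
    by (simp add: H_def)
qed

text \<open>
  The endpoint \<open>r = 1\<close>, where the symbol is constant and the sum is \<open>\<langle>f, g\<rangle>\<close>, is reached by
  continuity; this is what makes a separate completeness proof for the Hermite functions unnecessary.
\<close>

lemma mehler_symbol_wigner:
  fixes f g :: "real^'n \<Rightarrow> complex"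
  assumes f: "f \<in> schwartz" and g: "g \<in> schwartz" and r: "0 \<le> r" "r \<le> 1"
  shows "(\<lambda>k. of_real r ^ k * hermite_level f g k) sums
    (LINT z|lborel. of_real (mehler_symbol r z) * cnj (wigner g f z))"
proof (cases "r < 1")
  case True
  then show ?thesis using mehler_symbol_wigner_open f g r by blast
next
  case False
  then have r1: "r = 1" using r by simp
  define R where "R n = 1 - inverse (real (Suc n))" for n
  have R: "0 \<le> R n" "R n < 1" for n by (auto simp: R_def field_simps)
  have Rlim: "R \<longlonglongrightarrow> 1" unfolding R_def by real_asymp
  let ?A = "\<lambda>r. LINT z|lborel. of_real (mehler_symbol r z) * cnj (wigner g f z)"
  let ?l = "hermite_level f g"
  have [measurable]: "wigner g f \<in> borel_measurable borel"
    using wigner_integrable[OF g f] by simp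
  have sm: "summable (\<lambda>k. norm (?l k))"
    by (intro summable_hermite_level schwartz_integrable f g)
  have A: "?A (R n) = (\<Sum>k. of_real (R n) ^ k * ?l k)" for n
    using mehler_symbol_wigner_open[OF f g R] by (simp add: sums_iff)
  \<comment> \<open>On the series side the terms are dominated by the absolutely summable levels.
    The integral side below is dominated by 2^d times the modulus of the Wigner transform, a bound
    valid up to r = 1.\<close>
  have l1: "(\<lambda>n. ?A (R n)) \<longlonglongrightarrow> (\<Sum>k. 1 * ?l k)"
    unfolding A
  proof (rule tannerys_theorem[THEN conjunct2, THEN conjunct2, OF _ _ sm])
    show "(\<lambda>n. complex_of_real (R n) ^ k * ?l k) \<longlonglongrightarrow> 1 * ?l k" for k
    proof -
      have "(\<lambda>n. complex_of_real (R n)) \<longlonglongrightarrow> of_real 1" by (intro tendsto_of_real Rlim)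
      from tendsto_mult[OF tendsto_power[OF this, of k] tendsto_const[of "?l k"]] show ?thesis by simp
    qed
    have "norm (complex_of_real (R n) ^ k * ?l k) \<le> norm (?l k)" for k n
    proof -
      have "R n ^ k \<le> 1" using R[of n] by (intro power_le_one) auto
      then show ?thesis using R[of n] by (auto simp: norm_mult norm_power intro!: mult_left_le_one_le)
    qed
    then show "\<forall>\<^sub>F (k, n) in sequentially \<times>\<^sub>F sequentially. norm (complex_of_real (R n) ^ k * ?l k) \<le> norm (?l k)"
      by (intro always_eventually) auto
  qed auto
  have l2: "(\<lambda>n. ?A (R n)) \<longlonglongrightarrow> ?A 1"
  proof (rule integral_dominated_convergence[where w = "\<lambda>z. 2 ^ CARD('n) * norm (wigner g f z)"])
    show "integrable lborel (\<lambda>z. 2 ^ CARD('n) * norm (wigner g f z))"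
      by (intro integrable_mult_right integrable_norm wigner_integrable f g)
    show "AE z in lborel. (\<lambda>n. of_real (mehler_symbol (R n) z) * cnj (wigner g f z)) \<longlonglongrightarrow> of_real (mehler_symbol 1 z) * cnj (wigner g f z)"
      unfolding mehler_symbol_def cayley_def
      by (intro AE_I2 tendsto_intros Rlim) auto
    show "AE z in lborel. norm (of_real (mehler_symbol (R n) z) * cnj (wigner g f z)) \<le> 2 ^ CARD('n) * norm (wigner g f z)" for n
      using mehler_symbol_bounds[where 'n = 'n, of "R n"] R[of n] by (intro AE_I2) (auto simp: norm_mult intro!: mult_right_mono)
    show "(\<lambda>z. of_real (mehler_symbol 1 z) * cnj (wigner g f z)) \<in> borel_measurable lborel"
      "(\<lambda>z. of_real (mehler_symbol (R n) z) * cnj (wigner g f z)) \<in> borel_measurable lborel" for n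
      by measurable
  qed
  have "?A 1 = (\<Sum>k. ?l k)"
    using LIMSEQ_unique[OF l2 l1] by simp
  then show ?thesis
    using summable_norm_cancel[OF sm] r1 by (simp add: summable_sums)
qed

section \<open>The Hermite semigroup\<close>

lemma phase_form_derivative:
  "(phase_form has_derivative (\<lambda>h. z \<bullet> (2 *\<^sub>R fst h, (8 * pi\<^sup>2) *\<^sub>R snd h))) (at (z :: (real^'n) \<times> (real^'n)))"
proof -
  have eq: "phase_form = (\<lambda>z :: (real^'n) \<times> (real^'n). fst z \<bullet> fst z + 4 * pi\<^sup>2 * (snd z \<bullet> snd z))"
    by (simp add: fun_eq_iff phase_form_def power2_norm_eq_inner)
  show ?thesis unfolding eq
    by (auto intro!: derivative_eq_intros simp: fun_eq_iff inner_prod_def inner_commute algebra_simps)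
qed

lemma norm_square_le_phase_form: "(norm z)\<^sup>2 \<le> phase_form z"
proof -
  have "1 \<le> 4 * pi\<^sup>2" using power_mono[of 2 pi 2] pi_ge_two by simp
  then have "1 * (norm (snd z))\<^sup>2 \<le> 4 * pi\<^sup>2 * (norm (snd z))\<^sup>2"
    by (rule mult_right_mono) simp
  then show ?thesis by (simp add: phase_form_def norm_prod_def)
qed

text \<open>Two exchanges are made: of the sum and the average over M, dominated by |<P_k f, g>|,
  and of that average and the phase space integral, dominated by 2^d |W|.\<close>

lemma (in unit_distribution) weyl_symbol_average:
  fixes f g :: "real^'n \<Rightarrow> complex"
  assumes f: "f \<in> schwartz" and g: "g \<in> schwartz"
  shows "(\<lambda>k. of_real (LINT r|M. r ^ k) * hermite_level f g k) sums
    bracket (\<lambda>z. of_real (radial_symbol (CARD('n)) M 0 (phase_form z))) (wigner g f)"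
proof -
  let ?l = "hermite_level f g"
  let ?W = "\<lambda>z. cnj (wigner g f z)"
  \<comment> \<open>M sits on [0, 1] only almost surely; the clamp makes the bounds and
    \<open>mehler_symbol_wigner\<close> available for every r without changing any integral.\<close>
  let ?c = "\<lambda>r. max 0 (min 1 r)"
  have c: "0 \<le> ?c r" "?c r \<le> 1" for r :: real by auto
  have cAE: "AE r in M. ?c r = r" using unit by (auto elim!: AE_mp)
  have sm: "summable (\<lambda>k. norm (?l k))"
    by (intro summable_hermite_level schwartz_integrable f g)
  have W: "integrable lborel (wigner g f)" by (rule wigner_integrable[OF g f])
  have [measurable]: "wigner g f \<in> borel_measurable borel" using W by simp
  have "(\<lambda>k. LINT r|M. of_real (?c r) ^ k * ?l k) sums (LINT r|M. (\<Sum>k. of_real (?c r) ^ k * ?l k))"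
  proof (rule sums_integral)
    have le: "norm (of_real (?c r) ^ k * ?l k) \<le> norm (?l k)" for k r
      using c[of r] power_le_one[OF c, of r k] by (auto simp: norm_mult norm_power intro!: mult_left_le_one_le)
    show i: "integrable M (\<lambda>r. of_real (?c r) ^ k * ?l k)" for k
      by (rule integrable_bounded_unit[OF _ le]) measurable
    show "AE r in M. summable (\<lambda>k. norm (of_real (?c r) ^ k * ?l k))"
      by (intro AE_I2 summable_comparison_test[OF _ sm] exI[of _ 0]) (use le in auto)
    have "(LINT r|M. norm (of_real (?c r) ^ k * ?l k)) \<le> norm (?l k)" for k
      using integral_mono[OF integrable_norm[OF i[of k]] integrable_const[of "norm (?l k)"] le[of _ k]] prob_space
      by simp
    then show "summable (\<lambda>k. LINT r|M. norm (of_real (?c r) ^ k * ?l k))"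
      by (intro summable_comparison_test[OF _ sm] exI[of _ 0]) (auto simp: Bochner_Integration.integral_nonneg)
  qed
  moreover have "(LINT r|M. of_real (?c r) ^ k * ?l k) = of_real (LINT r|M. r ^ k) * ?l k" for k
  proof -
    have "(LINT r|M. of_real (?c r) ^ k * ?l k) = (LINT r|M. complex_of_real (r ^ k)) * ?l k"
      unfolding integral_mult_left_zero[symmetric]
    proof (rule integral_cong_AE)
      show "AE r in M. of_real (?c r) ^ k * ?l k = complex_of_real (r ^ k) * ?l k"
        using cAE by eventually_elim (simp only: of_real_power)
    qed measurable
    also have "(LINT r|M. complex_of_real (r ^ k)) = of_real (LINT r|M. r ^ k)"
      by (rule integral_of_real, rule integrable_bounded_unit[of _ 1]) (auto simp: power_le_one power_abs)
    finally show ?thesis .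
  qed
  moreover have "(LINT r|M. (\<Sum>k. of_real (?c r) ^ k * ?l k))
      = bracket (\<lambda>z. of_real (radial_symbol (CARD('n)) M 0 (phase_form z))) (wigner g f)"
  proof -
    interpret pair: pair_sigma_finite M "lborel :: ((real^'n) \<times> (real^'n)) measure" ..
    have int: "integrable (M \<Otimes>\<^sub>M lborel) (\<lambda>(r, z). of_real (mehler_symbol (?c r) z) * ?W z)"
    proof (rule Bochner_Integration.integrable_bound)
      have "integrable (M \<Otimes>\<^sub>M lborel) (\<lambda>(r, z). 2 ^ CARD('n) * norm (wigner g f z))"
        by (rule pair.Fubini_integrable) (use W in \<open>auto intro!: integrable_mult_right integrable_norm\<close>)
      then show "integrable (M \<Otimes>\<^sub>M lborel) (\<lambda>(r, z). 2 ^ CARD('n) * norm (wigner g f z))" .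
      have "(\<lambda>p. mehler_symbol (?c (fst p)) (snd p)) \<in> borel_measurable (M \<Otimes>\<^sub>M (lborel :: ((real^'n) \<times> (real^'n)) measure))"
        by (rule measurable_compose[OF _ mehler_symbol_measurable, of "\<lambda>p. (?c (fst p), snd p)", simplified]) measurable
      then show "(\<lambda>(r, z). of_real (mehler_symbol (?c r) z) * ?W z) \<in> borel_measurable (M \<Otimes>\<^sub>M lborel)"
        unfolding case_prod_unfold by measurable
      show "AE p in M \<Otimes>\<^sub>M lborel. norm (case p of (r, z) \<Rightarrow> of_real (mehler_symbol (?c r) z) * ?W z)
          \<le> norm (case p of (r, z) \<Rightarrow> 2 ^ CARD('n) * norm (wigner g f z))"
        using mehler_symbol_bounds[where 'n = 'n, OF c]
        by (intro AE_I2) (auto simp: norm_mult intro!: mult_right_mono)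
    qed
    have "(LINT r|M. (\<Sum>k. of_real (?c r) ^ k * ?l k)) = (LINT r|M. LINT z|lborel. of_real (mehler_symbol (?c r) z) * ?W z)"
      using mehler_symbol_wigner[OF f g c] by (simp add: sums_iff)
    also have "\<dots> = (LINT z|lborel. LINT r|M. of_real (mehler_symbol (?c r) z) * ?W z)"
      using pair.Fubini_integral[OF int] by simp
    also have "\<dots> = (LINT z|lborel. of_real (radial_symbol (CARD('n)) M 0 (phase_form z)) * ?W z)"
    proof -
      have "(LINT r|M. complex_of_real (mehler_symbol (?c r) z)) = of_real (radial_symbol (CARD('n)) M 0 (phase_form z))" for z :: "(real^'n) \<times> (real^'n)"
      proof -
        have "(LINT r|M. complex_of_real (mehler_symbol (?c r) z)) = of_real (LINT r|M. mehler_symbol (?c r) z)"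
        proof (rule integral_of_real, rule integrable_bounded_unit)
          show "(\<lambda>r. mehler_symbol (?c r) z) \<in> borel_measurable borel"
            unfolding mehler_symbol_def by measurable
          show "norm (mehler_symbol (?c r) z) \<le> 2 ^ CARD('n)" for r
            using mehler_symbol_bounds[OF c, of r z] by simp
        qed
        also have "(LINT r|M. mehler_symbol (?c r) z) = radial_symbol (CARD('n)) M 0 (phase_form z)"
          unfolding radial_symbol_def mehler_symbol_def
          by (rule integral_cong_AE) (use cAE in \<open>auto elim!: AE_mp\<close>)
        finally show ?thesis .
      qed
      then show ?thesis by (simp only: integral_mult_left_zero)
    qed
    finally show ?thesis unfolding bracket_def .
  qed
  ultimately show ?thesis by (simp only:)
qed

theorem mainTheorem2:
  fixes \<beta> T :: real
  assumes "0 < \<beta>" and "\<beta> \<le> 1" and "0 < T"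
  shows "\<exists>b :: real \<Rightarrow> (real^'n) \<times> (real^'n) \<Rightarrow> complex.
           (\<forall>t\<in>{0..T}. b t \<in> shubin_class \<and> has_weyl_symbol (hermite_semigroup \<beta> t) (b t)) \<and>
           (\<forall>k. (SUP t\<in>{0..T}. shubin_seminorm k (b t)) < \<infinity>)"
proof -
  let ?d = "CARD('n)"
  have d: "0 < ?d" by simp
  define c where "c t = exp (- t * real ?d powr \<beta>)" for t
  have c: "0 < c t" "c t \<le> 1" if "0 \<le> t" for t using that by (auto simp: c_def)
  have "\<forall>t\<in>{0..T}. \<exists>M. real_distribution M \<and> (AE x in M. 0 \<le> x \<and> x \<le> 1) \<and>
      (\<forall>k. exp (- t * real (2 * k + ?d) powr \<beta>) = c t * (LINT x|M. x ^ k))"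
    unfolding c_def using assms d by (intro ballI subordination_moments) auto
  \<comment> \<open>The measures are chosen independently for each t; uniformity will come from
    bounds that hold for every distribution on [0, 1].\<close>
  then obtain M where M: "\<And>t. t \<in> {0..T} \<Longrightarrow> unit_distribution (M t)"
    and mom: "\<And>t k. t \<in> {0..T} \<Longrightarrow> exp (- t * real (2 * k + ?d) powr \<beta>) = c t * (LINT x|M t. x ^ k)"
    unfolding unit_distribution_def unit_distribution_axioms_def by metis
  define \<phi> where "\<phi> t m q = c t * radial_symbol ?d (M t) m q" for t m q
  have \<phi>d: "(\<phi> t m has_real_derivative - \<phi> t (Suc m) q) (at q)" if "t \<in> {0..T}" for t m q
    unfolding \<phi>_def
    using DERIV_cmult[OF unit_distribution.radial_symbol_derivative[OF M[OF that]], of "c t"] by simp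
  \<comment> \<open>The prefactor \<open>c t\<close> is at most 1 for t \<ge> 0 and
    \<open>radial_symbol_bound\<close> does not depend on the measure, so the constant is free of t
    and even of T.\<close>
  have \<phi>b: "\<exists>C. \<forall>t\<in>{0..T}. \<forall>q\<ge>0. \<bar>\<phi> t m q\<bar> * (1 + q) ^ m \<le> C" for m
  proof (intro exI ballI allI impI)
    fix t q :: real assume t: "t \<in> {0..T}" and q: "0 \<le> q"
    have "\<bar>\<phi> t m q\<bar> * (1 + q) ^ m = c t * (\<bar>radial_symbol ?d (M t) m q\<bar> * (1 + q) ^ m)"
      using c[of t] t by (simp add: \<phi>_def abs_mult)
    also have "\<dots> \<le> 1 * (2 ^ ?d * (fact m * exp 1))"
    proof (rule mult_mono)
      show "\<bar>radial_symbol ?d (M t) m q\<bar> * (1 + q) ^ m \<le> 2 ^ ?d * (fact m * exp 1)"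
        by (rule unit_distribution.radial_symbol_bound[OF M[OF t] q])
    qed (use c[of t] t q in auto)
    finally show "\<bar>\<phi> t m q\<bar> * (1 + q) ^ m \<le> 1 * (2 ^ ?d * (fact m * exp 1))" .
  qed
  define b where "b t z = complex_of_real (\<phi> t 0 (phase_form z))" for t and z :: "(real^'n) \<times> (real^'n)"
  note shubin = shubin_of_quadratic[where S = "{0..T}" and \<phi> = \<phi> and Q = phase_form,
      OF _ \<phi>b phase_form_derivative norm_square_le_phase_form]
  have S: "b t \<in> shubin_class" if "t \<in> {0..T}" for t
    unfolding b_def[abs_def] by (rule shubin(1)[OF _ that]) (rule \<phi>d)
  have S': "(SUP t\<in>{0..T}. shubin_seminorm k (b t)) < \<infinity>" for k
    unfolding b_def[abs_def] by (rule shubin(2)) (rule \<phi>d)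
  have "has_weyl_symbol (hermite_semigroup \<beta> t) (b t)" if t: "t \<in> {0..T}" for t
    unfolding has_weyl_symbol_def weyl_op_def
  proof (intro ballI)
    fix f g :: "real^'n \<Rightarrow> complex" assume f: "f \<in> schwartz" and g: "g \<in> schwartz"
    interpret unit_distribution "M t" by (rule M[OF t])
    have "(\<lambda>k. of_real (c t) * (of_real (LINT r|M t. r ^ k) * hermite_level f g k)) sums
       (of_real (c t) * bracket (\<lambda>z. of_real (radial_symbol ?d (M t) 0 (phase_form z))) (wigner g f))"
      by (intro sums_mult weyl_symbol_average f g)
    moreover have "of_real (c t) * bracket (\<lambda>z. of_real (radial_symbol ?d (M t) 0 (phase_form z))) (wigner g f) = bracket (b t) (wigner g f)"
      unfolding b_def[abs_def] \<phi>_def of_real_mult by (rule bracket_scale[symmetric])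
    moreover have "of_real (c t) * (of_real (LINT r|M t. r ^ k) * hermite_level f g k)
      = of_real (exp (- t * real (2 * k + ?d) powr \<beta>)) * hermite_level f g k" for k
      unfolding mom[OF t] by simp
    ultimately have "(\<lambda>k. of_real (exp (- t * real (2 * k + ?d) powr \<beta>)) * hermite_level f g k) sums bracket (b t) (wigner g f)"
      by simp
    \<comment> \<open>Symbol side and operator side are sums of the same series, so uniqueness of
      sums gives the identity.\<close>
    then have "bracket (b t) (wigner g f) = bracket (hermite_semigroup \<beta> t f) g"
    proof (rule sums_unique2)
      show "(\<lambda>k. of_real (exp (- t * real (2 * k + ?d) powr \<beta>)) * hermite_level f g k) sums bracket (hermite_semigroup \<beta> t f) g"
        using t by (intro hermite_semigroup_bracket schwartz_integrable f g) auto
    qed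
    then show "bracket (hermite_semigroup \<beta> t f) g = bracket (b t) (wigner g f)" ..
  qed
  with S S' show ?thesis by (intro exI[of _ b]) blast
qed

end
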